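(* Let $A=\{a_1,\dots,a_N\}\subset\mathbb{R}^m$ be a set of $N\ge2$ distinct points, $A^c=\mathbb{R}^m\setminus A$, and $$J(u)=\int\left(\tfrac12|\nabla u|^2+\chi_{A^c}(u)\right)dx .$$ Let $u:\mathbb{R}^n\to\mathbb{R}^m$ be a nonconstant minimizer of $J$ with $\|u\|_{L^\infty(\mathbb{R}^n,\mathbb{R}^m)}<\infty$, let $x_0\in\mathbb{R}^n$ and $a_i\in A$. Then there exist constants $c>0$ and $R_0>0$, independent of $R$, such that for every $R\ge R_0$ for which $$d\big(u(B_R(x_0)),A\setminus\{a_i\}\big)>0$$ one has $$\mathcal{L}^n\big(\{u=a_i\}\cap B_R(x_0)\big)\ge cR^n .$$
   Context: $\chi_{A^c}$ is the characteristic function of $A^c$, $d$ is Euclidean distance, $\mathcal{L}^n$ is Lebesgue measure. A map $u\in W^{1,2}_{loc}(\mathbb{R}^n,\mathbb{R}^m)\cap L^\infty(\mathbb{R}^n;\mathbb{R}^m)$ is a minimizer of $J$ if $J_\Omega(u+v)\ge J_\Omega(u)$ for every $v\in W^{1,2}_0(\Omega,\mathbb{R}^m)\cap L^\infty(\Omega;\mathbb{R}^m)$ and every open bounded Lipschitz set $\Omega\subset\mathbb{R}^n$, where $J_\Omega$ is the integral over $\Omega$. Minimizers are identified with their continuous representative. *)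

theory Defs
  imports "HOL-Analysis.Analysis" "HOL-Probability.Essential_Supremum"
begin

primrec Ck_fun :: "nat \<Rightarrow> ('a::euclidean_space \<Rightarrow> 'b::real_normed_vector) \<Rightarrow> bool" where
  "Ck_fun 0 f \<longleftrightarrow> continuous_on UNIV f"
| "Ck_fun (Suc k) f \<longleftrightarrow>
     (\<forall>x. f differentiable (at x)) \<and> (\<forall>b\<in>Basis. Ck_fun k (\<lambda>x. frechet_derivative f (at x) b))"

definition test_fun_on :: "'a::euclidean_space set \<Rightarrow> ('a \<Rightarrow> 'b::real_normed_vector) \<Rightarrow> bool" where
  "test_fun_on \<Omega> f \<longleftrightarrow>
     (\<forall>k. Ck_fun k f) \<and> compact (closure {x. f x \<noteq> 0}) \<and> closure {x. f x \<noteq> 0} \<subseteq> \<Omega>"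

definition L2_on :: "'a::euclidean_space set \<Rightarrow> ('a \<Rightarrow> 'b::euclidean_space) \<Rightarrow> bool" where
  "L2_on S f \<longleftrightarrow>
     f \<in> borel_measurable (lebesgue_on S) \<and> integrable (lebesgue_on S) (\<lambda>x. (norm (f x))\<^sup>2)"

definition Linf_norm :: "'a::euclidean_space set \<Rightarrow> ('a \<Rightarrow> 'b::euclidean_space) \<Rightarrow> ereal" where
  "Linf_norm S f = esssup (lebesgue_on S) (\<lambda>x. ereal (norm (f x)))"

definition Linf_on :: "'a::euclidean_space set \<Rightarrow> ('a \<Rightarrow> 'b::euclidean_space) \<Rightarrow> bool" where
  "Linf_on S f \<longleftrightarrow> f \<in> borel_measurable (lebesgue_on S) \<and> Linf_norm S f < \<infinity>"

definition locally_integrable_on :: "'a::euclidean_space set \<Rightarrow> ('a \<Rightarrow> 'b::euclidean_space) \<Rightarrow> bool" where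
  "locally_integrable_on \<Omega> f \<longleftrightarrow> (\<forall>K. compact K \<and> K \<subseteq> \<Omega> \<longrightarrow> integrable (lebesgue_on K) f)"

definition has_weak_partial ::
  "'a::euclidean_space set \<Rightarrow> 'a \<Rightarrow> ('a \<Rightarrow> 'b::euclidean_space) \<Rightarrow> ('a \<Rightarrow> 'b) \<Rightarrow> bool" where
  "has_weak_partial \<Omega> b u g \<longleftrightarrow>
     locally_integrable_on \<Omega> u \<and> locally_integrable_on \<Omega> g \<and>
     (\<forall>\<phi> :: 'a \<Rightarrow> real. test_fun_on \<Omega> \<phi> \<longrightarrow>
        (LINT x|lebesgue_on \<Omega>. frechet_derivative \<phi> (at x) b *\<^sub>R u x)
          = - (LINT x|lebesgue_on \<Omega>. \<phi> x *\<^sub>R g x))"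

text \<open>For open \<open>\<Omega>\<close> a weak partial derivative is unique up to a null set, so the choice of the
  representative below does not affect any of the integrals in which it is used.\<close>

definition weak_partial ::
  "'a::euclidean_space set \<Rightarrow> 'a \<Rightarrow> ('a \<Rightarrow> 'b::euclidean_space) \<Rightarrow> 'a \<Rightarrow> 'b" where
  "weak_partial \<Omega> b u = (SOME g. has_weak_partial \<Omega> b u g)"

definition weak_grad_normsq ::
  "'a::euclidean_space set \<Rightarrow> ('a \<Rightarrow> 'b::euclidean_space) \<Rightarrow> 'a \<Rightarrow> real" where
  "weak_grad_normsq \<Omega> u x = (\<Sum>b\<in>Basis. (norm (weak_partial \<Omega> b u x))\<^sup>2)"

definition W12 :: "'a::euclidean_space set \<Rightarrow> ('a \<Rightarrow> 'b::euclidean_space) set" where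
  "W12 \<Omega> = {u. L2_on \<Omega> u \<and> (\<forall>b\<in>Basis. \<exists>g. has_weak_partial \<Omega> b u g \<and> L2_on \<Omega> g)}"

definition W12_loc :: "'a::euclidean_space set \<Rightarrow> ('a \<Rightarrow> 'b::euclidean_space) set" where
  "W12_loc \<Omega> = {u. (\<forall>K. compact K \<and> K \<subseteq> \<Omega> \<longrightarrow> L2_on K u) \<and>
     (\<forall>b\<in>Basis. \<exists>g. has_weak_partial \<Omega> b u g \<and> (\<forall>K. compact K \<and> K \<subseteq> \<Omega> \<longrightarrow> L2_on K g))}"

definition W12_normsq :: "'a::euclidean_space set \<Rightarrow> ('a \<Rightarrow> 'b::euclidean_space) \<Rightarrow> ennreal" where
  "W12_normsq \<Omega> u = (\<integral>\<^sup>+x. ennreal ((norm (u x))\<^sup>2 + weak_grad_normsq \<Omega> u x) \<partial>lebesgue_on \<Omega>)"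

text \<open>The closure of the test functions in \<open>W12 \<Omega>\<close>. Values outside \<open>\<Omega>\<close> are unconstrained.\<close>

definition W12_0 :: "'a::euclidean_space set \<Rightarrow> ('a \<Rightarrow> 'b::euclidean_space) set" where
  "W12_0 \<Omega> = {v \<in> W12 \<Omega>. \<exists>\<phi> :: nat \<Rightarrow> 'a \<Rightarrow> 'b.
     (\<forall>k. test_fun_on \<Omega> (\<phi> k)) \<and> (\<lambda>k. W12_normsq \<Omega> (\<lambda>x. \<phi> k x - v x)) \<longlonglongrightarrow> 0}"

text \<open>Near each boundary point, \<open>\<Omega>\<close> is the strict epigraph of a Lipschitz function \<open>\<gamma>\<close> defined on
  the hyperplane orthogonal to a unit vector \<open>e\<close>, which plays the role of the last coordinate
  direction.\<close>

definition bounded_lipschitz_open :: "'a::euclidean_space set \<Rightarrow> bool" where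
  "bounded_lipschitz_open \<Omega> \<longleftrightarrow> open \<Omega> \<and> bounded \<Omega> \<and>
     (\<forall>p\<in>frontier \<Omega>. \<exists>r>0. \<exists>e L. \<exists>\<gamma> :: 'a \<Rightarrow> real.
        norm e = 1 \<and> L-lipschitz_on {y. y \<bullet> e = 0} \<gamma> \<and>
        \<Omega> \<inter> ball p r = {x \<in> ball p r. \<gamma> (x - (x \<bullet> e) *\<^sub>R e) < x \<bullet> e})"

definition J_on ::
  "'b::euclidean_space set \<Rightarrow> 'a::euclidean_space set \<Rightarrow> ('a \<Rightarrow> 'b) \<Rightarrow> ennreal" where
  "J_on A \<Omega> u =
     (\<integral>\<^sup>+x. ennreal (1 / 2 * weak_grad_normsq \<Omega> u x + indicator (- A) (u x)) \<partial>lebesgue_on \<Omega>)"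

definition J_minimizer :: "'b::euclidean_space set \<Rightarrow> ('a::euclidean_space \<Rightarrow> 'b) \<Rightarrow> bool" where
  "J_minimizer A u \<longleftrightarrow> u \<in> W12_loc UNIV \<and> Linf_on UNIV u \<and>
     (\<forall>\<Omega> v. bounded_lipschitz_open \<Omega> \<and> v \<in> W12_0 \<Omega> \<and> Linf_on \<Omega> v \<longrightarrow>
        J_on A \<Omega> (\<lambda>x. u x + v x) \<ge> J_on A \<Omega> u)"

end

theory Submission
  imports Defs
begin

text \<open>
  If the distance hypothesis holds only for bounded \<open>R\<close>, take \<open>R\<^sub>0\<close> beyond all of them. Otherwise \<open>u\<close>
  omits \<open>A - {a}\<close> altogether, so moving \<open>u\<close> towards \<open>a\<close> never increases the potential. Let
  \<open>\<eta>\<close> be a smooth cut-off, \<open>\<eta> = 1\<close> on \<open>B\<^sub>R\<close>, supported in \<open>B\<^sub>2\<^sub>R\<close> with \<open>|\<nabla>\<eta>| \<le> C/R\<close>, and compare \<open>u\<close>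
  with \<open>u - \<eta>\<^sup>2 (u - a)\<close>, which equals \<open>a\<close> on \<open>B\<^sub>R\<close>. Because the cut-off is a square, AM-GM absorbs the
  cross term pointwise, and the energy density of the competitor plus the indicator function of
  \<open>B\<^sub>R \<inter> {u \<noteq> a}\<close> is at most that of \<open>u\<close> plus \<open>4 |\<nabla>\<eta>|\<^sup>2 |u - a|\<^sup>2\<close>. Minimality gives
  \<open>|B\<^sub>R \<inter> {u \<noteq> a}| = O(R\<^sup>n\<^sup>-\<^sup>2)\<close>, so \<open>{u = a}\<close> fills at least half of \<open>B\<^sub>R\<close> for large \<open>R\<close>; neither regularity
  theory nor a lower density bound is involved. That the perturbation is admissible (it lies in
  \<open>W12_0\<close>) follows by mollification.
\<close>

section \<open>Smooth functions of compact support\<close>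

text \<open>Two features of the definitions shape the proof. \<open>J_on\<close> is evaluated with
  partial derivatives picked by \<open>SOME\<close>, so no energy can be computed before weak
  derivatives are known to be unique almost everywhere; this is where the fundamental lemma of the
  calculus of variations enters. \<open>W12_0\<close> is a closure of smooth functions while
  \<open>u\<close> is only a Sobolev function, so explicit approximants are required; mollification
  gives them because it commutes with weak derivatives and converges in L^2 on compactly supported
  functions. The potential cannot grow because the indicator is already 1 wherever u differs from a,
  and the competitor does not move points where u = a. The remaining cost is of order R^(-2) times
  the volume R^n since u - a is essentially bounded. The radii R, 2R and 3R belong to the ball being
  estimated, the support of the cut-off and the domain on which minimality is tested. The energy of
  u on that domain is finite, so it cancels from both sides.\<close>

lemma Ck_fun_SucI:
  assumes "\<And>x. (f has_derivative f' x) (at x)"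
    and "\<And>b. b \<in> Basis \<Longrightarrow> Ck_fun k (\<lambda>x. f' x b)"
  shows "Ck_fun (Suc k) f"
proof -
  have "frechet_derivative f (at x) = f' x" for x
    using frechet_derivative_at[OF assms(1)[of x]] by simp
  then show ?thesis
    using assms by (auto simp: differentiable_def)
qed

lemma Ck_fun_has_derivative:
  assumes "Ck_fun (Suc k) f"
  shows "(f has_derivative frechet_derivative f (at x)) (at x)"
  using assms by (simp add: frechet_derivative_works)

lemma Ck_fun_SucD: "Ck_fun (Suc k) f \<Longrightarrow> Ck_fun k f"
proof (induction k arbitrary: f)
  case 0
  then show ?case
    by (simp add: continuous_on_eq_continuous_at differentiable_imp_continuous_within)
next
  case (Suc k)
  then show ?case by auto
qed

lemma Ck_fun_continuous_on: "Ck_fun k f \<Longrightarrow> continuous_on S f"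
proof (induction k)
  case 0
  then show ?case using continuous_on_subset by auto
qed (use Ck_fun_SucD in blast)

lemma Ck_fun_const: "Ck_fun k (\<lambda>x. c)"
proof (induction k arbitrary: c)
  case (Suc k)
  show ?case
    by (rule Ck_fun_SucI[where f' = "\<lambda>x h. 0"]) (auto intro: Suc)
qed simp

lemma Ck_fun_bounded_linear:
  assumes "bounded_linear f"
  shows "Ck_fun k f"
proof (cases k)
  case 0
  then show ?thesis using assms by (simp add: linear_continuous_on)
next
  case (Suc j)
  show ?thesis unfolding Suc
    by (rule Ck_fun_SucI[where f' = "\<lambda>x. f"])
      (use assms in \<open>auto simp: Ck_fun_const intro: bounded_linear_imp_has_derivative\<close>)
qed

lemma Ck_fun_add: "Ck_fun k f \<Longrightarrow> Ck_fun k g \<Longrightarrow> Ck_fun k (\<lambda>x. f x + g x)"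
proof (induction k arbitrary: f g)
  case 0
  then show ?case by (auto intro: continuous_intros)
next
  case (Suc k)
  show ?case
    by (rule Ck_fun_SucI, rule has_derivative_add[OF Ck_fun_has_derivative[OF Suc.prems(1)]
          Ck_fun_has_derivative[OF Suc.prems(2)]])
      (use Suc in auto)
qed

lemma Ck_fun_bounded_linear_comp:
  assumes "bounded_linear L"
  shows "Ck_fun k f \<Longrightarrow> Ck_fun k (\<lambda>x. L (f x))"
proof (induction k arbitrary: f)
  case 0
  then show ?case
    by (simp add: bounded_linear.continuous_on[OF assms])
next
  case (Suc k)
  show ?case
    by (rule Ck_fun_SucI, rule bounded_linear.has_derivative[OF assms Ck_fun_has_derivative[OF Suc.prems]])
      (use Suc in auto)
qed

lemma Ck_fun_scaleR:
  fixes f :: "'a::euclidean_space \<Rightarrow> real"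
  shows "Ck_fun k f \<Longrightarrow> Ck_fun k g \<Longrightarrow> Ck_fun k (\<lambda>x. f x *\<^sub>R g x)"
proof (induction k arbitrary: f g)
  case 0
  then show ?case by (auto intro: continuous_intros)
next
  case (Suc k)
  have "Ck_fun k f" "Ck_fun k g" using Suc.prems Ck_fun_SucD by blast+
  then show ?case
    by (intro Ck_fun_SucI[OF has_derivative_scaleR[OF Ck_fun_has_derivative[OF Suc.prems(1)]
          Ck_fun_has_derivative[OF Suc.prems(2)]]] Ck_fun_add Suc.IH)
      (use Suc.prems in auto)
qed

text \<open>One affine substitution covers every rescaling that occurs: dilating the bump to a
  mollifier, dilating the cut-off to radius R, and, with \<open>c = - 1\<close>, passing from \<rho>
  to the reflected kernel in a convolution.\<close>

lemma Ck_fun_affine: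
  shows "Ck_fun k f \<Longrightarrow> Ck_fun k (\<lambda>x. f (c *\<^sub>R (x - p)))"
proof (induction k arbitrary: f)
  case 0
  then show ?case
    by (auto intro!: continuous_intros intro: continuous_on_compose2[of UNIV f])
next
  case (Suc k)
  have d: "((\<lambda>x. f (c *\<^sub>R (x - p))) has_derivative
      (\<lambda>h. c *\<^sub>R frechet_derivative f (at (c *\<^sub>R (x - p))) h)) (at x)" for x
  proof -
    have "((\<lambda>x. f (c *\<^sub>R (x - p))) has_derivative
      (\<lambda>h. frechet_derivative f (at (c *\<^sub>R (x - p))) (c *\<^sub>R h))) (at x)"
      by (rule has_derivative_compose[OF _ Ck_fun_has_derivative[OF Suc.prems]])
        (auto intro!: derivative_eq_intros)
    moreover have "linear (frechet_derivative f (at (c *\<^sub>R (x - p))))"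
      using Suc.prems by (simp add: linear_frechet_derivative)
    ultimately show ?thesis by (simp add: linear_cmul)
  qed
  show ?case
    by (rule Ck_fun_SucI[OF d]) (use Suc in \<open>auto intro: Ck_fun_bounded_linear_comp[OF bounded_linear_scaleR_right]\<close>)
qed

lemma frechet_derivative_affine:
  assumes "f differentiable (at (c *\<^sub>R (x - p)))"
  shows "frechet_derivative (\<lambda>x. f (c *\<^sub>R (x - p))) (at x) h
    = c *\<^sub>R frechet_derivative f (at (c *\<^sub>R (x - p))) h"
proof -
  have "((\<lambda>x. f (c *\<^sub>R (x - p))) has_derivative
      (\<lambda>h. frechet_derivative f (at (c *\<^sub>R (x - p))) (c *\<^sub>R h))) (at x)"
    by (rule has_derivative_compose[where f = "\<lambda>x. c *\<^sub>R (x - p)"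
          and g = f, OF _ assms[unfolded frechet_derivative_works]])
      (auto intro!: derivative_eq_intros)
  then show ?thesis
    using assms by (simp add: frechet_derivative_at[symmetric] linear_cmul linear_frechet_derivative)
qed

text \<open>The family is closed under differentiation, \<open>F\<^sub>j' = F\<^sub>j\<^sub>+\<^sub>2 - j F\<^sub>j\<^sub>+\<^sub>1\<close>, so that smoothness
  follows by an induction over all \<open>j\<close> simultaneously.\<close>

definition flat_exp :: "nat \<Rightarrow> real \<Rightarrow> real" where
  "flat_exp j t = (if t > 0 then exp (- 1 / t) / t ^ j else 0)"

text \<open>From the right, the substitution s = 1/t turns the function into s^j / exp s, which
  tends to 0 at infinity; from the left it vanishes identically.\<close>

lemma flat_exp_tendsto_0: "(flat_exp j \<longlongrightarrow> 0) (at 0)"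
proof -
  have "((\<lambda>s::real. s ^ j / exp s) \<longlongrightarrow> 0) at_top"
    by (rule tendsto_power_div_exp_0)
  then have "((\<lambda>t::real. inverse t ^ j / exp (inverse t)) \<longlongrightarrow> 0) (at_right 0)"
    by (rule filterlim_compose[OF _ filterlim_inverse_at_top_right])
  then have "(flat_exp j \<longlongrightarrow> 0) (at_right 0)"
    by (rule Lim_transform_eventually)
      (auto simp: eventually_at_right_less flat_exp_def exp_minus field_simps power_inverse
        intro!: eventually_mono[OF eventually_at_right_less[of 0]])
  moreover have "(flat_exp j \<longlongrightarrow> 0) (at_left 0)"
    by (rule Lim_transform_eventually[OF tendsto_const])
      (auto simp: flat_exp_def eventually_at_filter)
  ultimately show ?thesis by (simp add: filterlim_split_at)
qed

lemma flat_exp_has_real_derivative: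
  "(flat_exp j has_real_derivative flat_exp (j + 2) t - real j * flat_exp (j + 1) t) (at t)"
proof (cases t "0::real" rule: linorder_cases)
  case less
  have "((\<lambda>t. 0) has_real_derivative 0) (at t)" by simp
  then show ?thesis
    by (rule DERIV_cong[OF has_field_derivative_transform_within_open[of _ _ _ "{..<0}"]])
      (use less in \<open>auto simp: flat_exp_def\<close>)
next
  case equal
  \<comment> \<open>For h \<noteq> 0 the difference quotient of \<open>flat_exp j\<close> at 0 is
    exactly \<open>flat_exp (Suc j) h\<close>, so differentiability there is the limit already
    proved, one index higher.\<close>
  have "(flat_exp j has_real_derivative 0) (at 0)"
    unfolding has_field_derivative_iff
    by (rule Lim_transform_eventually[OF flat_exp_tendsto_0[of "Suc j"]])
      (auto simp: flat_exp_def eventually_at_filter)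
  then show ?thesis using equal by (simp add: flat_exp_def)
next
  case greater
  have "((\<lambda>t. exp (- 1 / t) / t ^ j) has_real_derivative
      (exp (- 1 / t) * (1 / t\<^sup>2) * t ^ j - exp (- 1 / t) * (real j * t ^ (j - 1))) / (t ^ j * t ^ j)) (at t)"
    using greater by (auto intro!: derivative_eq_intros simp: power2_eq_square)
  moreover have "(exp (- 1 / t) * (1 / t\<^sup>2) * t ^ j - exp (- 1 / t) * (real j * t ^ (j - 1))) / (t ^ j * t ^ j)
      = flat_exp (j + 2) t - real j * flat_exp (j + 1) t"
    using greater by (cases j) (auto simp: flat_exp_def field_simps power2_eq_square)
  ultimately have "((\<lambda>t. exp (- 1 / t) / t ^ j) has_real_derivative
      flat_exp (j + 2) t - real j * flat_exp (j + 1) t) (at t)" by simp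
  then show ?thesis
    by (rule has_field_derivative_transform_within_open[of _ _ _ "{0<..}"])
      (use greater in \<open>auto simp: flat_exp_def\<close>)
qed

text \<open>By the chain rule each partial derivative is a combination of members
  \<open>j + 1\<close> and \<open>j + 2\<close> of the family, times a derivative of
  \<open>g\<close>. The induction therefore runs with \<open>j\<close> arbitrary and only has to
  know that products and sums preserve smoothness.\<close>

lemma Ck_fun_flat_exp_comp:
  assumes g: "\<And>k. Ck_fun k g"
  shows "Ck_fun k (\<lambda>x. flat_exp j (g x))"
proof (induction k arbitrary: j)
  case 0
  have "continuous_on UNIV (flat_exp j)"
    by (auto intro!: continuous_at_imp_continuous_on DERIV_isCont[OF flat_exp_has_real_derivative])
  from continuous_on_compose2[OF this g[of 0, simplified]] show ?case by simp
next
  case (Suc k)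
  have d: "((\<lambda>x. flat_exp j (g x)) has_derivative
      (\<lambda>h. (flat_exp (j + 2) (g x) - real j * flat_exp (j + 1) (g x)) * frechet_derivative g (at x) h)) (at x)" for x
    using has_derivative_compose[OF Ck_fun_has_derivative[OF g]
        flat_exp_has_real_derivative[unfolded has_field_derivative_def]] .
  have g': "Ck_fun k (\<lambda>x. frechet_derivative g (at x) b)" if "b \<in> Basis" for b
    using g[of "Suc k"] that by simp
  have "Ck_fun k (\<lambda>x. (flat_exp (j + 2) (g x) + (- real j) *\<^sub>R flat_exp (j + 1) (g x)) *\<^sub>R
      frechet_derivative g (at x) b)" if "b \<in> Basis" for b
    by (intro Ck_fun_scaleR Ck_fun_add Ck_fun_const Suc g' that)
  then show ?case
    by (intro Ck_fun_SucI[OF d]) (simp add: algebra_simps)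
qed

text \<open>The classical kernel exp(-1 / (1 - |x|^2)) on the unit ball; using the squared norm
  keeps it smooth at the origin.\<close>

definition bump :: "'a::euclidean_space \<Rightarrow> real" where
  "bump x = flat_exp 0 (1 - x \<bullet> x)"

lemma bump_pos_iff: "bump x > 0 \<longleftrightarrow> norm x < 1"
  by (auto simp: bump_def flat_exp_def power2_norm_eq_inner[symmetric] abs_square_less_1)

lemma bump_nonneg: "bump x \<ge> 0"
  by (auto simp: bump_def flat_exp_def)

lemma Ck_fun_bump: "Ck_fun k bump"
proof -
  have inner: "Ck_fun k (\<lambda>x::'a. x \<bullet> x)" for k
  proof (cases k)
    case (Suc j)
    have "((\<lambda>x::'a. x \<bullet> x) has_derivative (\<lambda>h. 2 *\<^sub>R (h \<bullet> x))) (at x)" for x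
      by (auto intro!: derivative_eq_intros simp: inner_commute)
    then show ?thesis unfolding Suc
      by (rule Ck_fun_SucI)
        (intro Ck_fun_bounded_linear_comp[OF bounded_linear_scaleR_right] Ck_fun_bounded_linear
          bounded_linear_inner_right)
  qed (auto intro: continuous_intros)
  have "Ck_fun k (\<lambda>x::'a. 1 + (- 1) *\<^sub>R (x \<bullet> x))" for k
    by (intro Ck_fun_add Ck_fun_const Ck_fun_bounded_linear_comp[OF bounded_linear_scaleR_right] inner)
  then have "Ck_fun k (\<lambda>x::'a. flat_exp 0 (1 + (- 1) *\<^sub>R (x \<bullet> x)))"
    by (rule Ck_fun_flat_exp_comp)
  then show ?thesis by (simp add: bump_def[abs_def])
qed

section \<open>Test functions: supports, derivatives, products, boundedness\<close>

lemma frechet_derivative_eq_0: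
  assumes "closed K" "\<And>x. x \<notin> K \<Longrightarrow> f x = 0" "x \<notin> K"
  shows "frechet_derivative f (at x) = (\<lambda>h. 0)"
proof -
  have "((\<lambda>x. 0) has_derivative (\<lambda>h. 0)) (at x)" by simp
  then have "(f has_derivative (\<lambda>h. 0)) (at x)"
    by (rule has_derivative_transform_within_open[of _ _ _ _ "- K"]) (use assms in auto)
  then show ?thesis using frechet_derivative_at by metis
qed

text \<open>Supports are never computed: a compact set off which \<open>f\<close> vanishes is
  closed, so it contains the closure of the set where \<open>f\<close> is nonzero.\<close>

lemma test_fun_onI:
  assumes "\<And>k. Ck_fun k f" "compact K" "K \<subseteq> \<Omega>" "\<And>x. x \<notin> K \<Longrightarrow> f x = 0"
  shows "test_fun_on \<Omega> f"
proof -
  have "closure {x. f x \<noteq> 0} \<subseteq> K"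
    by (rule closure_minimal) (use assms compact_imp_closed in auto)
  moreover from this have "compact (closure {x. f x \<noteq> 0})"
    using compact_Int_closed[OF assms(2) closed_closure[of "{x. f x \<noteq> 0}"]] by (simp only: inf.absorb2)
  ultimately show ?thesis unfolding test_fun_on_def
    using assms by blast
qed

lemma test_fun_onE:
  assumes "test_fun_on \<Omega> f"
  obtains K where "compact K" "K \<subseteq> \<Omega>" "\<And>x. x \<notin> K \<Longrightarrow> f x = 0"
    "\<And>x h. x \<notin> K \<Longrightarrow> frechet_derivative f (at x) h = 0"
proof -
  define K where "K = closure {x. f x \<noteq> 0}"
  have 0: "f x = 0" if "x \<notin> K" for x
    using that closure_subset[of "{x. f x \<noteq> 0}"] unfolding K_def by blast
  have "closed K" by (simp add: K_def)
  then have "frechet_derivative f (at x) h = 0" if "x \<notin> K" for x h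
    using frechet_derivative_eq_0[of K f x] 0 that by metis
  moreover have "compact K" "K \<subseteq> \<Omega>"
    using assms unfolding test_fun_on_def K_def by blast+
  ultimately show ?thesis using that 0 by metis
qed

lemma test_fun_on_mono: "test_fun_on \<Omega> f \<Longrightarrow> \<Omega> \<subseteq> \<Omega>' \<Longrightarrow> test_fun_on \<Omega>' f"
  by (auto simp: test_fun_on_def)

lemma test_fun_on_Ck: "test_fun_on \<Omega> f \<Longrightarrow> Ck_fun k f"
  by (simp add: test_fun_on_def)

lemma test_fun_on_has_derivative:
  "test_fun_on \<Omega> f \<Longrightarrow> (f has_derivative frechet_derivative f (at x)) (at x)"
  using Ck_fun_has_derivative test_fun_on_Ck by blast

lemma test_fun_on_derivative:
  assumes "test_fun_on \<Omega> f" "b \<in> Basis"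
  shows "test_fun_on \<Omega> (\<lambda>x. frechet_derivative f (at x) b)"
proof -
  obtain K where K: "compact K" "K \<subseteq> \<Omega>" "\<And>x h. x \<notin> K \<Longrightarrow> frechet_derivative f (at x) h = 0"
    using test_fun_onE[OF assms(1)] by metis
  show ?thesis
    by (rule test_fun_onI[OF _ K(1,2)]) (use K(3) assms test_fun_on_Ck[OF assms(1), of "Suc _"] in auto)
qed

lemma test_fun_on_scaleR:
  fixes f :: "'a::euclidean_space \<Rightarrow> real"
  assumes "test_fun_on \<Omega> f" "\<And>k. Ck_fun k g"
  shows "test_fun_on \<Omega> (\<lambda>x. f x *\<^sub>R g x)"
proof -
  obtain K where K: "compact K" "K \<subseteq> \<Omega>" "\<And>x. x \<notin> K \<Longrightarrow> f x = 0"
    using test_fun_onE[OF assms(1)] by metis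
  show ?thesis
    by (rule test_fun_onI[OF _ K(1,2)]) (use K(3) assms in \<open>auto intro: Ck_fun_scaleR test_fun_on_Ck\<close>)
qed

lemma frechet_derivative_scaleR:
  fixes f :: "'a::real_normed_vector \<Rightarrow> real"
  assumes "f differentiable (at x)" "g differentiable (at x)"
  shows "frechet_derivative (\<lambda>x. f x *\<^sub>R g x) (at x) h
    = f x *\<^sub>R frechet_derivative g (at x) h + frechet_derivative f (at x) h *\<^sub>R g x"
  using has_derivative_scaleR[OF assms[unfolded frechet_derivative_works]]
  by (simp flip: frechet_derivative_at)

lemma compact_support_bounded:
  assumes "continuous_on UNIV f" "compact K" "\<And>x. x \<notin> K \<Longrightarrow> f x = 0"
  obtains M where "M \<ge> 0" "\<And>x. norm (f x) \<le> M"
proof -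
  have "compact (f ` K)"
    using assms compact_continuous_image continuous_on_subset by blast
  then obtain M where "\<And>x. x \<in> K \<Longrightarrow> norm (f x) \<le> M"
    using compact_imp_bounded bounded_iff by (metis image_eqI)
  then have "norm (f x) \<le> max M 0" for x
    using assms(3)[of x] by (cases "x \<in> K") force+
  then show ?thesis using that[of "max M 0"] by auto
qed

section \<open>Convolution and mollifiers\<close>

text \<open>The scalar kernel carries the smoothness; the vector-valued factor \<open>w\<close> is
  typically just integrable.\<close>

definition conv :: "('a::euclidean_space \<Rightarrow> real) \<Rightarrow> ('a \<Rightarrow> 'b::euclidean_space) \<Rightarrow> 'a \<Rightarrow> 'b" where
  "conv \<rho> w x = (LINT y|lebesgue. \<rho> (x - y) *\<^sub>R w y)"

lemma test_fun_on_bounded: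
  assumes "test_fun_on \<Omega> f"
  obtains M where "M \<ge> 0" "\<And>x. norm (f x) \<le> M"
  using test_fun_onE[OF assms] compact_support_bounded[OF Ck_fun_continuous_on[OF test_fun_on_Ck[OF assms]]]
  by metis

lemma continuous_on_UNIV_borel_measurable_lebesgue:
  fixes f :: "'a::euclidean_space \<Rightarrow> 'b::euclidean_space"
  assumes "continuous_on UNIV f"
  shows "f \<in> borel_measurable lebesgue"
  using borel_measurable_continuous_onI[OF assms] by (simp add: measurable_completion)

lemma integrable_scaleR_bounded:
  fixes w :: "'a::euclidean_space \<Rightarrow> 'b::euclidean_space"
  assumes "continuous_on UNIV f" "\<And>x. norm (f x) \<le> M" "integrable lebesgue w"
  shows "integrable lebesgue (\<lambda>y. f y *\<^sub>R w y)"
proof (rule Bochner_Integration.integrable_bound)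
  show "integrable lebesgue (\<lambda>y. M *\<^sub>R w y)" using assms by simp
  show "(\<lambda>y. f y *\<^sub>R w y) \<in> borel_measurable lebesgue"
    using assms continuous_on_UNIV_borel_measurable_lebesgue by (intro borel_measurable_scaleR) auto
  show "AE y in lebesgue. norm (f y *\<^sub>R w y) \<le> norm (M *\<^sub>R w y)"
    using assms(2) by (auto intro!: AE_I2 mult_right_mono simp: order.trans[OF _ abs_ge_self])
qed

lemma integrable_conv:
  fixes w :: "'a::euclidean_space \<Rightarrow> 'b::euclidean_space"
  assumes "test_fun_on \<Omega> \<rho>" "integrable lebesgue w"
  shows "integrable lebesgue (\<lambda>y. \<rho> (x - y) *\<^sub>R w y)"
proof -
  obtain M where "\<And>x. norm (\<rho> x) \<le> M"
    using test_fun_on_bounded[OF assms(1)] by metis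
  moreover have "continuous_on UNIV (\<lambda>y. \<rho> (x - y))"
    by (rule continuous_on_compose2[OF Ck_fun_continuous_on[OF test_fun_on_Ck[OF assms(1)], of UNIV]])
      (auto intro: continuous_intros)
  ultimately show ?thesis
    using assms by (intro integrable_scaleR_bounded) auto
qed

text \<open>Two points at distance less than 1 either both lie in \<open>cball 0 (r + 1)\<close>,
  where compactness applies, or both lie outside \<open>cball 0 r\<close>, where \<open>f\<close>
  vanishes.\<close>

lemma compact_support_uniformly_continuous:
  fixes f :: "'a::euclidean_space \<Rightarrow> 'b::real_normed_vector"
  assumes "continuous_on UNIV f" "compact K" "\<And>x. x \<notin> K \<Longrightarrow> f x = 0"
  shows "uniformly_continuous_on UNIV f"
  unfolding uniformly_continuous_on_def
proof (intro allI impI)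
  fix e :: real assume "e > 0"
  obtain r where "\<forall>x\<in>K. norm x \<le> r"
    using compact_imp_bounded[OF assms(2)] unfolding bounded_iff by blast
  then have r: "K \<subseteq> cball 0 r" by auto
  have "uniformly_continuous_on (cball 0 (r + 1)) f"
    by (rule compact_uniformly_continuous[OF continuous_on_subset[OF assms(1)]]) auto
  then obtain d where "d > 0"
    "\<forall>x\<in>cball 0 (r + 1). \<forall>y\<in>cball 0 (r + 1). dist y x < d \<longrightarrow> dist (f y) (f x) < e"
    using \<open>e > 0\<close> unfolding uniformly_continuous_on_def by blast
  then have d: "d > 0" "\<And>x y. norm x \<le> r + 1 \<Longrightarrow> norm y \<le> r + 1 \<Longrightarrow> dist y x < d \<Longrightarrow> dist (f y) (f x) < e"
    by auto
  have "dist (f y) (f x) < e" if "dist y x < min d 1" for x y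
  proof (cases "norm x \<le> r + 1 \<and> norm y \<le> r + 1")
    case False
    then have "norm x > r" "norm y > r"
      using that norm_triangle_ineq2[of x y] norm_triangle_ineq2[of y x] by (auto simp: dist_norm norm_minus_commute)
    then have "f x = 0" "f y = 0"
      using assms(3) r by (meson mem_cball_0 not_le subsetD)+
    then show ?thesis using \<open>e > 0\<close> by simp
  qed (use d that in auto)
  then show "\<exists>d>0. \<forall>x\<in>UNIV. \<forall>x'\<in>UNIV. dist x' x < d \<longrightarrow> dist (f x') (f x) < e"
    using d(1) by (intro exI[of _ "min d 1"]) auto
qed

lemma test_fun_on_uniformly_continuous: "test_fun_on \<Omega> f \<Longrightarrow> uniformly_continuous_on UNIV f"
  by (metis test_fun_onE compact_support_uniformly_continuous Ck_fun_continuous_on test_fun_on_Ck)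

lemma frechet_derivative_expand:
  assumes "f differentiable (at z)"
  shows "frechet_derivative f (at z) h = (\<Sum>b\<in>Basis. (h \<bullet> b) *\<^sub>R frechet_derivative f (at z) b)"
proof -
  have "linear (frechet_derivative f (at z))"
    using assms by (rule linear_frechet_derivative)
  then have "frechet_derivative f (at z) (\<Sum>b\<in>Basis. (h \<bullet> b) *\<^sub>R b) = (\<Sum>b\<in>Basis. (h \<bullet> b) *\<^sub>R frechet_derivative f (at z) b)"
    by (simp add: linear_sum linear_cmul)
  then show ?thesis by (simp add: euclidean_representation)
qed

lemma test_fun_on_differentiable: "test_fun_on \<Omega> f \<Longrightarrow> f differentiable (at x)"
  using test_fun_on_has_derivative differentiable_def by blast

text \<open>The partial derivatives are uniformly continuous, so the mean value inequality on the
  segment from z to z + h gives a first-order remainder that is small uniformly in z. This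
  uniformity is what permits differentiation under the integral sign for a convolution.\<close>

lemma test_fun_on_uniform_remainder:
  fixes \<rho> :: "'a::euclidean_space \<Rightarrow> real"
  assumes \<rho>: "test_fun_on \<Omega> \<rho>" and "e > 0"
  obtains d where "d > 0"
    "\<And>z h. norm h < d \<Longrightarrow> norm (\<rho> (z + h) - \<rho> z - frechet_derivative \<rho> (at z) h) \<le> e * norm h"
proof -
  \<comment> \<open>The increment of the derivative is expanded over the basis, and each of its
    \<open>DIM('a)\<close> terms may contribute at most \<open>e'\<close>.\<close>
  define e' where "e' = e / DIM('a)"
  have e': "e' > 0" using \<open>e > 0\<close> by (simp add: e'_def)
  have "\<forall>b\<in>Basis. \<exists>d>0. \<forall>x y. dist x y < d \<longrightarrow>
      dist (frechet_derivative \<rho> (at x) b) (frechet_derivative \<rho> (at y) b) < e'"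
    using test_fun_on_uniformly_continuous[OF test_fun_on_derivative[OF \<rho>]] e'
    unfolding uniformly_continuous_on_def by (metis UNIV_I)
  then obtain D where D: "\<And>b. b \<in> Basis \<Longrightarrow> D b > 0"
    "\<And>b x y. b \<in> Basis \<Longrightarrow> dist x y < D b \<Longrightarrow>
      dist (frechet_derivative \<rho> (at x) b) (frechet_derivative \<rho> (at y) b) < e'"
    by metis
  define d where "d = Min (D ` (Basis :: 'a set))"
  have "d > 0" using D(1) by (simp add: d_def)
  have d: "\<bar>frechet_derivative \<rho> (at x) b - frechet_derivative \<rho> (at y) b\<bar> \<le> e'"
    if "b \<in> Basis" "dist x y < d" for b x y
  proof -
    have "d \<le> D b" using that by (simp add: d_def)
    then show ?thesis using D(2)[OF that(1), of x y] that(2) by (simp add: dist_real_def)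
  qed
  have "norm (\<rho> (z + h) - \<rho> z - frechet_derivative \<rho> (at z) h) \<le> e * norm h" if h: "norm h < d" for z h
  proof -
    have on: "onorm (\<lambda>k. frechet_derivative \<rho> (at x) k - frechet_derivative \<rho> (at z) k) \<le> e"
      if "x \<in> ball z d" for x
    proof (rule onorm_bound)
      fix k
      have "norm (frechet_derivative \<rho> (at x) k - frechet_derivative \<rho> (at z) k)
        = norm (\<Sum>b\<in>Basis. (k \<bullet> b) * (frechet_derivative \<rho> (at x) b - frechet_derivative \<rho> (at z) b))"
        using frechet_derivative_expand[OF test_fun_on_differentiable[OF \<rho>], of x k]
          frechet_derivative_expand[OF test_fun_on_differentiable[OF \<rho>], of z k]
        by (simp add: sum_subtractf right_diff_distrib)
      also have "\<dots> \<le> (\<Sum>b\<in>(Basis::'a set). norm k * e')"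
      proof (rule sum_norm_le)
        fix b :: 'a assume b: "b \<in> Basis"
        show "norm ((k \<bullet> b) * (frechet_derivative \<rho> (at x) b - frechet_derivative \<rho> (at z) b)) \<le> norm k * e'"
          unfolding norm_mult using b d[OF b, of x z] that
          by (intro mult_mono) (auto simp: Basis_le_norm dist_commute)
      qed
      also have "\<dots> = e * norm k" by (simp add: e'_def)
      finally show "norm (frechet_derivative \<rho> (at x) k - frechet_derivative \<rho> (at z) k) \<le> e * norm k" .
    qed (use \<open>e > 0\<close> in simp)
    have "norm (\<rho> (z + h) - \<rho> z - frechet_derivative \<rho> (at z) (z + h - z)) \<le> norm (z + h - z) * e"
    proof (rule differentiable_bound_linearization[where S = "ball z d"])
      show "z + t *\<^sub>R (z + h - z) \<in> ball z d" if "t \<in> {0..1}" for t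
      proof -
        have "\<bar>t\<bar> * norm h \<le> 1 * norm h" using that by (intro mult_right_mono) auto
        then show ?thesis using h by (simp add: dist_norm)
      qed
      show "(\<rho> has_derivative frechet_derivative \<rho> (at x)) (at x within ball z d)" if "x \<in> ball z d" for x
        by (rule has_derivative_at_withinI[OF test_fun_on_has_derivative[OF \<rho>]])
      show "onorm (frechet_derivative \<rho> (at x) - frechet_derivative \<rho> (at z)) \<le> e" if "x \<in> ball z d" for x
        using on[OF that] by (simp add: fun_diff_def)
    qed (use \<open>d > 0\<close> in simp)
    then show ?thesis by (simp add: mult.commute)
  qed
  then show ?thesis using that \<open>d > 0\<close> by blast
qed

lemma norm_integral_le_integral:
  fixes f :: "_ \<Rightarrow> 'b::{banach, second_countable_topology}"
  assumes "integrable M f" "integrable M g" "\<And>x. norm (f x) \<le> g x"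
  shows "norm (integral\<^sup>L M f) \<le> integral\<^sup>L M g"
  using assms by (intro order.trans[OF integral_norm_bound integral_mono]) auto

text \<open>The remainder of the convolution is the integral of the remainder of \<rho> against
  \<open>w\<close>. As the latter is uniformly at most \<open>e' * norm h\<close>, the former is at
  most that times the L^1 norm of \<open>w\<close>.\<close>

lemma conv_has_derivative:
  fixes w :: "'a::euclidean_space \<Rightarrow> 'b::euclidean_space"
  assumes \<rho>: "test_fun_on \<Omega> \<rho>" and w: "integrable lebesgue w"
  shows "(conv \<rho> w has_derivative
    (\<lambda>h. \<Sum>b\<in>Basis. (h \<bullet> b) *\<^sub>R conv (\<lambda>z. frechet_derivative \<rho> (at z) b) w x)) (at x)"
    (is "(_ has_derivative ?D) _")
  unfolding has_derivative_at_alt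
proof (intro conjI allI impI)
  show "bounded_linear ?D"
    by (intro bounded_linear_sum bounded_linear_scaleR_const bounded_linear_inner_left)
next
  fix e :: real assume "e > 0"
  define W where "W = (LINT y|lebesgue. norm (w y))"
  have W: "W \<ge> 0" by (simp add: W_def)
  \<comment> \<open>Adding 1 keeps the quotient meaningful when \<open>w\<close> vanishes almost
    everywhere, and still gives \<open>e' * W \<le> e\<close>.\<close>
  define e' where "e' = e / (W + 1)"
  have "e' > 0" using \<open>e > 0\<close> W by (simp add: e'_def)
  then obtain d where d: "d > 0"
    "\<And>z h. norm h < d \<Longrightarrow> norm (\<rho> (z + h) - \<rho> z - frechet_derivative \<rho> (at z) h) \<le> e' * norm h"
    using test_fun_on_uniform_remainder[OF \<rho>] by metis
  have "norm (conv \<rho> w y - conv \<rho> w x - ?D (y - x)) \<le> e * norm (y - x)" if "norm (y - x) < d" for y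
  proof -
    let ?h = "y - x"
    have D: "?D ?h = (LINT t|lebesgue. frechet_derivative \<rho> (at (x - t)) ?h *\<^sub>R w t)"
      and iD: "integrable lebesgue (\<lambda>t. frechet_derivative \<rho> (at (x - t)) ?h *\<^sub>R w t)"
      unfolding conv_def frechet_derivative_expand[OF test_fun_on_differentiable[OF \<rho>], of _ ?h]
      using integrable_conv[OF test_fun_on_derivative[OF \<rho>] w, of _ x]
      by (auto simp: scaleR_sum_left integral_sum simp flip: scaleR_scaleR)
    have "conv \<rho> w y - conv \<rho> w x - ?D ?h
      = (LINT t|lebesgue. (\<rho> (y - t) - \<rho> (x - t) - frechet_derivative \<rho> (at (x - t)) ?h) *\<^sub>R w t)"
      unfolding D unfolding conv_def scaleR_diff_left
      using integrable_conv[OF \<rho> w] iD by simp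
    also have "norm \<dots> \<le> (LINT t|lebesgue. e' * norm ?h * norm (w t))"
    proof (rule norm_integral_le_integral)
      show "integrable lebesgue (\<lambda>t. (\<rho> (y - t) - \<rho> (x - t) - frechet_derivative \<rho> (at (x - t)) ?h) *\<^sub>R w t)"
        unfolding scaleR_diff_left using integrable_conv[OF \<rho> w] iD by simp
      show "integrable lebesgue (\<lambda>t. e' * norm ?h * norm (w t))" using w by simp
      show "norm ((\<rho> (y - t) - \<rho> (x - t) - frechet_derivative \<rho> (at (x - t)) ?h) *\<^sub>R w t) \<le> e' * norm ?h * norm (w t)" for t
        using d(2)[OF that, of "x - t"] by (simp add: mult_right_mono)
    qed
    also have "\<dots> = e' * W * norm ?h" by (simp add: W_def)
    also have "\<dots> \<le> e * norm ?h"
      using W \<open>e > 0\<close> by (intro mult_right_mono) (auto simp: e'_def field_simps)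
    finally show ?thesis .
  qed
  then show "\<exists>d>0. \<forall>y. norm (y - x) < d \<longrightarrow> norm (conv \<rho> w y - conv \<rho> w x - ?D (y - x)) \<le> e * norm (y - x)"
    using d(1) by blast
qed

lemma frechet_derivative_conv:
  assumes "test_fun_on \<Omega> \<rho>" "integrable lebesgue w" "b \<in> Basis"
  shows "frechet_derivative (conv \<rho> w) (at x) b = conv (\<lambda>z. frechet_derivative \<rho> (at z) b) w x"
  unfolding frechet_derivative_at[OF conv_has_derivative[OF assms(1,2)], symmetric]
  using assms(3) by (simp add: inner_Basis if_distrib[of "\<lambda>c. c *\<^sub>R _"] cong: if_cong)

text \<open>Every derivative falls on the kernel, whose partial derivatives are again test
  functions, so the induction is over all kernels at once.\<close>

lemma Ck_fun_conv:
  assumes "integrable lebesgue w"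
  shows "test_fun_on \<Omega> \<rho> \<Longrightarrow> Ck_fun k (conv \<rho> w)"
proof (induction k arbitrary: \<rho>)
  case 0
  then show ?case
    using has_derivative_continuous[OF conv_has_derivative[OF _ assms]]
    by (simp add: continuous_at_imp_continuous_on)
next
  case (Suc k)
  then show ?case
    using conv_has_derivative[OF Suc.prems assms] frechet_derivative_conv[OF Suc.prems assms]
    by (auto simp: differentiable_def intro: Suc.IH test_fun_on_derivative)
qed

lemma conv_eq_0:
  assumes "\<And>y. w y = 0 \<or> \<rho> (x - y) = 0"
  shows "conv \<rho> w x = 0"
proof -
  have "(\<lambda>y. \<rho> (x - y) *\<^sub>R w y) = (\<lambda>y. 0)" using assms by fastforce
  then show ?thesis by (simp add: conv_def)
qed

section \<open>Reflection invariance and integrability of test functions\<close>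

lemma lborel_distr_diff: "distr lborel borel (\<lambda>y. x - y) = (lborel :: 'a::euclidean_space measure)"
proof -
  have "(lborel :: 'a measure) = density (distr lborel borel (\<lambda>y. x + (- 1) *\<^sub>R y)) (\<lambda>_. ennreal (\<bar>- 1\<bar> ^ DIM('a)))"
    by (rule lborel_affine) simp
  then show ?thesis by (simp add: density_1)
qed

lemma integral_lborel_reflect:
  fixes f :: "'a::euclidean_space \<Rightarrow> 'b::euclidean_space"
  assumes "f \<in> borel_measurable borel"
  shows "(LINT y|lborel. f (x - y)) = (LINT y|lborel. f y)"
  by (subst (2) lborel_distr_diff[of x, symmetric], subst integral_distr) (use assms in auto)

lemma nn_integral_lborel_reflect:
  fixes f :: "'a::euclidean_space \<Rightarrow> ennreal"
  assumes "f \<in> borel_measurable borel"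
  shows "(\<integral>\<^sup>+ y. f (x - y) \<partial>lborel) = (\<integral>\<^sup>+ y. f y \<partial>lborel)"
  by (subst (2) lborel_distr_diff[of x, symmetric], subst nn_integral_distr) (use assms in auto)

lemma test_fun_on_borel_measurable:
  fixes f :: "'a::euclidean_space \<Rightarrow> 'b::euclidean_space"
  assumes "test_fun_on \<Omega> f"
  shows "f \<in> borel_measurable borel"
  using Ck_fun_continuous_on[OF test_fun_on_Ck[OF assms]] by (rule borel_measurable_continuous_onI)

lemma test_fun_on_integral_reflect:
  fixes f :: "'a::euclidean_space \<Rightarrow> 'b::euclidean_space"
  assumes "test_fun_on \<Omega> f"
  shows "(LINT y|lebesgue. f (x - y)) = (LINT y|lebesgue. f y)"
proof -
  have m: "f \<in> borel_measurable borel"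
    using assms by (rule test_fun_on_borel_measurable)
  have "(LINT y|lebesgue. f (x - y)) = (LINT y|lborel. f (x - y))"
    by (rule integral_completion) (use m in measurable)
  also have "\<dots> = (LINT y|lborel. f y)" using m by (rule integral_lborel_reflect)
  also have "\<dots> = (LINT y|lebesgue. f y)"
    by (rule integral_completion[symmetric]) (use m in measurable)
  finally show ?thesis .
qed

lemma integrable_indicator_compact:
  fixes K :: "'a::euclidean_space set"
  assumes "compact K"
  shows "integrable lebesgue (indicator K :: 'a \<Rightarrow> real)"
  using lmeasurable_compact[OF assms] by (auto simp: fmeasurable_def)

lemma integrable_compact_support:
  fixes f :: "'a::euclidean_space \<Rightarrow> 'b::euclidean_space"
  assumes "continuous_on UNIV f" "compact K" "\<And>x. x \<notin> K \<Longrightarrow> f x = 0"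
  shows "integrable lebesgue f"
proof -
  obtain M where M: "\<And>x. norm (f x) \<le> M"
    using compact_support_bounded[OF assms] by metis
  show ?thesis
  proof (rule Bochner_Integration.integrable_bound)
    show "integrable lebesgue (\<lambda>x. M * indicator K x)"
      using integrable_indicator_compact[OF assms(2)] by simp
    show "AE x in lebesgue. norm (f x) \<le> norm (M * indicator K x)"
      using M assms(3) by (auto intro!: AE_I2 simp: indicator_def order.trans[OF _ abs_ge_self])
  qed (use assms continuous_on_UNIV_borel_measurable_lebesgue in auto)
qed

lemma test_fun_on_integrable:
  fixes f :: "'a::euclidean_space \<Rightarrow> 'b::euclidean_space"
  assumes "test_fun_on \<Omega> f"
  shows "integrable lebesgue f"
  using test_fun_onE[OF assms] integrable_compact_support[OF Ck_fun_continuous_on[OF test_fun_on_Ck[OF assms]]]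
  by metis

section \<open>Mollifiers of scale 1 / (k + 1) and smooth plateau functions\<close>

definition mollifier :: "nat \<Rightarrow> 'a::euclidean_space \<Rightarrow> real" where
  "mollifier k x = bump (real (Suc k) *\<^sub>R x) / (LINT z|lebesgue. bump (real (Suc k) *\<^sub>R (z::'a)))"

lemma norm_Suc_scaleR_less_1: "norm (real (Suc k) *\<^sub>R x) < 1 \<longleftrightarrow> norm x < 1 / real (Suc k)"
  by (simp only: norm_scaleR abs_of_nat pos_less_divide_eq[OF of_nat_0_less_iff[THEN iffD2, OF zero_less_Suc]] mult.commute)

lemma test_fun_on_bump_scaled: "test_fun_on UNIV (\<lambda>x::'a::euclidean_space. bump (real (Suc k) *\<^sub>R x))"
proof (rule test_fun_onI)
  show "Ck_fun j (\<lambda>x::'a. bump (real (Suc k) *\<^sub>R x))" for j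
    using Ck_fun_affine[OF Ck_fun_bump, where p = 0 and c = "real (Suc k)"] by simp
  show "bump (real (Suc k) *\<^sub>R x) = 0" if "x \<notin> cball 0 (1 / real (Suc k))" for x :: 'a
  proof -
    have "\<not> norm (real (Suc k) *\<^sub>R x) < 1" using that by (simp only: norm_Suc_scaleR_less_1) auto
    then show ?thesis using bump_pos_iff bump_nonneg by (metis order_le_less)
  qed
qed auto

text \<open>A nonnegative function with zero integral vanishes almost everywhere, but this one is
  positive on a ball, which is not negligible.\<close>

lemma bump_integral_pos: "(LINT z|lebesgue. bump (real (Suc k) *\<^sub>R (z::'a::euclidean_space))) > 0"
proof -
  let ?f = "\<lambda>z::'a. bump (real (Suc k) *\<^sub>R z)"
  have i: "integrable lebesgue ?f"
    using test_fun_on_bump_scaled by (rule test_fun_on_integrable)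
  have "(LINT z|lebesgue. ?f z) \<noteq> 0"
  proof
    assume "(LINT z|lebesgue. ?f z) = 0"
    then have "AE z in lebesgue. ?f z = 0"
      using integral_nonneg_eq_0_iff_AE[OF i] bump_nonneg by auto
    then have "{z. ?f z \<noteq> 0} \<in> null_sets lebesgue"
      by (simp add: AE_iff_null_sets completion.complete2 eventually_ae_filter)
         (metis (no_types, lifting) completion.complete2)
    moreover have "ball 0 (1 / real (Suc k)) \<subseteq> {z. ?f z \<noteq> 0}"
    proof
      fix z :: 'a assume "z \<in> ball 0 (1 / real (Suc k))"
      then have "?f z > 0" unfolding bump_pos_iff norm_Suc_scaleR_less_1 by simp
      then show "z \<in> {z. ?f z \<noteq> 0}" by simp
    qed
    ultimately have "negligible (ball (0::'a) (1 / real (Suc k)))"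
      by (metis negligible_iff_null_sets negligible_subset)
    then show False
      using open_not_negligible[of "ball (0::'a) (1 / real (Suc k))"] by auto
  qed
  moreover have "(LINT z|lebesgue. ?f z) \<ge> 0" by (intro integral_nonneg_AE AE_I2 bump_nonneg)
  ultimately show ?thesis by simp
qed

lemma mollifier_nonneg: "mollifier k x \<ge> 0"
  using bump_nonneg bump_integral_pos by (metis divide_nonneg_pos mollifier_def)

lemma mollifier_eq_0: "1 / real (Suc k) \<le> norm x \<Longrightarrow> mollifier k x = 0"
proof -
  assume "1 / real (Suc k) \<le> norm x"
  then have "\<not> norm (real (Suc k) *\<^sub>R x) < 1" by (simp only: norm_Suc_scaleR_less_1 not_less)
  then have "bump (real (Suc k) *\<^sub>R x) = 0" using bump_pos_iff bump_nonneg by (metis order_le_less)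
  then show ?thesis by (simp add: mollifier_def)
qed

lemma test_fun_on_mollifier: "test_fun_on UNIV (mollifier k)"
  unfolding mollifier_def[abs_def] divide_inverse real_scaleR_def[symmetric]
  by (intro test_fun_on_scaleR test_fun_on_bump_scaled Ck_fun_const)

lemma mollifier_integral: "(LINT x|lebesgue. mollifier k (x::'a::euclidean_space)) = 1"
  using bump_integral_pos[of k, where 'a = 'a] by (simp add: mollifier_def)

lemma mollifier_integral_reflect: "(LINT y|lebesgue. mollifier k (x - y)) = 1"
  using test_fun_on_integral_reflect[OF test_fun_on_mollifier[of k]] mollifier_integral by metis

text \<open>A non-integrable function has Bochner integral 0 by convention, so the value 1 already
  certifies integrability.\<close>

lemma mollifier_integrable_reflect: "integrable lebesgue (\<lambda>y. mollifier k (x - y))"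
  using mollifier_integral_reflect[of k x] not_integrable_integral_eq by fastforce

text \<open>The witness is the indicator function of a \<open>\<delta>\<close>-neighbourhood of \<open>K\<close>, mollified at scale \<open>\<delta>\<close>.\<close>

lemma smooth_plateau:
  fixes K :: "'a::euclidean_space set"
  assumes K: "compact K"
  obtains \<phi> :: "'a \<Rightarrow> real" where
    "\<And>\<Omega>. {x + y |x y. x \<in> K \<and> norm y \<le> 2 / real (Suc k)} \<subseteq> \<Omega> \<Longrightarrow> test_fun_on \<Omega> \<phi>"
    "\<And>x. x \<in> K \<Longrightarrow> \<phi> x = 1" "\<And>x. 0 \<le> \<phi> x" "\<And>x. \<phi> x \<le> 1"
    "\<And>x. x \<notin> {x + y |x y. x \<in> K \<and> norm y \<le> 2 / real (Suc k)} \<Longrightarrow> \<phi> x = 0"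
proof -
  define N where "N = (\<lambda>r. {x + y |x y. x \<in> K \<and> y \<in> cball (0::'a) r})"
  have cN: "compact (N r)" for r
    unfolding N_def by (rule compact_sums[OF K]) simp
  define \<delta> where "\<delta> = 1 / real (Suc k)"
  define \<phi> where "\<phi> = conv (mollifier k) (indicator (N \<delta>) :: 'a \<Rightarrow> real)"
  have ii: "integrable lebesgue (indicator (N \<delta>) :: 'a \<Rightarrow> real)"
    by (rule integrable_indicator_compact[OF cN])
  have Ck: "Ck_fun j \<phi>" for j
    unfolding \<phi>_def by (rule Ck_fun_conv[OF ii test_fun_on_mollifier])
  have out: "\<phi> x = 0" if "x \<notin> N (2 * \<delta>)" for x
    unfolding \<phi>_def
  proof (rule conv_eq_0)
    fix y
    show "indicat_real (N \<delta>) y = 0 \<or> mollifier k (x - y) = 0"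
    proof (rule ccontr)
      assume "\<not> ?thesis"
      then have "y \<in> N \<delta>" "norm (x - y) < \<delta>"
        using mollifier_eq_0[of k "x - y"] by (auto simp: \<delta>_def indicator_def not_less split: if_splits intro: leI)
      then obtain p q where "p \<in> K" "norm q \<le> \<delta>" "y = p + q" unfolding N_def by auto
      then have "x = p + (q + (x - y))" "norm (q + (x - y)) \<le> 2 * \<delta>"
        using \<open>norm (x - y) < \<delta>\<close> norm_triangle_ineq[of q "x - y"] by auto
      then have "x \<in> N (2 * \<delta>)" using \<open>p \<in> K\<close> unfolding N_def mem_Collect_eq mem_cball_0 by blast
      then show False using that by simp
    qed
  qed
  have one: "\<phi> x = 1" if "x \<in> K" for x
  proof -
    have "mollifier k (x - y) * indicat_real (N \<delta>) y = mollifier k (x - y)" for y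
    proof (cases "norm (x - y) < \<delta>")
      case True
      then have "y = x + (y - x)" "y - x \<in> cball 0 \<delta>" by (auto simp: norm_minus_commute)
      then have "y \<in> N \<delta>" unfolding N_def using that by blast
      then show ?thesis by simp
    next
      case False
      then show ?thesis using mollifier_eq_0[of k "x - y"] by (simp add: \<delta>_def)
    qed
    then show ?thesis unfolding \<phi>_def conv_def real_scaleR_def by (simp only: mollifier_integral_reflect)
  qed
  have ge: "0 \<le> \<phi> x" for x
    by (simp add: \<phi>_def conv_def mollifier_nonneg integral_nonneg_AE)
  have le: "\<phi> x \<le> 1" for x
  proof -
    have "\<phi> x \<le> (LINT y|lebesgue. mollifier k (x - y))"
      unfolding \<phi>_def conv_def
      using integrable_conv[OF test_fun_on_mollifier ii] mollifier_integrable_reflect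
      by (intro integral_mono) (auto simp: indicator_def mollifier_nonneg)
    then show ?thesis by (simp add: mollifier_integral_reflect)
  qed
  have N2: "{x + y |x y. x \<in> K \<and> norm y \<le> 2 / real (Suc k)} = N (2 * \<delta>)"
    by (auto simp: N_def \<delta>_def)
  have test: "test_fun_on \<Omega> \<phi>" if "N (2 * \<delta>) \<subseteq> \<Omega>" for \<Omega>
    by (rule test_fun_onI[OF Ck cN that out])
  show ?thesis
    by (rule that[of \<phi>, unfolded N2]) (use test one ge le out in blast)+
qed

text \<open>The convolution of \<rho> with the indicator of a large ball is constant near the
  origin, with value the integral of \<rho>. Its derivative at 0 is therefore zero; computed on the
  kernel, the same derivative is the integral of the partial derivative of \<rho>. This replaces the
  usual argument by Fubini and the fundamental theorem of calculus.\<close>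

lemma integral_frechet_derivative_eq_0:
  fixes \<rho> :: "'a::euclidean_space \<Rightarrow> real"
  assumes \<rho>: "test_fun_on \<Omega> \<rho>" and b: "b \<in> Basis"
  shows "(LINT x|lebesgue. frechet_derivative \<rho> (at x) b) = 0"
proof -
  obtain K where K: "compact K" "\<And>x. x \<notin> K \<Longrightarrow> \<rho> x = 0"
    "\<And>x h. x \<notin> K \<Longrightarrow> frechet_derivative \<rho> (at x) h = 0"
    using test_fun_onE[OF \<rho>] by metis
  obtain r where "\<forall>x\<in>K. norm x \<le> r"
    using compact_imp_bounded[OF K(1)] unfolding bounded_iff by blast
  then have r: "K \<subseteq> cball 0 r" by auto
  \<comment> \<open>The extra 1 in the radius ensures that for |x| < 1 the function y \<mapsto>
    \<rho>(x - y) is supported in the ball, so multiplying by the indicator changes nothing.\<close>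
  let ?w = "indicator (cball 0 (r + 1)) :: 'a \<Rightarrow> real"
  have i: "integrable lebesgue ?w" by (rule integrable_indicator_compact) simp
  have restrict: "f (x - y) * ?w y = f (x - y)"
    if "\<And>x. x \<notin> K \<Longrightarrow> f x = 0" "norm x < 1" for f x y
  proof (cases "norm y \<le> r + 1")
    case False
    then have "norm (x - y) > r"
      using that(2) norm_triangle_ineq2[of y x] by (simp add: norm_minus_commute)
    then have "x - y \<notin> K" using r by auto
    then show ?thesis using that(1) by simp
  qed simp
  have const: "conv \<rho> ?w x = (LINT y|lebesgue. \<rho> y)" if "x \<in> ball 0 1" for x
  proof -
    have "\<rho> (x - y) * ?w y = \<rho> (x - y)" for y
      using restrict[of \<rho> x y] K(2) that by simp
    then show ?thesis
      unfolding conv_def real_scaleR_def by (simp only: test_fun_on_integral_reflect[OF \<rho>])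
  qed
  have "(conv \<rho> ?w has_derivative (\<lambda>h. 0)) (at 0)"
    by (rule has_derivative_transform_within_open[OF has_derivative_const, of "ball 0 1"]) (use const in auto)
  then have "0 = frechet_derivative (conv \<rho> ?w) (at 0) b"
    by (simp flip: frechet_derivative_at)
  also have "\<dots> = (LINT y|lebesgue. frechet_derivative \<rho> (at (0 - y)) b)"
  proof -
    have "frechet_derivative \<rho> (at (0 - y)) b * ?w y = frechet_derivative \<rho> (at (0 - y)) b" for y
      using restrict[of "\<lambda>z. frechet_derivative \<rho> (at z) b" 0 y] K(3) by simp
    then show ?thesis
      unfolding frechet_derivative_conv[OF \<rho> i b] conv_def real_scaleR_def by (simp only:)
  qed
  also have "\<dots> = (LINT y|lebesgue. frechet_derivative \<rho> (at y) b)"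
    by (rule test_fun_on_integral_reflect[OF test_fun_on_derivative[OF \<rho> b]])
  finally show ?thesis by simp
qed

section \<open>Weak partial derivatives\<close>

lemma lebesgue_on_vanishing:
  fixes f :: "'a::euclidean_space \<Rightarrow> 'b::euclidean_space"
  assumes "S \<in> sets lebesgue" "\<And>x. x \<notin> S \<Longrightarrow> f x = 0"
  shows "integral\<^sup>L (lebesgue_on S) f = integral\<^sup>L lebesgue f"
    and "integrable (lebesgue_on S) f \<longleftrightarrow> integrable lebesgue f"
proof -
  have "(\<lambda>x. if x \<in> S then f x else 0) = f" using assms(2) by auto
  then show "integral\<^sup>L (lebesgue_on S) f = integral\<^sup>L lebesgue f"
    "integrable (lebesgue_on S) f \<longleftrightarrow> integrable lebesgue f"
    using Lebesgue_Measure.integral_restrict_UNIV[OF assms(1), of f] Lebesgue_Measure.integrable_restrict_UNIV[OF assms(1), of f] by auto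
qed

lemma locally_integrable_on_compact:
  assumes "locally_integrable_on \<Omega> f" "compact K" "K \<subseteq> \<Omega>"
  shows "integrable lebesgue (\<lambda>x. if x \<in> K then f x else 0)"
  using assms lmeasurable_compact[of K] Lebesgue_Measure.integrable_restrict_UNIV[of K f]
  by (auto simp: locally_integrable_on_def)

lemma test_fun_on_scaleR_integrable:
  fixes g :: "'a::euclidean_space \<Rightarrow> 'b::euclidean_space"
  assumes \<phi>: "test_fun_on \<Omega> \<phi>" and g: "locally_integrable_on \<Omega> g" and \<Omega>: "\<Omega> \<in> sets lebesgue"
  shows "integrable (lebesgue_on \<Omega>) (\<lambda>x. \<phi> x *\<^sub>R g x)"
proof -
  obtain K where K: "compact K" "K \<subseteq> \<Omega>" "\<And>x. x \<notin> K \<Longrightarrow> \<phi> x = 0"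
    using test_fun_onE[OF \<phi>] by metis
  obtain M where M: "\<And>x. norm (\<phi> x) \<le> M"
    using test_fun_on_bounded[OF \<phi>] by metis
  have "integrable lebesgue (\<lambda>x. \<phi> x *\<^sub>R (if x \<in> K then g x else 0))"
    by (rule integrable_scaleR_bounded[OF Ck_fun_continuous_on[OF test_fun_on_Ck[OF \<phi>]] M
          locally_integrable_on_compact[OF g K(1,2)]])
  also have "(\<lambda>x. \<phi> x *\<^sub>R (if x \<in> K then g x else 0)) = (\<lambda>x. \<phi> x *\<^sub>R g x)"
    using K(3) by auto
  finally have "integrable lebesgue (\<lambda>x. \<phi> x *\<^sub>R g x)" .
  moreover have "\<phi> x *\<^sub>R g x = 0" if "x \<notin> \<Omega>" for x
    using K(2,3) that by auto
  ultimately show ?thesis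
    using lebesgue_on_vanishing(2)[OF \<Omega>, of "\<lambda>x. \<phi> x *\<^sub>R g x"] by simp
qed

section \<open>The fundamental lemma of the calculus of variations and uniqueness of weak
  derivatives\<close>

lemma integral_compact_eq_0_of_test_fun:
  fixes f :: "'a::euclidean_space \<Rightarrow> real"
  assumes \<Omega>: "open \<Omega>" and f: "locally_integrable_on \<Omega> f"
    and orth: "\<And>\<phi>. test_fun_on \<Omega> \<phi> \<Longrightarrow> (LINT x|lebesgue_on \<Omega>. \<phi> x * f x) = 0"
    and K: "compact K" "K \<subseteq> \<Omega>"
  shows "(LINT x|lebesgue_on K. f x) = 0"
proof -
  define N where "N = (\<lambda>r. {x + y |x y. x \<in> K \<and> norm y \<le> r})"
  obtain e where e: "e > 0" "(\<Union>x\<in>K. cball x e) \<subseteq> \<Omega>"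
    by (rule compact_subset_open_imp_cball_epsilon_subset[OF K(1) \<Omega> K(2)])
  \<comment> \<open>From this index on, the collars of width \<open>2 / real (Suc (k0 + k))\<close>
    around \<open>K\<close> stay within distance \<open>e\<close>, hence inside \<Omega>.\<close>
  obtain k0 where k0: "2 / e < real k0" using reals_Archimedean2 by blast
  define r where "r = (\<lambda>k. 2 / real (Suc (k0 + k)))"
  have r_le: "r k \<le> r 0" for k by (simp add: r_def frac_le)
  have r0: "r 0 \<le> e" using k0 e(1) by (simp add: r_def field_simps)
  have N_mono: "N s \<subseteq> N t" if "s \<le> t" for s t using that by (force simp: N_def)
  have "x + y \<in> \<Omega>" if "x \<in> K" "norm y \<le> r 0" for x y
  proof -
    have "x + y \<in> cball x e" using that r0 by (simp add: dist_norm)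
    then show ?thesis using e(2) that(1) by blast
  qed
  then have N_sub: "N (r 0) \<subseteq> \<Omega>" by (auto simp: N_def)
  have N_cpt: "compact (N (r 0))"
    using compact_sums[OF K(1) compact_cball[of 0 "r 0"]] by (simp add: N_def)
  have "\<exists>\<phi> :: 'a \<Rightarrow> real. test_fun_on \<Omega> \<phi> \<and> (\<forall>x\<in>K. \<phi> x = 1) \<and> (\<forall>x. 0 \<le> \<phi> x \<and> \<phi> x \<le> 1) \<and>
      (\<forall>x. x \<notin> N (r k) \<longrightarrow> \<phi> x = 0)" for k
  proof -
    have Nk: "{x + y |x y. x \<in> K \<and> norm y \<le> 2 / real (Suc (k0 + k))} = N (r k)"
      by (simp add: N_def r_def)
    show ?thesis
    proof (rule smooth_plateau[OF K(1), of "k0 + k", unfolded Nk])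
      fix \<phi> :: "'a \<Rightarrow> real"
      assume *: "\<And>\<Omega>. N (r k) \<subseteq> \<Omega> \<Longrightarrow> test_fun_on \<Omega> \<phi>" "\<And>x. x \<in> K \<Longrightarrow> \<phi> x = 1"
        "\<And>x. 0 \<le> \<phi> x" "\<And>x. \<phi> x \<le> 1" "\<And>x. x \<notin> N (r k) \<Longrightarrow> \<phi> x = 0"
      have "N (r k) \<subseteq> \<Omega>" using N_mono[OF r_le] N_sub by blast
      then show ?thesis using * by blast
    qed
  qed
  then obtain \<phi> where \<phi>: "\<And>k. test_fun_on \<Omega> (\<phi> k)" "\<And>k x. x \<in> K \<Longrightarrow> \<phi> k x = 1"
    "\<And>k x. 0 \<le> \<phi> k x" "\<And>k x. \<phi> k x \<le> (1::real)" "\<And>k x. x \<notin> N (r k) \<Longrightarrow> \<phi> k x = 0"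
    by metis
  \<comment> \<open>As \<open>f\<close> is only locally integrable, it is cut down to the largest
    collar, which is compact and contains the supports of all plateau functions. The result is
    integrable on the whole space and serves as the dominating function.\<close>
  define F where "F = (\<lambda>x. if x \<in> N (r 0) then f x else 0)"
  have F: "integrable lebesgue F"
    unfolding F_def by (rule locally_integrable_on_compact[OF f N_cpt N_sub])
  have \<Omega>': "\<Omega> \<in> sets lebesgue" using \<Omega> by simp
  have zero: "(LINT x|lebesgue. \<phi> k x * F x) = 0" for k
  proof -
    have eq: "\<phi> k x * f x = \<phi> k x * F x" for x
      using \<phi>(5)[of x k] N_mono[OF r_le, of k] by (auto simp: F_def)
    have "\<phi> k x * F x = 0" if "x \<notin> \<Omega>" for x using that N_sub by (auto simp: F_def)
    then have "(LINT x|lebesgue. \<phi> k x * F x) = (LINT x|lebesgue_on \<Omega>. \<phi> k x * F x)"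
      by (rule lebesgue_on_vanishing(1)[OF \<Omega>', symmetric])
    also have "\<dots> = 0" using orth[OF \<phi>(1)[of k]] by (simp add: eq)
    finally show ?thesis .
  qed
  \<comment> \<open>The plateau functions equal 1 on \<open>K\<close>, and their collars shrink to
    \<open>K\<close>: a point outside has positive distance from \<open>K\<close> and is eventually
    missed. Hence they converge pointwise to the indicator of \<open>K\<close>, and the vanishing of
    the integrals passes to the limit.\<close>
  have "(\<lambda>k. LINT x|lebesgue. \<phi> k x * F x) \<longlonglongrightarrow> (LINT x|lebesgue. indicator K x * F x)"
  proof (rule integral_dominated_convergence[where w = "\<lambda>x. norm (F x)"])
    have Fm: "F \<in> borel_measurable lebesgue" using F by auto
    show "(\<lambda>x. indicator K x * F x) \<in> borel_measurable lebesgue"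
      using Fm lmeasurable_compact[OF K(1)] by (intro borel_measurable_times borel_measurable_indicator) auto
    show "(\<lambda>x. \<phi> k x * F x) \<in> borel_measurable lebesgue" for k
      using Fm continuous_on_UNIV_borel_measurable_lebesgue[OF Ck_fun_continuous_on[OF test_fun_on_Ck[OF \<phi>(1)]]]
      by (intro borel_measurable_times)
    show "integrable lebesgue (\<lambda>x. norm (F x))" using F by simp
    show "AE x in lebesgue. norm (\<phi> k x * F x) \<le> norm (F x)" for k
      using \<phi>(3,4) by (intro AE_I2) (simp add: abs_mult mult_left_le_one_le)
    show "AE x in lebesgue. (\<lambda>k. \<phi> k x * F x) \<longlonglongrightarrow> indicator K x * F x"
    proof (intro AE_I2 tendsto_mult_right tendsto_eventually)
      fix x
      show "\<forall>\<^sub>F k in sequentially. \<phi> k x = indicator K x"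
      proof (cases "x \<in> K")
        case False
        have "open (- K)" using K(1) compact_imp_closed by blast
        then obtain d where d: "d > 0" "cball x d \<subseteq> - K"
          using False open_contains_cball by blast
        obtain n where n: "2 / d < real n" using reals_Archimedean2 by blast
        have "\<phi> k x = 0" if "k \<ge> n" for k
        proof (rule \<phi>(5), rule notI)
          assume "x \<in> N (r k)"
          then obtain p y where p: "x = p + y" "p \<in> K" "norm y \<le> r k" unfolding N_def by blast
          have "2 / d < real (Suc (k0 + k))" using n that by linarith
          then have "r k < d" using d(1) by (simp add: r_def field_simps)
          then have "p \<in> cball x d" using p by (simp add: dist_norm)
          then show False using d(2) p(2) by blast
        qed
        then show ?thesis using False by (auto simp: eventually_sequentially)
      qed (simp add: \<phi>(2))
    qed
  qed
  then have "(LINT x|lebesgue. indicator K x * F x) = 0"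
    by (simp add: zero LIMSEQ_const_iff)
  also have "(\<lambda>x. indicator K x * F x) = (\<lambda>x. if x \<in> K then f x else 0)"
    using e(1) K(2) by (fastforce simp: F_def N_def r_def)
  finally show ?thesis
    using lmeasurable_compact[OF K(1)] by (simp add: Lebesgue_Measure.integral_restrict_UNIV fmeasurableD)
qed

lemma integrable_lebesgue_on_subset:
  fixes f :: "'a::euclidean_space \<Rightarrow> 'b::euclidean_space"
  assumes "integrable (lebesgue_on S) f" "S \<in> sets lebesgue" "T \<in> sets lebesgue" "T \<subseteq> S"
  shows "integrable (lebesgue_on T) f"
  using set_integrable_subset[of lebesgue S f T] assms
  by (simp add: set_integrable_def integrable_restrict_space)

text \<open>A closed subset of the set where \<open>f\<close> is positive has zero integral of a
  positive function, so it is null. Inner regularity fills the whole set with such closed subsets up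
  to measure \<open>e\<close>.\<close>

lemma null_positive_set:
  fixes f :: "'a::euclidean_space \<Rightarrow> real"
  assumes f: "integrable (lebesgue_on K) f" and K: "compact K"
    and zero: "\<And>T. compact T \<Longrightarrow> T \<subseteq> K \<Longrightarrow> (LINT x|lebesgue_on T. f x) = 0"
  shows "{x \<in> K. f x > 0} \<in> null_sets lebesgue"
proof -
  let ?S = "{x \<in> K. f x > 0}"
  have K': "K \<in> sets lebesgue" using lmeasurable_compact[OF K] by auto
  have S: "?S \<in> sets lebesgue"
  proof -
    have "{x \<in> space (lebesgue_on K). f x > 0} \<in> sets (lebesgue_on K)"
      using f by (intro borel_measurable_less) auto
    then show ?thesis using K' by (simp add: sets_restrict_space_iff)
  qed
  have null: "emeasure lebesgue T = 0" if T: "closed T" "T \<subseteq> ?S" for T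
  proof -
    have sub: "T \<subseteq> K" using T by auto
    have cT: "compact T" using compact_Int_closed[OF K T(1)] sub by (simp add: inf.absorb2)
    have T': "T \<in> sets lebesgue" using lmeasurable_compact[OF cT] by auto
    have "AE x in lebesgue_on T. 0 \<le> f x"
      using T(2) by (intro AE_I2) (auto intro: less_imp_le)
    then have "AE x in lebesgue_on T. f x = 0"
      using integral_nonneg_eq_0_iff_AE[OF integrable_lebesgue_on_subset[OF f K' T' sub]] zero[OF cT sub]
      by simp
    then have "AE x in lebesgue. x \<in> T \<longrightarrow> f x = 0"
      using T' by (simp add: AE_restrict_space_iff)
    then have "AE x in lebesgue. x \<notin> T"
      by (rule AE_mp) (use T in \<open>auto intro!: AE_I2\<close>)
    then show ?thesis using AE_iff_measurable[OF T', of "\<lambda>x. x \<notin> T"] by simp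
  qed
  have "emeasure lebesgue ?S \<le> ennreal e" if e: "e > 0" for e
  proof -
    obtain T where T: "closed T" "T \<subseteq> ?S" "?S - T \<in> lmeasurable" "emeasure lebesgue (?S - T) < ennreal e"
      by (rule sets_lebesgue_inner_closed[OF S e])
    have "emeasure lebesgue (T \<union> (?S - T)) \<le> emeasure lebesgue T + emeasure lebesgue (?S - T)"
      using T(1,3) by (intro emeasure_subadditive) auto
    moreover have "T \<union> (?S - T) = ?S" using T(2) by blast
    ultimately show ?thesis using T(4) null[OF T(1,2)] by simp
  qed
  then have "emeasure lebesgue ?S \<le> 0"
    by - (rule ennreal_le_epsilon, simp)
  then show ?thesis using S by (auto simp: null_sets_def)
qed

lemma locally_integrable_on_minus:
  "locally_integrable_on \<Omega> f \<Longrightarrow> locally_integrable_on \<Omega> (\<lambda>x. - f x)"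
  by (auto simp: locally_integrable_on_def)

text \<open>\<Omega> is exhausted by countably many compact sets; on each, the previous lemma is
  applied to \<open>f\<close> and to \<open>- f\<close>.\<close>

lemma fundamental_lemma_real:
  fixes f :: "'a::euclidean_space \<Rightarrow> real"
  assumes \<Omega>: "open \<Omega>" and f: "locally_integrable_on \<Omega> f"
    and orth: "\<And>\<phi>. test_fun_on \<Omega> \<phi> \<Longrightarrow> (LINT x|lebesgue_on \<Omega>. \<phi> x * f x) = 0"
  shows "AE x in lebesgue_on \<Omega>. f x = 0"
proof -
  have "\<exists>C :: nat \<Rightarrow> 'a set. (\<forall>n. compact (C n)) \<and> (\<forall>n. C n \<subseteq> \<Omega>) \<and> (\<Union>n. C n) = \<Omega>"
  proof (rule open_Union_compact_subsets[OF \<Omega>])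
    fix C :: "nat \<Rightarrow> 'a set"
    assume "\<And>n. compact (C n)" "\<And>n. C n \<subseteq> \<Omega>" "(\<Union>n. C n) = \<Omega>"
    then show ?thesis by (intro exI[of _ C] conjI allI)
  qed
  then obtain C :: "nat \<Rightarrow> 'a set" where
    "(\<forall>n. compact (C n)) \<and> (\<forall>n. C n \<subseteq> \<Omega>) \<and> (\<Union>n. C n) = \<Omega>"
    by (rule exE)
  then have C: "\<And>n. compact (C n)" "\<And>n. C n \<subseteq> \<Omega>" and CU: "(\<Union>n. C n) = \<Omega>"
    by simp_all
  have "{x \<in> C n. f x > 0} \<in> null_sets lebesgue" for n
  proof (rule null_positive_set[OF _ C(1)])
    show "integrable (lebesgue_on (C n)) f" using f C by (simp add: locally_integrable_on_def)
    show "(LINT x|lebesgue_on T. f x) = 0" if "compact T" "T \<subseteq> C n" for T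
      by (rule integral_compact_eq_0_of_test_fun[OF \<Omega> f orth that(1)]) (use that C(2) in blast)+
  qed
  moreover have "{x \<in> C n. - f x > 0} \<in> null_sets lebesgue" for n
  proof (rule null_positive_set[OF _ C(1)])
    show "integrable (lebesgue_on (C n)) (\<lambda>x. - f x)" using f C by (simp add: locally_integrable_on_def)
    show "(LINT x|lebesgue_on T. - f x) = 0" if "compact T" "T \<subseteq> C n" for T
      by (rule integral_compact_eq_0_of_test_fun[OF \<Omega> locally_integrable_on_minus[OF f] _ that(1)])
        (use that C(2) orth in auto)
  qed
  ultimately have "(\<Union>n. {x \<in> C n. f x > 0} \<union> {x \<in> C n. - f x > 0}) \<in> null_sets lebesgue"
    by (intro null_sets_UN null_sets.Un)
  moreover have "{x \<in> \<Omega>. f x \<noteq> 0} \<subseteq> (\<Union>n. {x \<in> C n. f x > 0} \<union> {x \<in> C n. - f x > 0})"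
    unfolding CU[symmetric] by auto
  ultimately have "AE x in lebesgue. x \<in> \<Omega> \<longrightarrow> f x = 0"
    by (intro AE_I'[of "\<Union>n. {x \<in> C n. f x > 0} \<union> {x \<in> C n. - f x > 0}"]) auto
  then show ?thesis using \<Omega> by (simp add: AE_restrict_space_iff)
qed

lemma test_fun_on_inner_integral:
  fixes g :: "'a::euclidean_space \<Rightarrow> 'b::euclidean_space"
  assumes "test_fun_on \<Omega> \<phi>" "locally_integrable_on \<Omega> g" "\<Omega> \<in> sets lebesgue"
  shows "(LINT x|lebesgue_on \<Omega>. \<phi> x *\<^sub>R g x) \<bullet> i = (LINT x|lebesgue_on \<Omega>. \<phi> x * (g x \<bullet> i))"
  using integral_inner_left[OF test_fun_on_scaleR_integrable[OF assms], of i] by simp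

lemma locally_integrable_on_inner:
  "locally_integrable_on \<Omega> g \<Longrightarrow> locally_integrable_on \<Omega> (\<lambda>x. g x \<bullet> i)"
  by (auto simp: locally_integrable_on_def)

lemma locally_integrable_on_diff:
  "locally_integrable_on \<Omega> f \<Longrightarrow> locally_integrable_on \<Omega> g \<Longrightarrow> locally_integrable_on \<Omega> (\<lambda>x. f x - g x)"
  by (auto simp: locally_integrable_on_def)

lemma locally_integrable_on_add:
  "locally_integrable_on \<Omega> f \<Longrightarrow> locally_integrable_on \<Omega> g \<Longrightarrow> locally_integrable_on \<Omega> (\<lambda>x. f x + g x)"
  by (auto simp: locally_integrable_on_def)

text \<open>The difference of two weak derivatives is orthogonal to all test functions. The
  fundamental lemma is applied to each coordinate, and finitely many exceptional null sets are
  joined.\<close>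

lemma has_weak_partial_unique:
  fixes u :: "'a::euclidean_space \<Rightarrow> 'b::euclidean_space"
  assumes \<Omega>: "open \<Omega>" and g: "has_weak_partial \<Omega> b u g" and h: "has_weak_partial \<Omega> b u h"
  shows "AE x in lebesgue_on \<Omega>. g x = h x"
proof -
  have \<Omega>': "\<Omega> \<in> sets lebesgue" using \<Omega> by simp
  have gl: "locally_integrable_on \<Omega> g" and hl: "locally_integrable_on \<Omega> h"
    using g h by (auto simp: has_weak_partial_def)
  have "AE x in lebesgue_on \<Omega>. (g x - h x) \<bullet> i = 0" for i
  proof (rule fundamental_lemma_real[OF \<Omega>])
    show "locally_integrable_on \<Omega> (\<lambda>x. (g x - h x) \<bullet> i)"
      by (intro locally_integrable_on_inner locally_integrable_on_diff gl hl)
    fix \<phi> :: "'a \<Rightarrow> real" assume \<phi>: "test_fun_on \<Omega> \<phi>"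
    have "(LINT x|lebesgue_on \<Omega>. \<phi> x *\<^sub>R g x) = (LINT x|lebesgue_on \<Omega>. \<phi> x *\<^sub>R h x)"
      using g h \<phi> unfolding has_weak_partial_def by (metis neg_equal_iff_equal)
    then have "(LINT x|lebesgue_on \<Omega>. \<phi> x *\<^sub>R (g x - h x)) = 0"
      using test_fun_on_scaleR_integrable[OF \<phi> gl \<Omega>'] test_fun_on_scaleR_integrable[OF \<phi> hl \<Omega>']
      by (simp add: scaleR_diff_right)
    then show "(LINT x|lebesgue_on \<Omega>. \<phi> x * ((g x - h x) \<bullet> i)) = 0"
      using test_fun_on_inner_integral[OF \<phi> locally_integrable_on_diff[OF gl hl] \<Omega>', of i] by simp
  qed
  then have "AE x in lebesgue_on \<Omega>. \<forall>i\<in>Basis. (g x - h x) \<bullet> i = 0"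
    by (intro AE_finite_allI) auto
  then show ?thesis
    by (rule AE_mp) (auto intro!: AE_I2 simp: euclidean_eq_iff[of "g _"] inner_diff_left)
qed

text \<open>This gives access to the energies: the unspecified choice inside
  \<open>weak_partial\<close> may be replaced under an integral by any weak derivative that has been
  exhibited.\<close>

lemma weak_partial_AE_eq:
  fixes u :: "'a::euclidean_space \<Rightarrow> 'b::euclidean_space"
  assumes "open \<Omega>" "has_weak_partial \<Omega> b u g"
  shows "AE x in lebesgue_on \<Omega>. weak_partial \<Omega> b u x = g x"
  using has_weak_partial_unique[OF assms(1) _ assms(2), of "weak_partial \<Omega> b u"]
    someI[of "has_weak_partial \<Omega> b u", OF assms(2)] unfolding weak_partial_def by simp

section \<open>Calculus of weak partial derivatives\<close>

lemma has_weak_partial_subset: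
  fixes u :: "'a::euclidean_space \<Rightarrow> 'b::euclidean_space"
  assumes g: "has_weak_partial UNIV b u g" and \<Omega>: "open \<Omega>" and b: "b \<in> Basis"
  shows "has_weak_partial \<Omega> b u g"
  unfolding has_weak_partial_def
proof (intro conjI allI impI)
  show "locally_integrable_on \<Omega> u" "locally_integrable_on \<Omega> g"
    using g by (auto simp: has_weak_partial_def locally_integrable_on_def)
  fix \<phi> :: "'a \<Rightarrow> real" assume \<phi>: "test_fun_on \<Omega> \<phi>"
  have \<Omega>': "\<Omega> \<in> sets lebesgue" using \<Omega> by simp
  obtain K where K: "K \<subseteq> \<Omega>" "\<And>x. x \<notin> K \<Longrightarrow> \<phi> x = 0"
    "\<And>x h. x \<notin> K \<Longrightarrow> frechet_derivative \<phi> (at x) h = 0"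
    using test_fun_onE[OF \<phi>] by metis
  have 1: "(LINT x|lebesgue_on \<Omega>. \<phi> x *\<^sub>R g x) = (LINT x|lebesgue. \<phi> x *\<^sub>R g x)"
    by (rule lebesgue_on_vanishing(1)[OF \<Omega>']) (use K in auto)
  have 2: "(LINT x|lebesgue_on \<Omega>. frechet_derivative \<phi> (at x) b *\<^sub>R u x)
      = (LINT x|lebesgue. frechet_derivative \<phi> (at x) b *\<^sub>R u x)"
    by (rule lebesgue_on_vanishing(1)[OF \<Omega>']) (use K in auto)
  have "test_fun_on UNIV \<phi>" using \<phi> by (rule test_fun_on_mono) simp
  then show "(LINT x|lebesgue_on \<Omega>. frechet_derivative \<phi> (at x) b *\<^sub>R u x)
      = - (LINT x|lebesgue_on \<Omega>. \<phi> x *\<^sub>R g x)"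
    unfolding 1 2 using g by (simp add: has_weak_partial_def lebesgue_on_UNIV_eq)
qed

lemma locally_integrable_on_continuous:
  fixes f :: "'a::euclidean_space \<Rightarrow> 'b::euclidean_space"
  assumes "continuous_on UNIV f"
  shows "locally_integrable_on \<Omega> f"
  unfolding locally_integrable_on_def
proof (intro allI impI)
  fix K assume K: "compact K \<and> K \<subseteq> \<Omega>"
  have "continuous_on K f" using assms continuous_on_subset by blast
  then have "integrable lborel (\<lambda>x. indicator K x *\<^sub>R f x)"
    using K borel_integrable_compact[of K f] by simp
  then have "integrable lebesgue (\<lambda>x. indicator K x *\<^sub>R f x)"
    using integrable_completion borel_measurable_integrable by blast
  moreover have "K \<in> sets lebesgue" using K lmeasurable_compact by auto
  ultimately show "integrable (lebesgue_on K) f" by (simp add: integrable_restrict_space)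
qed

text \<open>Integration by parts: for each vector i, the scalar function \<phi> f \<bullet> i is a
  test function, so the integral of its partial derivative is zero, and the Leibniz rule splits that
  integral into the two sides of the identity.\<close>

lemma has_weak_partial_smooth:
  fixes f :: "'a::euclidean_space \<Rightarrow> 'b::euclidean_space"
  assumes f: "\<And>k. Ck_fun k f" and b: "b \<in> Basis"
  shows "has_weak_partial UNIV b f (\<lambda>x. frechet_derivative f (at x) b)"
  unfolding has_weak_partial_def
proof (intro conjI allI impI)
  have f': "Ck_fun k (\<lambda>x. frechet_derivative f (at x) b)" for k
    using f[of "Suc k"] b by simp
  show lf: "locally_integrable_on UNIV f"
    by (rule locally_integrable_on_continuous[OF Ck_fun_continuous_on[OF f]])
  show lf': "locally_integrable_on UNIV (\<lambda>x. frechet_derivative f (at x) b)"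
    by (rule locally_integrable_on_continuous[OF Ck_fun_continuous_on[OF f']])
  fix \<phi> :: "'a \<Rightarrow> real" assume \<phi>: "test_fun_on UNIV \<phi>"
  let ?f' = "\<lambda>x. frechet_derivative f (at x) b"
  let ?\<phi>' = "\<lambda>x. frechet_derivative \<phi> (at x) b"
  have \<phi>': "test_fun_on UNIV ?\<phi>'" using \<phi> b by (rule test_fun_on_derivative)
  have int: "integrable lebesgue (\<lambda>x. \<phi> x *\<^sub>R ?f' x)" "integrable lebesgue (\<lambda>x. ?\<phi>' x *\<^sub>R f x)"
    using test_fun_on_scaleR_integrable[OF \<phi> lf'] test_fun_on_scaleR_integrable[OF \<phi>' lf]
    by (simp_all add: lebesgue_on_UNIV_eq)
  have "(LINT x|lebesgue. \<phi> x *\<^sub>R ?f' x + ?\<phi>' x *\<^sub>R f x) \<bullet> i = 0" for i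
  proof -
    have fi: "Ck_fun k (\<lambda>x. f x \<bullet> i)" for k
      by (rule Ck_fun_bounded_linear_comp[OF bounded_linear_inner_left f])
    have df: "f differentiable (at x)" for x using f[of "Suc 0"] by simp
    have d\<phi>: "\<phi> differentiable (at x)" for x by (rule test_fun_on_differentiable[OF \<phi>])
    have "frechet_derivative (\<lambda>x. \<phi> x *\<^sub>R f x \<bullet> i) (at x) b = (\<phi> x *\<^sub>R ?f' x + ?\<phi>' x *\<^sub>R f x) \<bullet> i" for x
      by (subst frechet_derivative_at[OF bounded_linear.has_derivative[OF bounded_linear_inner_left
          has_derivative_scaleR[OF d\<phi>[unfolded frechet_derivative_works] df[unfolded frechet_derivative_works]]],
            symmetric]) (rule refl)
    moreover have "(LINT x|lebesgue. frechet_derivative (\<lambda>x. \<phi> x *\<^sub>R f x \<bullet> i) (at x) b) = 0"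
      using integral_frechet_derivative_eq_0[OF test_fun_on_scaleR[OF \<phi> fi] b] by simp
    ultimately have "(LINT x|lebesgue. (\<phi> x *\<^sub>R ?f' x + ?\<phi>' x *\<^sub>R f x) \<bullet> i) = 0" by simp
    moreover have "integrable lebesgue (\<lambda>x. \<phi> x *\<^sub>R ?f' x + ?\<phi>' x *\<^sub>R f x)"
      using int by simp
    ultimately show ?thesis by (simp only: integral_inner_left)
  qed
  then have "(LINT x|lebesgue. \<phi> x *\<^sub>R ?f' x + ?\<phi>' x *\<^sub>R f x) = 0"
    by - (rule inner_eq_zero_iff[THEN iffD1])
  then have "(LINT x|lebesgue. \<phi> x *\<^sub>R ?f' x) + (LINT x|lebesgue. ?\<phi>' x *\<^sub>R f x) = 0"
    using int by simp
  then show "(LINT x|lebesgue_on UNIV. ?\<phi>' x *\<^sub>R f x) = - (LINT x|lebesgue_on UNIV. \<phi> x *\<^sub>R ?f' x)"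
    by (simp add: lebesgue_on_UNIV_eq eq_neg_iff_add_eq_0 add.commute)
qed

lemma has_weak_partial_const: "b \<in> Basis \<Longrightarrow> has_weak_partial UNIV b (\<lambda>x. a) (\<lambda>x. 0)"
  using has_weak_partial_smooth[OF Ck_fun_const, of b a] by simp

lemma has_weak_partial_diff:
  fixes u v :: "'a::euclidean_space \<Rightarrow> 'b::euclidean_space"
  assumes "open \<Omega>" "b \<in> Basis" "has_weak_partial \<Omega> b u g" "has_weak_partial \<Omega> b v h"
  shows "has_weak_partial \<Omega> b (\<lambda>x. u x - v x) (\<lambda>x. g x - h x)"
  unfolding has_weak_partial_def
proof (intro conjI allI impI)
  have *: "locally_integrable_on \<Omega> u" "locally_integrable_on \<Omega> v"
    "locally_integrable_on \<Omega> g" "locally_integrable_on \<Omega> h"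
    using assms by (auto simp: has_weak_partial_def)
  then show "locally_integrable_on \<Omega> (\<lambda>x. u x - v x)" "locally_integrable_on \<Omega> (\<lambda>x. g x - h x)"
    by (auto intro: locally_integrable_on_diff)
  fix \<phi> :: "'a \<Rightarrow> real" assume \<phi>: "test_fun_on \<Omega> \<phi>"
  have \<Omega>: "\<Omega> \<in> sets lebesgue" using assms(1) by simp
  note int = test_fun_on_scaleR_integrable[OF _ _ \<Omega>]
  show "(LINT x|lebesgue_on \<Omega>. frechet_derivative \<phi> (at x) b *\<^sub>R (u x - v x))
      = - (LINT x|lebesgue_on \<Omega>. \<phi> x *\<^sub>R (g x - h x))"
    using assms(3,4) \<phi> int[OF \<phi> *(3)] int[OF \<phi> *(4)]
      int[OF test_fun_on_derivative[OF \<phi> assms(2)] *(1)] int[OF test_fun_on_derivative[OF \<phi> assms(2)] *(2)]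
    by (simp add: has_weak_partial_def scaleR_diff_right)
qed

lemma locally_integrable_on_scaleR:
  fixes u :: "'a::euclidean_space \<Rightarrow> 'b::euclidean_space"
  assumes "continuous_on UNIV \<psi>" "locally_integrable_on \<Omega> u"
  shows "locally_integrable_on \<Omega> (\<lambda>x. \<psi> x *\<^sub>R u x)"
  unfolding locally_integrable_on_def
proof (intro allI impI)
  fix K assume K: "compact K \<and> K \<subseteq> \<Omega>"
  have "compact (\<psi> ` K)"
    using K assms(1) by (intro compact_continuous_image continuous_on_subset[OF assms(1)]) auto
  then obtain M where M: "\<And>x. x \<in> K \<Longrightarrow> norm (\<psi> x) \<le> M"
    using compact_imp_bounded bounded_iff by (metis image_eqI)
  have K': "K \<in> sets lebesgue" using K lmeasurable_compact by auto
  have u: "integrable (lebesgue_on K) u" using assms K by (auto simp: locally_integrable_on_def)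
  show "integrable (lebesgue_on K) (\<lambda>x. \<psi> x *\<^sub>R u x)"
  proof (rule Bochner_Integration.integrable_bound)
    show "integrable (lebesgue_on K) (\<lambda>x. M *\<^sub>R u x)" using u by simp
    have "\<psi> \<in> borel_measurable (lebesgue_on K)"
      using continuous_imp_measurable_on_sets_lebesgue[OF _ K'] assms(1) continuous_on_subset by blast
    then show "(\<lambda>x. \<psi> x *\<^sub>R u x) \<in> borel_measurable (lebesgue_on K)"
      using u by (intro borel_measurable_scaleR) auto
    show "AE x in lebesgue_on K. norm (\<psi> x *\<^sub>R u x) \<le> norm (M *\<^sub>R u x)"
      using M by (auto intro!: AE_I2 mult_right_mono simp: order.trans[OF _ abs_ge_self])
  qed
qed

text \<open>The product of \<phi> and \<psi> is itself a test function. Testing the weak derivative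
  of \<open>u\<close> against it and expanding by the Leibniz rule gives the product
  formula.\<close>

lemma has_weak_partial_scaleR:
  fixes u :: "'a::euclidean_space \<Rightarrow> 'b::euclidean_space"
  assumes \<Omega>: "open \<Omega>" and b: "b \<in> Basis" and u: "has_weak_partial \<Omega> b u g"
    and \<psi>: "\<And>k. Ck_fun k (\<psi> :: 'a \<Rightarrow> real)"
  shows "has_weak_partial \<Omega> b (\<lambda>x. \<psi> x *\<^sub>R u x)
    (\<lambda>x. \<psi> x *\<^sub>R g x + frechet_derivative \<psi> (at x) b *\<^sub>R u x)"
  unfolding has_weak_partial_def
proof (intro conjI allI impI)
  have lu: "locally_integrable_on \<Omega> u" and lg: "locally_integrable_on \<Omega> g"
    using u by (auto simp: has_weak_partial_def)
  let ?\<psi>' = "\<lambda>x. frechet_derivative \<psi> (at x) b"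
  have \<psi>': "Ck_fun k ?\<psi>'" for k using \<psi>[of "Suc k"] b by simp
  show l1: "locally_integrable_on \<Omega> (\<lambda>x. \<psi> x *\<^sub>R u x)"
    by (rule locally_integrable_on_scaleR[OF Ck_fun_continuous_on[OF \<psi>] lu])
  have l2: "locally_integrable_on \<Omega> (\<lambda>x. \<psi> x *\<^sub>R g x)"
    by (rule locally_integrable_on_scaleR[OF Ck_fun_continuous_on[OF \<psi>] lg])
  have l3: "locally_integrable_on \<Omega> (\<lambda>x. ?\<psi>' x *\<^sub>R u x)"
    by (rule locally_integrable_on_scaleR[OF Ck_fun_continuous_on[OF \<psi>'] lu])
  show "locally_integrable_on \<Omega> (\<lambda>x. \<psi> x *\<^sub>R g x + ?\<psi>' x *\<^sub>R u x)"
    by (rule locally_integrable_on_add[OF l2 l3])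
  fix \<phi> :: "'a \<Rightarrow> real" assume \<phi>: "test_fun_on \<Omega> \<phi>"
  have \<Omega>': "\<Omega> \<in> sets lebesgue" using \<Omega> by simp
  let ?\<phi>' = "\<lambda>x. frechet_derivative \<phi> (at x) b"
  note int = test_fun_on_scaleR_integrable[OF _ _ \<Omega>']
  have i1: "integrable (lebesgue_on \<Omega>) (\<lambda>x. ?\<phi>' x *\<^sub>R \<psi> x *\<^sub>R u x)"
    by (rule int[OF test_fun_on_derivative[OF \<phi> b] l1])
  have i2: "integrable (lebesgue_on \<Omega>) (\<lambda>x. \<phi> x *\<^sub>R \<psi> x *\<^sub>R g x)"
    by (rule int[OF \<phi> l2])
  have i3: "integrable (lebesgue_on \<Omega>) (\<lambda>x. \<phi> x *\<^sub>R ?\<psi>' x *\<^sub>R u x)"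
    by (rule int[OF \<phi> l3])
  have d: "frechet_derivative (\<lambda>x. \<phi> x *\<^sub>R \<psi> x) (at x) b = \<phi> x *\<^sub>R ?\<psi>' x + ?\<phi>' x *\<^sub>R \<psi> x" for x
    by (rule frechet_derivative_scaleR[OF test_fun_on_differentiable[OF \<phi>]]) (use \<psi>[of "Suc 0"] in simp)
  have "(LINT x|lebesgue_on \<Omega>. (\<phi> x *\<^sub>R ?\<psi>' x + ?\<phi>' x *\<^sub>R \<psi> x) *\<^sub>R u x)
      = - (LINT x|lebesgue_on \<Omega>. (\<phi> x *\<^sub>R \<psi> x) *\<^sub>R g x)"
    using u test_fun_on_scaleR[OF \<phi> \<psi>] unfolding has_weak_partial_def d[symmetric] by blast
  then have "(LINT x|lebesgue_on \<Omega>. \<phi> x *\<^sub>R ?\<psi>' x *\<^sub>R u x) + (LINT x|lebesgue_on \<Omega>. ?\<phi>' x *\<^sub>R \<psi> x *\<^sub>R u x)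
      = - (LINT x|lebesgue_on \<Omega>. \<phi> x *\<^sub>R \<psi> x *\<^sub>R g x)"
    using i1 i3 by (simp add: scaleR_add_left)
  then show "(LINT x|lebesgue_on \<Omega>. ?\<phi>' x *\<^sub>R \<psi> x *\<^sub>R u x)
      = - (LINT x|lebesgue_on \<Omega>. \<phi> x *\<^sub>R (\<psi> x *\<^sub>R g x + ?\<psi>' x *\<^sub>R u x))"
    unfolding scaleR_add_right Bochner_Integration.integral_add[OF i2 i3]
    by (simp add: algebra_simps eq_neg_iff_add_eq_0)
qed

text \<open>For fixed x, the function y \<mapsto> \<rho>(x - y) is an admissible test function for
  \<open>v\<close>. The minus sign from the reflection cancels the one in the definition of the weak
  derivative, so the derivative moves from the kernel to \<open>v\<close>.\<close>

lemma frechet_derivative_conv_weak: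
  fixes v :: "'a::euclidean_space \<Rightarrow> 'b::euclidean_space"
  assumes \<rho>: "test_fun_on UNIV \<rho>" and b: "b \<in> Basis" and v: "integrable lebesgue v"
    and g: "has_weak_partial UNIV b v g"
  shows "frechet_derivative (conv \<rho> v) (at x) b = conv \<rho> g x"
proof -
  define \<phi> where "\<phi> = (\<lambda>y. \<rho> ((- 1) *\<^sub>R (y - x)))"
  obtain K where K: "compact K" "\<And>x. x \<notin> K \<Longrightarrow> \<rho> x = 0" using test_fun_onE[OF \<rho>] by metis
  have "test_fun_on UNIV \<phi>"
  proof (rule test_fun_onI)
    show "Ck_fun k \<phi>" for k
      unfolding \<phi>_def by (rule Ck_fun_affine[OF test_fun_on_Ck[OF \<rho>]])
    show "compact ((\<lambda>y. x - y) ` K)"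
      by (intro compact_continuous_image continuous_intros K)
    show "\<phi> y = 0" if "y \<notin> (\<lambda>y. x - y) ` K" for y
    proof -
      have "x - y \<notin> K" using that by (metis diff_diff_eq2 add_diff_cancel_left' image_eqI)
      then show ?thesis using K(2) by (simp add: \<phi>_def)
    qed
  qed simp
  then have "(LINT y|lebesgue. frechet_derivative \<phi> (at y) b *\<^sub>R v y) = - (LINT y|lebesgue. \<phi> y *\<^sub>R g y)"
    using g by (simp add: has_weak_partial_def lebesgue_on_UNIV_eq)
  moreover have "frechet_derivative \<phi> (at y) b = - frechet_derivative \<rho> (at (x - y)) b" for y
    unfolding \<phi>_def
    using frechet_derivative_affine[OF test_fun_on_differentiable[OF \<rho>], of "- 1" x y b] by simp
  ultimately have "conv (\<lambda>z. frechet_derivative \<rho> (at z) b) v x = conv \<rho> g x"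
    by (simp add: conv_def \<phi>_def)
  then show ?thesis by (simp add: frechet_derivative_conv[OF \<rho> v b])
qed

section \<open>Mollification of square-integrable functions\<close>

text \<open>Tonelli's theorem will be applied to the product of two copies of \<open>lborel\<close>,
  where y \<mapsto> f y must be Borel; this supplies such a version, coordinate by
  coordinate.\<close>

lemma lebesgue_borel_representative:
  fixes f :: "'a::euclidean_space \<Rightarrow> 'b::euclidean_space"
  assumes f: "f \<in> borel_measurable lebesgue"
  obtains g where "g \<in> borel_measurable borel" "AE x in lebesgue. f x = g x"
proof -
  have "\<forall>i\<in>Basis. \<exists>g. g \<in> borel_measurable lborel \<and> (AE x in lborel. f x \<bullet> i = g x)"
  proof
    fix i :: 'b assume "i \<in> Basis"
    have "(\<lambda>x. f x \<bullet> i) \<in> borel_measurable lebesgue"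
      using f by (intro borel_measurable_inner) auto
    then show "\<exists>g. g \<in> borel_measurable lborel \<and> (AE x in lborel. f x \<bullet> i = g x)"
      using completion_ex_borel_measurable_real by blast
  qed
  then obtain g where g: "\<And>i. i \<in> Basis \<Longrightarrow> g i \<in> borel_measurable lborel"
    "\<And>i. i \<in> Basis \<Longrightarrow> AE x in lborel. f x \<bullet> i = g i x"
    by metis
  show ?thesis
  proof
    show "(\<lambda>x. \<Sum>i\<in>Basis. g i x *\<^sub>R i) \<in> borel_measurable borel"
      using g(1) by (intro borel_measurable_sum borel_measurable_scaleR) auto
    have "AE x in lborel. \<forall>i\<in>Basis. f x \<bullet> i = g i x"
      using g(2) by (intro AE_finite_allI) auto
    then have "AE x in lborel. f x = (\<Sum>i\<in>Basis. g i x *\<^sub>R i)"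
    proof (rule eventually_mono)
      fix x assume "\<forall>i\<in>Basis. f x \<bullet> i = g i x"
      then have "(\<Sum>i\<in>Basis. g i x *\<^sub>R i) = (\<Sum>i\<in>Basis. (f x \<bullet> i) *\<^sub>R i)"
        by (intro sum.cong) auto
      then show "f x = (\<Sum>i\<in>Basis. g i x *\<^sub>R i)" by (simp add: euclidean_representation)
    qed
    then show "AE x in lebesgue. f x = (\<Sum>i\<in>Basis. g i x *\<^sub>R i)"
      by (rule AE_completion)
  qed
qed

text \<open>Jensen's inequality for the square, in the form of the variance identity: the kernel is
  a probability density with mean value m of \<open>f\<close>, and the average of |f - m|^2, which
  is nonnegative, equals the average of |f|^2 minus |m|^2.\<close>

lemma norm_conv_mollifier_sq_le:
  fixes f :: "'a::euclidean_space \<Rightarrow> 'b::euclidean_space"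
  assumes f: "integrable lebesgue f" "integrable lebesgue (\<lambda>x. (norm (f x))\<^sup>2)"
  shows "(norm (conv (mollifier k) f x))\<^sup>2 \<le> (LINT y|lebesgue. mollifier k (x - y) * (norm (f y))\<^sup>2)"
proof -
  define m where "m = conv (mollifier k) f x"
  let ?\<rho> = "\<lambda>y. mollifier k (x - y)"
  have i1: "integrable lebesgue (\<lambda>y. ?\<rho> y *\<^sub>R f y)"
    by (rule integrable_conv[OF test_fun_on_mollifier f(1)])
  have i2: "integrable lebesgue (\<lambda>y. ?\<rho> y * (norm (f y))\<^sup>2)"
    using integrable_conv[OF test_fun_on_mollifier f(2), of k x] by simp
  have i3: "integrable lebesgue (\<lambda>y. ?\<rho> y * (norm m)\<^sup>2)"
    using mollifier_integrable_reflect[of k x] by simp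
  have i4: "integrable lebesgue (\<lambda>y. 2 * ((?\<rho> y *\<^sub>R f y) \<bullet> m))"
    by (intro integrable_mult_right integrable_inner_left i1)
  have "0 \<le> (LINT y|lebesgue. ?\<rho> y * (norm (f y - m))\<^sup>2)"
    by (intro integral_nonneg_AE AE_I2 mult_nonneg_nonneg mollifier_nonneg) auto
  also have "(\<lambda>y. ?\<rho> y * (norm (f y - m))\<^sup>2)
      = (\<lambda>y. ?\<rho> y * (norm (f y))\<^sup>2 - 2 * ((?\<rho> y *\<^sub>R f y) \<bullet> m) + ?\<rho> y * (norm m)\<^sup>2)"
    by (rule ext) (simp add: power2_norm_eq_inner inner_diff_left inner_diff_right inner_commute algebra_simps)
  also have "(LINT y|lebesgue. ?\<rho> y * (norm (f y))\<^sup>2 - 2 * ((?\<rho> y *\<^sub>R f y) \<bullet> m) + ?\<rho> y * (norm m)\<^sup>2)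
      = (LINT y|lebesgue. ?\<rho> y * (norm (f y))\<^sup>2) - (LINT y|lebesgue. 2 * ((?\<rho> y *\<^sub>R f y) \<bullet> m))
        + (LINT y|lebesgue. ?\<rho> y * (norm m)\<^sup>2)"
    using i2 i3 i4 by (simp only: Bochner_Integration.integral_add Bochner_Integration.integral_diff
        Bochner_Integration.integrable_diff)
  also have "(LINT y|lebesgue. ?\<rho> y * (norm m)\<^sup>2) = (norm m)\<^sup>2"
    using mollifier_integral_reflect[of k x] by simp
  also have "(LINT y|lebesgue. 2 * ((?\<rho> y *\<^sub>R f y) \<bullet> m)) = 2 * (m \<bullet> m)"
    using integral_inner_left[OF i1, of m] by (simp add: m_def conv_def)
  finally show ?thesis
    by (simp add: m_def power2_norm_eq_inner)
qed

lemma nn_integral_mollifier_left: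
  fixes y :: "'a::euclidean_space"
  shows "(\<integral>\<^sup>+x. ennreal (mollifier k (x - y)) \<partial>lborel) = 1"
proof -
  have m: "(\<lambda>z::'a. ennreal (mollifier k (- z))) \<in> borel_measurable borel"
    using test_fun_on_borel_measurable[OF test_fun_on_mollifier] by measurable
  have m': "(\<lambda>z::'a. ennreal (mollifier k z)) \<in> borel_measurable borel"
    using test_fun_on_borel_measurable[OF test_fun_on_mollifier] by measurable
  have "(\<integral>\<^sup>+x. ennreal (mollifier k (x - y)) \<partial>lborel) = (\<integral>\<^sup>+x. ennreal (mollifier k (0 - (x::'a))) \<partial>lborel)"
    using nn_integral_lborel_reflect[OF m, of y] by simp
  also have "\<dots> = (\<integral>\<^sup>+x. ennreal (mollifier k (x::'a)) \<partial>lborel)"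
    by (rule nn_integral_lborel_reflect[OF m'])
  also have "\<dots> = (\<integral>\<^sup>+x. ennreal (mollifier k (x::'a)) \<partial>lebesgue)"
    using m' by (simp add: nn_integral_completion)
  also have "\<dots> = ennreal (LINT x|lebesgue. mollifier k (x::'a))"
    by (rule nn_integral_eq_integral[OF test_fun_on_integrable[OF test_fun_on_mollifier]])
      (simp add: mollifier_nonneg)
  finally show ?thesis by (simp add: mollifier_integral)
qed

lemma conv_cong_AE:
  assumes "AE x in lebesgue. f x = g x" "f \<in> borel_measurable lebesgue" "g \<in> borel_measurable lebesgue"
    "test_fun_on \<Omega> \<rho>"
  shows "conv \<rho> f = conv \<rho> g"
proof
  fix x
  have c: "continuous_on UNIV (\<lambda>y. \<rho> (x - y))"
    by (rule continuous_on_compose2[OF Ck_fun_continuous_on[OF test_fun_on_Ck[OF assms(4)], of UNIV]])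
      (auto intro: continuous_intros)
  show "conv \<rho> f x = conv \<rho> g x"
    unfolding conv_def
    by (rule integral_cong_AE)
      (use assms(1-3) continuous_on_UNIV_borel_measurable_lebesgue[OF c] in
        \<open>auto intro!: borel_measurable_scaleR\<close>)
qed

text \<open>The L^2 case of Young's inequality for a kernel of mass 1: Jensen's bound is integrated
  in x and the order of integration is exchanged, after which the inner integral of the kernel is
  1.\<close>

lemma nn_integral_conv_sq_le_borel:
  fixes f :: "'a::euclidean_space \<Rightarrow> 'b::euclidean_space"
  assumes f: "integrable lebesgue f" "integrable lebesgue (\<lambda>x. (norm (f x))\<^sup>2)"
    and m: "f \<in> borel_measurable borel"
  shows "(\<integral>\<^sup>+x. ennreal ((norm (conv (mollifier k) f x))\<^sup>2) \<partial>lebesgue) \<le> (\<integral>\<^sup>+x. ennreal ((norm (f x))\<^sup>2) \<partial>lebesgue)"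
proof -
  have \<rho>m: "(mollifier k :: 'a \<Rightarrow> real) \<in> borel_measurable borel"
    by (rule test_fun_on_borel_measurable[OF test_fun_on_mollifier])
  have cm: "conv (mollifier k) f \<in> borel_measurable borel"
    by (rule borel_measurable_continuous_onI[OF Ck_fun_continuous_on[OF Ck_fun_conv[OF f(1) test_fun_on_mollifier]]])
  have "(\<integral>\<^sup>+x. ennreal ((norm (conv (mollifier k) f x))\<^sup>2) \<partial>lebesgue)
      = (\<integral>\<^sup>+x. ennreal ((norm (conv (mollifier k) f x))\<^sup>2) \<partial>lborel)"
    using cm by (simp add: nn_integral_completion)
  also have "\<dots> \<le> (\<integral>\<^sup>+x. (\<integral>\<^sup>+y. ennreal (mollifier k (x - y) * (norm (f y))\<^sup>2) \<partial>lborel) \<partial>lborel)"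
  proof (rule nn_integral_mono)
    fix x
    have "ennreal ((norm (conv (mollifier k) f x))\<^sup>2) \<le> ennreal (LINT y|lebesgue. mollifier k (x - y) * (norm (f y))\<^sup>2)"
      by (intro ennreal_leI norm_conv_mollifier_sq_le f)
    also have "\<dots> = (\<integral>\<^sup>+y. ennreal (mollifier k (x - y) * (norm (f y))\<^sup>2) \<partial>lebesgue)"
      using integrable_conv[OF test_fun_on_mollifier f(2), of k x]
      by (intro nn_integral_eq_integral[symmetric]) (auto simp: mollifier_nonneg)
    also have "\<dots> = (\<integral>\<^sup>+y. ennreal (mollifier k (x - y) * (norm (f y))\<^sup>2) \<partial>lborel)"
      by (rule nn_integral_completion) (use \<rho>m m in measurable)
    finally show "ennreal ((norm (conv (mollifier k) f x))\<^sup>2)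
      \<le> (\<integral>\<^sup>+y. ennreal (mollifier k (x - y) * (norm (f y))\<^sup>2) \<partial>lborel)" .
  qed
  also have "\<dots> = (\<integral>\<^sup>+y. (\<integral>\<^sup>+x. ennreal (mollifier k (x - y) * (norm (f y))\<^sup>2) \<partial>lborel) \<partial>lborel)"
    by (rule lborel_pair.Fubini'[symmetric]) (use \<rho>m m in measurable)
  also have "\<dots> = (\<integral>\<^sup>+y. ennreal ((norm (f y))\<^sup>2) \<partial>lborel)"
  proof (rule nn_integral_cong)
    fix y
    have "(\<integral>\<^sup>+x. ennreal (mollifier k (x - y) * (norm (f y))\<^sup>2) \<partial>lborel)
        = (\<integral>\<^sup>+x. ennreal (mollifier k (x - y)) * ennreal ((norm (f y))\<^sup>2) \<partial>lborel)"
      by (simp add: ennreal_mult mollifier_nonneg)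
    also have "\<dots> = (\<integral>\<^sup>+x. ennreal (mollifier k (x - y)) \<partial>lborel) * ennreal ((norm (f y))\<^sup>2)"
      by (rule nn_integral_multc) (use \<rho>m in measurable)
    finally show "(\<integral>\<^sup>+x. ennreal (mollifier k (x - y) * (norm (f y))\<^sup>2) \<partial>lborel) = ennreal ((norm (f y))\<^sup>2)"
      by (simp add: nn_integral_mollifier_left)
  qed
  also have "\<dots> = (\<integral>\<^sup>+x. ennreal ((norm (f x))\<^sup>2) \<partial>lebesgue)"
    using m by (simp add: nn_integral_completion)
  finally show ?thesis .
qed

lemma nn_integral_conv_sq_le:
  fixes f :: "'a::euclidean_space \<Rightarrow> 'b::euclidean_space"
  assumes f: "integrable lebesgue f" "integrable lebesgue (\<lambda>x. (norm (f x))\<^sup>2)"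
  shows "(\<integral>\<^sup>+x. ennreal ((norm (conv (mollifier k) f x))\<^sup>2) \<partial>lebesgue) \<le> (\<integral>\<^sup>+x. ennreal ((norm (f x))\<^sup>2) \<partial>lebesgue)"
proof -
  have fm: "f \<in> borel_measurable lebesgue" using f by auto
  obtain g where g: "g \<in> borel_measurable borel" "AE x in lebesgue. f x = g x"
    by (rule lebesgue_borel_representative[OF fm])
  have gm: "g \<in> borel_measurable lebesgue" using g(1) by (simp add: measurable_completion)
  have g2: "AE x in lebesgue. (norm (f x))\<^sup>2 = (norm (g x))\<^sup>2"
    using g(2) by (rule AE_mp) auto
  have "integrable lebesgue g"
    using integrable_cong_AE[OF fm gm g(2)] f by simp
  moreover have "integrable lebesgue (\<lambda>x. (norm (g x))\<^sup>2)"
    using integrable_cong_AE[OF _ _ g2] f gm by auto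
  ultimately have "(\<integral>\<^sup>+x. ennreal ((norm (conv (mollifier k) g x))\<^sup>2) \<partial>lebesgue) \<le> (\<integral>\<^sup>+x. ennreal ((norm (g x))\<^sup>2) \<partial>lebesgue)"
    using g(1) by (rule nn_integral_conv_sq_le_borel)
  moreover have "conv (mollifier k) f = conv (mollifier k) g"
    by (rule conv_cong_AE[OF g(2) fm gm test_fun_on_mollifier])
  moreover have "(\<integral>\<^sup>+x. ennreal ((norm (f x))\<^sup>2) \<partial>lebesgue) = (\<integral>\<^sup>+x. ennreal ((norm (g x))\<^sup>2) \<partial>lebesgue)"
    by (rule nn_integral_cong_AE) (use g2 in auto)
  ultimately show ?thesis by simp
qed

section \<open>Radial truncation and approximation by continuous functions in L^2\<close>

definition clip :: "real \<Rightarrow> 'b::real_normed_vector \<Rightarrow> 'b" where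
  "clip N y = (N / max N (norm y)) *\<^sub>R y"

lemma norm_clip_le: "N > 0 \<Longrightarrow> norm (clip N y) \<le> N"
  by (simp add: clip_def field_simps max_def)

lemma clip_eq: "N > 0 \<Longrightarrow> norm y \<le> N \<Longrightarrow> clip N y = y"
  by (simp add: clip_def max_def)

lemma norm_diff_clip_le:
  assumes "N > 0"
  shows "norm (y - clip N y) \<le> norm y"
proof -
  define t where "t = N / max N (norm y)"
  have t: "0 \<le> t" "t \<le> 1" using assms by (auto simp: t_def)
  have "y - clip N y = (1 - t) *\<^sub>R y" by (simp add: clip_def t_def scaleR_diff_left)
  then have "norm (y - clip N y) = (1 - t) * norm y" using t by simp
  also have "\<dots> \<le> 1 * norm y" using t by (intro mult_right_mono) auto
  finally show ?thesis by simp
qed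

lemma continuous_on_clip: "N > 0 \<Longrightarrow> continuous_on S (clip N)"
  unfolding clip_def[abs_def] by (intro continuous_intros) (auto simp: max_def split: if_splits)

lemma norm_add_sq_le: "(norm (x + y))\<^sup>2 \<le> 2 * (norm x)\<^sup>2 + 2 * (norm y)\<^sup>2"
proof -
  have "(norm (x + y))\<^sup>2 \<le> (norm x + norm y)\<^sup>2"
    by (intro power_mono norm_triangle_ineq) simp
  also have "\<dots> \<le> 2 * (norm x)\<^sup>2 + 2 * (norm y)\<^sup>2"
    using sum_squares_bound[of "norm x" "norm y"] by (simp add: power2_sum)
  finally show ?thesis .
qed

lemma borel_measurable_clip:
  fixes w :: "'a::euclidean_space \<Rightarrow> 'b::euclidean_space"
  assumes "N > 0" "w \<in> borel_measurable M"
  shows "(\<lambda>x. clip N (w x)) \<in> borel_measurable M"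
  using measurable_compose[OF assms(2) borel_measurable_continuous_onI[OF continuous_on_clip[OF assms(1)]]] .

text \<open>The error is dominated by |w|^2, and at each point it is eventually zero, namely once
  the truncation radius exceeds |w x|.\<close>

lemma L2_clip_approx:
  fixes w :: "'a::euclidean_space \<Rightarrow> 'b::euclidean_space"
  assumes w: "w \<in> borel_measurable lebesgue" "integrable lebesgue (\<lambda>x. (norm (w x))\<^sup>2)"
  shows "(\<lambda>n. LINT x|lebesgue. (norm (w x - clip (real (Suc n)) (w x)))\<^sup>2) \<longlonglongrightarrow> 0"
    and "integrable lebesgue (\<lambda>x. (norm (w x - clip (real (Suc n)) (w x)))\<^sup>2)"
proof -
  have m: "(\<lambda>x. (norm (w x - clip (real (Suc n)) (w x)))\<^sup>2) \<in> borel_measurable lebesgue" for n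
    using w(1) borel_measurable_clip[OF _ w(1), of "real (Suc n)"] by auto
  have le: "norm ((norm (w x - clip (real (Suc n)) (w x)))\<^sup>2) \<le> (norm (w x))\<^sup>2" for x n
    using norm_diff_clip_le[of "real (Suc n)" "w x"] by (simp add: power_mono)
  show "integrable lebesgue (\<lambda>x. (norm (w x - clip (real (Suc n)) (w x)))\<^sup>2)"
    by (rule Bochner_Integration.integrable_bound[OF w(2) m]) (use le in \<open>auto simp del: of_nat_Suc\<close>)
  have "(\<lambda>n. LINT x|lebesgue. (norm (w x - clip (real (Suc n)) (w x)))\<^sup>2) \<longlonglongrightarrow> (LINT x|(lebesgue :: 'a measure). 0)"
  proof (rule integral_dominated_convergence[where w = "\<lambda>x. (norm (w x))\<^sup>2"])
    show "AE x in lebesgue. (\<lambda>n. (norm (w x - clip (real (Suc n)) (w x)))\<^sup>2) \<longlonglongrightarrow> 0"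
    proof (intro AE_I2 tendsto_eventually)
      fix x
      obtain n where n: "norm (w x) \<le> real n" using real_arch_simple by blast
      have "(norm (w x - clip (real (Suc k)) (w x)))\<^sup>2 = 0" if "k \<ge> n" for k
        using n that clip_eq[of "real (Suc k)" "w x"] by simp
      then show "\<forall>\<^sub>F n in sequentially. (norm (w x - clip (real (Suc n)) (w x)))\<^sup>2 = 0"
        unfolding eventually_sequentially by blast
    qed
    show "AE x in lebesgue. norm ((norm (w x - clip (real (Suc n)) (w x)))\<^sup>2) \<le> (norm (w x))\<^sup>2" for n
      by (intro AE_I2 le)
  qed (use m w in \<open>auto simp del: of_nat_Suc\<close>)
  then show "(\<lambda>n. LINT x|lebesgue. (norm (w x - clip (real (Suc n)) (w x)))\<^sup>2) \<longlonglongrightarrow> 0"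
    by simp
qed

text \<open>A Lebesgue measurable function is an almost everywhere limit of continuous functions,
  but without any domination. Truncating both \<open>w\<close> and these functions at height
  \<open>N\<close> bounds the error by \<open>2 * N\<close>, and a cut-off confines it to a ball, so
  dominated convergence applies.\<close>

lemma L2_approx_continuous:
  fixes w :: "'a::euclidean_space \<Rightarrow> 'b::euclidean_space"
  assumes w: "w \<in> borel_measurable lebesgue" "integrable lebesgue (\<lambda>x. (norm (w x))\<^sup>2)"
    and supp: "\<And>x. x \<notin> cball 0 r \<Longrightarrow> w x = 0" and "e > 0"
  shows "\<exists>h. continuous_on UNIV h \<and> (\<forall>x. x \<notin> cball 0 (r + 1) \<longrightarrow> h x = 0) \<and>
    integrable lebesgue (\<lambda>x. (norm (w x - h x))\<^sup>2) \<and> (LINT x|lebesgue. (norm (w x - h x))\<^sup>2) < e"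
proof -
  \<comment> \<open>Two errors are combined at the end by |x + y|^2 \<le> 2 |x|^2 + 2 |y|^2, so each
    may use \<open>e / 4\<close>.\<close>
  have "\<forall>\<^sub>F n in sequentially. (LINT x|lebesgue. (norm (w x - clip (real (Suc n)) (w x)))\<^sup>2) < e / 4"
    by (rule order_tendstoD(2)[OF L2_clip_approx(1)[OF w]]) (use \<open>e > 0\<close> in simp)
  then obtain n where n: "(LINT x|lebesgue. (norm (w x - clip (real (Suc n)) (w x)))\<^sup>2) < e / 4"
    by (auto simp only: eventually_sequentially)
  define N where "N = real (Suc n)"
  have N: "N > 0" by (simp add: N_def)
  have "w measurable_on UNIV"
    by (rule lebesgue_measurable_imp_measurable_on[OF w(1)]) simp
  then obtain Z g where Z: "negligible Z" and g: "\<And>n. continuous_on UNIV (g n)"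
    and lim: "\<And>x. x \<notin> Z \<Longrightarrow> (\<lambda>n. g n x) \<longlonglongrightarrow> w x"
    by (auto simp: measurable_on_def)
  define \<eta> where "\<eta> = (\<lambda>x::'a. max 0 (min 1 (r + 1 - norm x)))"
  have \<eta>: "0 \<le> \<eta> x" "\<eta> x \<le> 1" for x by (auto simp: \<eta>_def)
  have \<eta>1: "\<eta> x = 1" if "x \<in> cball 0 r" for x using that by (auto simp: \<eta>_def)
  have \<eta>0: "\<eta> x = 0" if "x \<notin> cball 0 (r + 1)" for x using that by (auto simp: \<eta>_def)
  have \<eta>c: "continuous_on UNIV \<eta>" unfolding \<eta>_def by (intro continuous_intros)
  define h where "h = (\<lambda>n x. \<eta> x *\<^sub>R clip N (g n x))"
  have hc: "continuous_on UNIV (h n)" for n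
    unfolding h_def by (intro continuous_intros \<eta>c continuous_on_compose2[OF continuous_on_clip[OF N, of UNIV] g]) auto
  have h0: "h n x = 0" if "x \<notin> cball 0 (r + 1)" for n x using \<eta>0[OF that] by (simp add: h_def)
  let ?P = "\<lambda>x. clip N (w x)"
  have P0: "?P x = 0" if "x \<notin> cball 0 r" for x using supp[OF that] by (simp add: clip_def)
  \<comment> \<open>The cut-off is 1 wherever the truncated \<open>w\<close> can be nonzero; thus it
    does not disturb the limit of the \<open>h n\<close>.\<close>
  have \<eta>P: "\<eta> x *\<^sub>R ?P x = ?P x" for x
    using \<eta>1[of x] P0[of x] by (cases "x \<in> cball 0 r") auto
  have Pm: "?P \<in> borel_measurable lebesgue" by (rule borel_measurable_clip[OF N w(1)])
  have hm: "h n \<in> borel_measurable lebesgue" for n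
    by (rule continuous_on_UNIV_borel_measurable_lebesgue[OF hc])
  have m: "(\<lambda>x. (norm (?P x - h n x))\<^sup>2) \<in> borel_measurable lebesgue" for n
    using Pm hm[of n] by auto
  have bound: "(norm (?P x - h n x))\<^sup>2 \<le> (2 * N)\<^sup>2 * indicator (cball 0 (r + 1)) x" for n x
  proof (cases "x \<in> cball 0 (r + 1)")
    case True
    have "norm (h n x) \<le> 1 * N"
      unfolding h_def norm_scaleR using \<eta>[of x] norm_clip_le[OF N, of "g n x"] by (intro mult_mono) auto
    then have "norm (?P x - h n x) \<le> 2 * N"
      using norm_triangle_ineq4[of "?P x" "h n x"] norm_clip_le[OF N, of "w x"] by linarith
    then have "(norm (?P x - h n x))\<^sup>2 \<le> (2 * N)\<^sup>2" by (rule power_mono) simp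
    then show ?thesis using True by (simp only: indicator_simps mult_1_right)
  next
    case False
    then have "x \<notin> cball 0 r" by auto
    then show ?thesis using False h0[OF False] P0 by simp
  qed
  have bi: "integrable lebesgue (\<lambda>x. (2 * N)\<^sup>2 * indicator (cball (0::'a) (r + 1)) x)"
    using integrable_indicator_compact[OF compact_cball] by (rule integrable_mult_right)
  have hi: "integrable lebesgue (\<lambda>x. (norm (?P x - h n x))\<^sup>2)" for n
    by (rule Bochner_Integration.integrable_bound[OF bi m]) (use bound in \<open>auto intro!: AE_I2 order.trans[OF _ abs_ge_self]\<close>)
  have "(\<lambda>n. LINT x|lebesgue. (norm (?P x - h n x))\<^sup>2) \<longlonglongrightarrow> (LINT x|(lebesgue :: 'a measure). 0)"
  proof (rule integral_dominated_convergence[where w = "\<lambda>x. (2 * N)\<^sup>2 * indicator (cball 0 (r + 1)) x"])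
    have "Z \<in> null_sets lebesgue" using Z by (simp add: negligible_iff_null_sets)
    then have "AE x in lebesgue. x \<notin> Z" by (rule AE_not_in)
    then show "AE x in lebesgue. (\<lambda>n. (norm (?P x - h n x))\<^sup>2) \<longlonglongrightarrow> 0"
    proof (rule eventually_mono)
      fix x assume "x \<notin> Z"
      have "(\<lambda>n. clip N (g n x)) \<longlonglongrightarrow> ?P x"
        by (rule continuous_on_tendsto_compose[OF continuous_on_clip[OF N, of UNIV] lim[OF \<open>x \<notin> Z\<close>]]) auto
      then have "(\<lambda>n. (norm (?P x - h n x))\<^sup>2) \<longlonglongrightarrow> (norm (?P x - \<eta> x *\<^sub>R ?P x))\<^sup>2"
        unfolding h_def by (intro tendsto_intros)
      then show "(\<lambda>n. (norm (?P x - h n x))\<^sup>2) \<longlonglongrightarrow> 0" by (simp add: \<eta>P)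
    qed
    show "AE x in lebesgue. norm ((norm (?P x - h n x))\<^sup>2) \<le> (2 * N)\<^sup>2 * indicator (cball 0 (r + 1)) x" for n
      using bound by (intro AE_I2) simp
  qed (use m bi in auto)
  then have "\<forall>\<^sub>F k in sequentially. (LINT x|lebesgue. (norm (?P x - h k x))\<^sup>2) < e / 4"
    by (rule order_tendstoD(2)) (use \<open>e > 0\<close> in simp)
  then obtain k where k: "(LINT x|lebesgue. (norm (?P x - h k x))\<^sup>2) < e / 4"
    by (auto simp only: eventually_sequentially)
  have ci: "integrable lebesgue (\<lambda>x. (norm (w x - ?P x))\<^sup>2)"
    unfolding N_def by (rule L2_clip_approx(2)[OF w])
  have le: "(norm (w x - h k x))\<^sup>2 \<le> 2 * (norm (w x - ?P x))\<^sup>2 + 2 * (norm (?P x - h k x))\<^sup>2" for x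
    using norm_add_sq_le[of "w x - ?P x" "?P x - h k x"] by simp
  have si: "integrable lebesgue (\<lambda>x. 2 * (norm (w x - ?P x))\<^sup>2 + 2 * (norm (?P x - h k x))\<^sup>2)"
    by (intro Bochner_Integration.integrable_add integrable_mult_right ci hi)
  have i: "integrable lebesgue (\<lambda>x. (norm (w x - h k x))\<^sup>2)"
  proof (rule Bochner_Integration.integrable_bound[OF si])
    show "(\<lambda>x. (norm (w x - h k x))\<^sup>2) \<in> borel_measurable lebesgue" using w(1) hm[of k] by auto
    show "AE x in lebesgue. norm ((norm (w x - h k x))\<^sup>2)
        \<le> norm (2 * (norm (w x - ?P x))\<^sup>2 + 2 * (norm (?P x - h k x))\<^sup>2)"
      using le by (intro AE_I2) simp
  qed
  have "(LINT x|lebesgue. (norm (w x - h k x))\<^sup>2)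
      \<le> (LINT x|lebesgue. 2 * (norm (w x - ?P x))\<^sup>2 + 2 * (norm (?P x - h k x))\<^sup>2)"
    by (rule integral_mono[OF i si le])
  also have "\<dots> = 2 * (LINT x|lebesgue. (norm (w x - ?P x))\<^sup>2) + 2 * (LINT x|lebesgue. (norm (?P x - h k x))\<^sup>2)"
    using ci hi[of k] by simp
  also have "\<dots> < e" using n k by (simp add: N_def del: of_nat_Suc)
  finally have "(LINT x|lebesgue. (norm (w x - h k x))\<^sup>2) < e" .
  then show ?thesis using hc h0 i by (intro exI[of _ "h k"] conjI allI impI)
qed

text \<open>The difference is an average of h y - h x over points y near x, hence below the modulus
  of continuity. The indicator records that supports grow by at most 1, which turns the uniform
  estimate into an L^2 estimate.\<close>

lemma conv_continuous_uniform:
  fixes h :: "'a::euclidean_space \<Rightarrow> 'b::euclidean_space"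
  assumes h: "continuous_on UNIV h" and supp: "\<And>x. x \<notin> cball 0 r \<Longrightarrow> h x = 0" and "e > 0"
  shows "\<forall>\<^sub>F k in sequentially. \<forall>x. norm (conv (mollifier k) h x - h x) \<le> e * indicator (cball 0 (r + 1)) x"
proof -
  have hi: "integrable lebesgue h"
    by (rule integrable_compact_support[OF h compact_cball[of 0 r] supp])
  obtain d where d: "d > 0" "\<And>x y. dist x y < d \<Longrightarrow> dist (h x) (h y) < e"
    using compact_support_uniformly_continuous[OF h compact_cball supp] \<open>e > 0\<close>
    unfolding uniformly_continuous_on_def by (metis UNIV_I)
  obtain n where n: "1 / d < real n" using reals_Archimedean2 by blast
  have "norm (conv (mollifier k) h x - h x) \<le> e * indicator (cball 0 (r + 1)) x" if "k \<ge> n" for k x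
  proof -
    let ?\<rho> = "\<lambda>y. mollifier k (x - y)"
    have kd: "1 / real (Suc k) \<le> d"
    proof -
      have "1 / d \<le> real (Suc k)" using n that by linarith
      then show ?thesis using d(1) by (simp add: field_simps)
    qed
    have near: "mollifier k (x - y) = 0 \<or> norm (x - y) < min d 1" for y
    proof (cases "norm (x - y) < 1 / real (Suc k)")
      case True
      moreover have "1 / real (Suc k) \<le> 1" by simp
      ultimately show ?thesis using kd by linarith
    qed (use mollifier_eq_0[of k "x - y"] in auto)
    have i1: "integrable lebesgue (\<lambda>y. ?\<rho> y *\<^sub>R h y)"
      by (rule integrable_conv[OF test_fun_on_mollifier hi])
    have i2: "integrable lebesgue (\<lambda>y. ?\<rho> y *\<^sub>R h x)"
      using mollifier_integrable_reflect[of k x] by simp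
    show ?thesis
    proof (cases "x \<in> cball 0 (r + 1)")
      case True
      have "conv (mollifier k) h x - h x = (LINT y|lebesgue. ?\<rho> y *\<^sub>R h y) - (LINT y|lebesgue. ?\<rho> y *\<^sub>R h x)"
        using mollifier_integral_reflect[of k x] mollifier_integrable_reflect[of k x] by (simp add: conv_def)
      also have "\<dots> = (LINT y|lebesgue. ?\<rho> y *\<^sub>R (h y - h x))"
        using i1 i2 by (simp only: scaleR_diff_right Bochner_Integration.integral_diff)
      also have "norm \<dots> \<le> (LINT y|lebesgue. ?\<rho> y * e)"
      proof (rule norm_integral_le_integral)
        show "integrable lebesgue (\<lambda>y. ?\<rho> y *\<^sub>R (h y - h x))"
          using i1 i2 by (simp only: scaleR_diff_right Bochner_Integration.integrable_diff)
        show "integrable lebesgue (\<lambda>y. ?\<rho> y * e)"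
          using mollifier_integrable_reflect[of k x] by simp
        show "norm (?\<rho> y *\<^sub>R (h y - h x)) \<le> ?\<rho> y * e" for y
        proof (cases "mollifier k (x - y) = 0")
          case False
          then have "dist (h y) (h x) < e"
            using near[of y] by (intro d(2)) (auto simp: dist_norm norm_minus_commute)
          then show ?thesis
            using mollifier_nonneg[of k "x - y"] by (simp add: dist_norm mult_left_mono)
        qed simp
      qed
      also have "\<dots> = e" using mollifier_integral_reflect[of k x] by simp
      finally show ?thesis using True by simp
    next
      case False
      have "conv (mollifier k) h x = 0"
      proof (rule conv_eq_0)
        fix y
        show "h y = 0 \<or> mollifier k (x - y) = 0"
        proof (rule ccontr)
          assume "\<not> ?thesis"
          then have "norm y \<le> r" "norm (x - y) < 1" using supp[of y] near[of y] by auto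
          then have "norm x \<le> r + 1" using norm_triangle_ineq[of y "x - y"] by simp
          then show False using False by simp
        qed
      qed
      moreover have "h x = 0" using supp[of x] False by auto
      ultimately show ?thesis using False by simp
    qed
  qed
  then show ?thesis unfolding eventually_sequentially by blast
qed

lemma conv_diff:
  assumes "test_fun_on \<Omega> \<rho>" "integrable lebesgue f" "integrable lebesgue g"
  shows "conv \<rho> (\<lambda>x. f x - g x) x = conv \<rho> f x - conv \<rho> g x"
  using integrable_conv[OF assms(1,2), of x] integrable_conv[OF assms(1,3), of x]
  by (simp add: conv_def scaleR_diff_right)

lemma integrable_of_L2_support:
  fixes w :: "'a::euclidean_space \<Rightarrow> 'b::euclidean_space"
  assumes "w \<in> borel_measurable lebesgue" "integrable lebesgue (\<lambda>x. (norm (w x))\<^sup>2)"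
    "compact K" "\<And>x. x \<notin> K \<Longrightarrow> w x = 0"
  shows "integrable lebesgue w"
proof (rule Bochner_Integration.integrable_bound)
  show "integrable lebesgue (\<lambda>x. indicator K x + (norm (w x))\<^sup>2)"
    using integrable_indicator_compact[OF assms(3)] assms(2) by simp
  have "norm (w x) \<le> indicator K x + (norm (w x))\<^sup>2" for x
  proof (cases "x \<in> K")
    case True
    have "0 \<le> (norm (w x) - 1/2)\<^sup>2" by simp
    then show ?thesis using True by (simp add: power2_diff power2_eq_square algebra_simps)
  qed (use assms(4) in simp)
  then show "AE x in lebesgue. norm (w x) \<le> norm (indicator K x + (norm (w x))\<^sup>2)"
    by (intro AE_I2) (simp add: abs_of_nonneg)
qed fact

lemma ennreal_tendsto_0I:
  fixes f :: "'a \<Rightarrow> ennreal"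
  assumes "\<And>e::real. e > 0 \<Longrightarrow> \<forall>\<^sub>F x in F. f x \<le> ennreal e"
  shows "(f \<longlongrightarrow> 0) F"
proof (rule order_tendstoI)
  fix a :: ennreal assume "0 < a"
  then obtain z where z: "0 < z" "z < a" using dense by blast
  then obtain e where e: "z = ennreal e" "e > 0"
    by (cases z) auto
  show "\<forall>\<^sub>F x in F. f x < a"
    using assms[OF e(2)] by (rule eventually_mono) (use z e in auto)
qed simp

text \<open>Density argument: with \<open>h\<close> continuous and close to \<open>w\<close>, the
  error splits into the mollified w - h, which convolution does not enlarge in L^2, the difference h
  - w itself, and the mollification error of \<open>h\<close>, which is uniformly small on a fixed
  ball.\<close>

lemma conv_mollifier_L2_tendsto:
  fixes w :: "'a::euclidean_space \<Rightarrow> 'b::euclidean_space"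
  assumes w: "w \<in> borel_measurable lebesgue" "integrable lebesgue (\<lambda>x. (norm (w x))\<^sup>2)"
    and K: "compact K" "\<And>x. x \<notin> K \<Longrightarrow> w x = 0"
  shows "(\<lambda>k. \<integral>\<^sup>+x. ennreal ((norm (conv (mollifier k) w x - w x))\<^sup>2) \<partial>lebesgue) \<longlonglongrightarrow> 0"
proof (rule ennreal_tendsto_0I)
  fix e :: real assume "e > 0"
  obtain r where "\<forall>x\<in>K. norm x \<le> r"
    using compact_imp_bounded[OF K(1)] unfolding bounded_iff by blast
  then have supp: "w x = 0" if "x \<notin> cball 0 r" for x using that K(2)[of x] by auto
  have wi: "integrable lebesgue w" by (rule integrable_of_L2_support[OF w K])
  \<comment> \<open>The first two errors enter with factor 4 and together cost 2e/3; the third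
    enters with factor 2 and costs at most e/4.\<close>
  have "e / 12 > 0" using \<open>e > 0\<close> by simp
  from L2_approx_continuous[OF w supp this] obtain h where "continuous_on UNIV h \<and>
    (\<forall>x. x \<notin> cball 0 (r + 1) \<longrightarrow> h x = 0) \<and>
    integrable lebesgue (\<lambda>x. (norm (w x - h x))\<^sup>2) \<and> (LINT x|lebesgue. (norm (w x - h x))\<^sup>2) < e / 12"
    by (rule exE)
  then have h: "continuous_on UNIV h" "\<And>x. x \<notin> cball 0 (r + 1) \<Longrightarrow> h x = 0"
    "integrable lebesgue (\<lambda>x. (norm (w x - h x))\<^sup>2)" "(LINT x|lebesgue. (norm (w x - h x))\<^sup>2) < e / 12"
    by auto
  have hi: "integrable lebesgue h" by (rule integrable_compact_support[OF h(1) compact_cball h(2)])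
  define V where "V = measure lebesgue (cball (0::'a) (r + 1 + 1))"
  \<comment> \<open>Chosen so that \<delta>^2 times the volume \<open>V\<close> is at most e/8; the
    added 1 covers the case \<open>V = 0\<close>.\<close>
  define \<delta> where "\<delta> = sqrt (e / (8 * (V + 1)))"
  have V: "V \<ge> 0" by (simp add: V_def)
  have \<delta>: "\<delta> > 0" "\<delta>\<^sup>2 = e / (8 * (V + 1))"
    using \<open>e > 0\<close> V by (auto simp: \<delta>_def intro!: divide_pos_pos real_sqrt_pow2)
  have nn_wh: "(\<integral>\<^sup>+x. ennreal ((norm (w x - h x))\<^sup>2) \<partial>lebesgue) \<le> ennreal (e / 12)"
    using nn_integral_eq_integral[OF h(3)] h(4) by (simp add: ennreal_leI)
  have "(\<integral>\<^sup>+x. ennreal ((norm (conv (mollifier k) w x - w x))\<^sup>2) \<partial>lebesgue) \<le> ennreal e"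
    if k: "\<forall>x. norm (conv (mollifier k) h x - h x) \<le> \<delta> * indicator (cball 0 (r + 1 + 1)) x" for k
  proof -
    let ?c = "conv (mollifier k)"
    have c: "?c f \<in> borel_measurable lebesgue" if "integrable lebesgue f" for f :: "'a \<Rightarrow> 'b"
      by (rule continuous_on_UNIV_borel_measurable_lebesgue[OF Ck_fun_continuous_on[OF Ck_fun_conv[OF that test_fun_on_mollifier]]])
    have hm: "h \<in> borel_measurable lebesgue" using hi by auto
    have whi: "integrable lebesgue (\<lambda>x. w x - h x)" using wi hi by simp
    have pt: "(norm (?c w x - w x))\<^sup>2 \<le> 4 * (norm (?c (\<lambda>x. w x - h x) x))\<^sup>2
        + 4 * (norm (w x - h x))\<^sup>2 + 2 * (norm (?c h x - h x))\<^sup>2" for x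
    proof -
      have eq: "?c w x - w x = (?c (\<lambda>x. w x - h x) x + (h x - w x)) + (?c h x - h x)"
        by (simp add: conv_diff[OF test_fun_on_mollifier wi hi])
      show ?thesis
        unfolding eq
        using norm_add_sq_le[of "?c (\<lambda>x. w x - h x) x + (h x - w x)" "?c h x - h x"]
          norm_add_sq_le[of "?c (\<lambda>x. w x - h x) x" "h x - w x", unfolded norm_minus_commute[of "h x" "w x"]]
        by linarith
    qed
    have "(\<integral>\<^sup>+x. ennreal ((norm (?c w x - w x))\<^sup>2) \<partial>lebesgue)
        \<le> (\<integral>\<^sup>+x. 4 * ennreal ((norm (?c (\<lambda>x. w x - h x) x))\<^sup>2)
          + 4 * ennreal ((norm (w x - h x))\<^sup>2) + 2 * ennreal ((norm (?c h x - h x))\<^sup>2) \<partial>lebesgue)"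
    proof (rule nn_integral_mono)
      fix x
      have "ennreal ((norm (?c w x - w x))\<^sup>2) \<le> ennreal (4 * (norm (?c (\<lambda>x. w x - h x) x))\<^sup>2
        + 4 * (norm (w x - h x))\<^sup>2 + 2 * (norm (?c h x - h x))\<^sup>2)"
        by (intro ennreal_leI pt)
      also have "\<dots> = 4 * ennreal ((norm (?c (\<lambda>x. w x - h x) x))\<^sup>2)
          + 4 * ennreal ((norm (w x - h x))\<^sup>2) + 2 * ennreal ((norm (?c h x - h x))\<^sup>2)"
        by (simp add: ennreal_mult)
      finally show "ennreal ((norm (?c w x - w x))\<^sup>2) \<le> 4 * ennreal ((norm (?c (\<lambda>x. w x - h x) x))\<^sup>2)
          + 4 * ennreal ((norm (w x - h x))\<^sup>2) + 2 * ennreal ((norm (?c h x - h x))\<^sup>2)" .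
    qed
    also have "\<dots> = 4 * (\<integral>\<^sup>+x. ennreal ((norm (?c (\<lambda>x. w x - h x) x))\<^sup>2) \<partial>lebesgue)
        + 4 * (\<integral>\<^sup>+x. ennreal ((norm (w x - h x))\<^sup>2) \<partial>lebesgue)
        + 2 * (\<integral>\<^sup>+x. ennreal ((norm (?c h x - h x))\<^sup>2) \<partial>lebesgue)"
    proof -
      have m1: "(\<lambda>x. ennreal ((norm (?c (\<lambda>x. w x - h x) x))\<^sup>2)) \<in> borel_measurable lebesgue"
        using c[OF whi] by measurable
      have m2: "(\<lambda>x. ennreal ((norm (w x - h x))\<^sup>2)) \<in> borel_measurable lebesgue"
        using w(1) hm by measurable
      have m3: "(\<lambda>x. ennreal ((norm (?c h x - h x))\<^sup>2)) \<in> borel_measurable lebesgue"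
        using c[OF hi] hm by measurable
      show ?thesis
        using m1 m2 m3 by (simp add: nn_integral_add nn_integral_cmult)
    qed
    also have "\<dots> \<le> 4 * ennreal (e / 12) + 4 * ennreal (e / 12) + 2 * ennreal (\<delta>\<^sup>2 * V)"
    proof (intro add_mono mult_left_mono)
      show "(\<integral>\<^sup>+x. ennreal ((norm (?c (\<lambda>x. w x - h x) x))\<^sup>2) \<partial>lebesgue) \<le> ennreal (e / 12)"
        using nn_integral_conv_sq_le[OF whi h(3)] nn_wh by (rule order.trans)
      show "(\<integral>\<^sup>+x. ennreal ((norm (w x - h x))\<^sup>2) \<partial>lebesgue) \<le> ennreal (e / 12)" by (rule nn_wh)
      have "(\<integral>\<^sup>+x. ennreal ((norm (?c h x - h x))\<^sup>2) \<partial>lebesgue)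
          \<le> (\<integral>\<^sup>+x. ennreal (\<delta>\<^sup>2) * indicator (cball (0::'a) (r + 1 + 1)) x \<partial>lebesgue)"
      proof (rule nn_integral_mono)
        fix x
        show "ennreal ((norm (?c h x - h x))\<^sup>2) \<le> ennreal (\<delta>\<^sup>2) * indicator (cball (0::'a) (r + 1 + 1)) x"
        proof (cases "x \<in> cball 0 (r + 1 + 1)")
          case True
          then show ?thesis using k[rule_format, of x] by (simp add: ennreal_leI power_mono)
        next
          case False
          then have "norm (?c h x - h x) = 0" using k[rule_format, of x] by simp
          then show ?thesis by simp
        qed
      qed
      also have "\<dots> = ennreal (\<delta>\<^sup>2) * emeasure lebesgue (cball (0::'a) (r + 1 + 1))"
        by (rule nn_integral_cmult_indicator) simp
      also have "\<dots> = ennreal (\<delta>\<^sup>2 * V)"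
        by (simp only: emeasure_eq_measure2[OF lmeasurable_cball] V_def[symmetric] ennreal_mult[OF zero_le_power2 V])
      finally show "(\<integral>\<^sup>+x. ennreal ((norm (?c h x - h x))\<^sup>2) \<partial>lebesgue) \<le> ennreal (\<delta>\<^sup>2 * V)" .
    qed auto
    also have "\<dots> = ennreal (2 * e / 3 + 2 * (\<delta>\<^sup>2 * V))"
    proof -
      have "4 * ennreal (e / 12) = ennreal (4 * (e / 12))" "2 * ennreal (\<delta>\<^sup>2 * V) = ennreal (2 * (\<delta>\<^sup>2 * V))"
        using ennreal_mult[of 4 "e / 12"] ennreal_mult[of 2 "\<delta>\<^sup>2 * V"] \<open>e > 0\<close> V by simp_all
      then show ?thesis
        using \<open>e > 0\<close> V by (simp flip: ennreal_plus)
    qed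
    also have "\<dots> \<le> ennreal e"
    proof (rule ennreal_leI)
      have "\<delta>\<^sup>2 * V \<le> e / 8" unfolding \<delta>(2) using \<open>e > 0\<close> V by (simp add: field_simps)
      then show "2 * e / 3 + 2 * (\<delta>\<^sup>2 * V) \<le> e" using \<open>e > 0\<close> by simp
    qed
    finally show ?thesis .
  qed
  then show "\<forall>\<^sub>F k in sequentially. (\<integral>\<^sup>+x. ennreal ((norm (conv (mollifier k) w x - w x))\<^sup>2) \<partial>lebesgue) \<le> ennreal e"
    using conv_continuous_uniform[OF h(1,2) \<delta>(1)] by (rule eventually_mono[rotated])
qed

text \<open>The mollifications of \<open>v\<close> are the required test functions. Their partial
  derivatives are the mollifications of the \<open>G b\<close>, so convergence in the W^(1,2) norm
  reduces to L^2 convergence for \<open>v\<close> and for each of the finitely many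
  \<open>G b\<close>.\<close>

lemma compact_support_in_W12_0:
  fixes v :: "'a::euclidean_space \<Rightarrow> 'b::euclidean_space"
  assumes \<Omega>: "open \<Omega>" and K: "compact K" "K \<subseteq> \<Omega>"
    and v: "v \<in> borel_measurable lebesgue" "integrable lebesgue (\<lambda>x. (norm (v x))\<^sup>2)" "\<And>x. x \<notin> K \<Longrightarrow> v x = 0"
    and G: "\<And>b. b \<in> Basis \<Longrightarrow> has_weak_partial UNIV b v (G b)"
      "\<And>b. b \<in> Basis \<Longrightarrow> G b \<in> borel_measurable lebesgue"
      "\<And>b. b \<in> Basis \<Longrightarrow> integrable lebesgue (\<lambda>x. (norm (G b x))\<^sup>2)"
      "\<And>b x. b \<in> Basis \<Longrightarrow> x \<notin> K \<Longrightarrow> G b x = 0"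
  shows "v \<in> W12_0 \<Omega>"
proof -
  have \<Omega>': "\<Omega> \<in> sets lebesgue" using \<Omega> by simp
  have L2: "L2_on \<Omega> f" if f: "f \<in> borel_measurable lebesgue" "integrable lebesgue (\<lambda>x. (norm (f x))\<^sup>2)"
    "\<And>x. x \<notin> K \<Longrightarrow> f x = 0" for f :: "'a \<Rightarrow> 'b"
    unfolding L2_on_def
  proof
    show "f \<in> borel_measurable (lebesgue_on \<Omega>)" using f(1) by (rule measurable_restrict_space1)
    show "integrable (lebesgue_on \<Omega>) (\<lambda>x. (norm (f x))\<^sup>2)"
      by (subst lebesgue_on_vanishing(2)[OF \<Omega>']) (use f K in auto)
  qed
  have vi: "integrable lebesgue v" by (rule integrable_of_L2_support[OF v(1,2) K(1) v(3)])
  have W: "v \<in> W12 \<Omega>"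
    unfolding W12_def
  proof (intro CollectI conjI ballI)
    fix b :: 'a assume b: "b \<in> Basis"
    have "L2_on \<Omega> (G b)" by (rule L2) (use G b in auto)
    then show "\<exists>g. has_weak_partial \<Omega> b v g \<and> L2_on \<Omega> g"
      using has_weak_partial_subset[OF G(1)[OF b] \<Omega> b] by blast
  qed (use L2 v in auto)
  obtain d where d: "d > 0" "(\<Union>x\<in>K. cball x d) \<subseteq> \<Omega>"
    by (rule compact_subset_open_imp_cball_epsilon_subset[OF K(1) \<Omega> K(2)])
  \<comment> \<open>Shifting the index by \<open>k0\<close> makes every mollification radius at most
    \<open>d\<close>, so each member of the sequence, not only a tail, is supported in
    \<Omega>.\<close>
  obtain k0 where k0: "1 / d < real k0" using reals_Archimedean2 by blast
  define \<phi> where "\<phi> = (\<lambda>k. conv (mollifier (k0 + k)) v)"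
  define N where "N = {x + y |x y. x \<in> K \<and> y \<in> cball 0 d}"
  have N: "compact N" unfolding N_def by (rule compact_sums[OF K(1) compact_cball])
  have "x + y \<in> \<Omega>" if "x \<in> K" "norm y \<le> d" for x y
  proof -
    have "x + y \<in> cball x d" using that by (simp add: dist_norm)
    then show ?thesis using d(2) that(1) by blast
  qed
  then have N\<Omega>: "N \<subseteq> \<Omega>" by (auto simp: N_def)
  have \<phi>C: "Ck_fun j (\<phi> k)" for j k
    unfolding \<phi>_def by (rule Ck_fun_conv[OF vi test_fun_on_mollifier])
  have \<phi>: "test_fun_on \<Omega> (\<phi> k)" for k
  proof (rule test_fun_onI[OF \<phi>C N N\<Omega>])
    fix x assume x: "x \<notin> N"
    show "\<phi> k x = 0"
      unfolding \<phi>_def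
    proof (rule conv_eq_0)
      fix y
      show "v y = 0 \<or> mollifier (k0 + k) (x - y) = 0"
      proof (cases "y \<in> K")
        case True
        have "\<not> norm (x - y) \<le> d"
        proof
          assume "norm (x - y) \<le> d"
          then have "x - y \<in> cball 0 d" by simp
          moreover have "x = y + (x - y)" by simp
          ultimately show False using x True unfolding N_def by blast
        qed
        moreover have "1 / real (Suc (k0 + k)) \<le> d"
        proof -
          have "1 / d \<le> real (Suc (k0 + k))" using k0 by linarith
          then show ?thesis using d(1) by (simp add: field_simps)
        qed
        ultimately show ?thesis by (intro disjI2 mollifier_eq_0) linarith
      qed (use v(3) in auto)
    qed
  qed
  let ?D = "\<lambda>k f x. ennreal ((norm (conv (mollifier (k0 + k)) f x - f x))\<^sup>2)"
  have bound: "W12_normsq \<Omega> (\<lambda>x. \<phi> k x - v x)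
      \<le> (\<integral>\<^sup>+x. ?D k v x \<partial>lebesgue) + (\<Sum>b\<in>Basis. \<integral>\<^sup>+x. ?D k (G b) x \<partial>lebesgue)" for k
  proof -
    \<comment> \<open>\<open>W12_normsq\<close> uses the chosen partial derivatives of the
      difference; they are identified almost everywhere with the mollification errors of the
      \<open>G b\<close>.\<close>
    have "AE x in lebesgue_on \<Omega>. weak_partial \<Omega> b (\<lambda>x. \<phi> k x - v x) x = conv (mollifier (k0 + k)) (G b) x - G b x"
      if b: "b \<in> Basis" for b
    proof (rule weak_partial_AE_eq[OF \<Omega>])
      have "has_weak_partial UNIV b (\<lambda>x. \<phi> k x - v x) (\<lambda>x. frechet_derivative (\<phi> k) (at x) b - G b x)"
        by (rule has_weak_partial_diff[OF open_UNIV b has_weak_partial_smooth[OF \<phi>C b] G(1)[OF b]])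
      then have "has_weak_partial UNIV b (\<lambda>x. \<phi> k x - v x) (\<lambda>x. conv (mollifier (k0 + k)) (G b) x - G b x)"
        unfolding \<phi>_def frechet_derivative_conv_weak[OF test_fun_on_mollifier b vi G(1)[OF b]] .
      then show "has_weak_partial \<Omega> b (\<lambda>x. \<phi> k x - v x) (\<lambda>x. conv (mollifier (k0 + k)) (G b) x - G b x)"
        by (rule has_weak_partial_subset[OF _ \<Omega> b])
    qed
    then have AE: "AE x in lebesgue_on \<Omega>. \<forall>b\<in>Basis. weak_partial \<Omega> b (\<lambda>x. \<phi> k x - v x) x
        = conv (mollifier (k0 + k)) (G b) x - G b x"
      by (intro AE_finite_allI) auto
    have cm: "conv (mollifier (k0 + k)) f \<in> borel_measurable lebesgue" if "integrable lebesgue f" for f :: "'a \<Rightarrow> 'b"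
      by (rule continuous_on_UNIV_borel_measurable_lebesgue[OF Ck_fun_continuous_on[OF Ck_fun_conv[OF that test_fun_on_mollifier]]])
    have Dm: "?D k f \<in> borel_measurable lebesgue" if "integrable lebesgue f" for f :: "'a \<Rightarrow> 'b"
    proof -
      have "f \<in> borel_measurable lebesgue" using that by auto
      then show ?thesis using cm[OF that] by measurable
    qed
    have Gi: "integrable lebesgue (G b)" if "b \<in> Basis" for b
      by (rule integrable_of_L2_support[OF G(2,3)[OF that] K(1) G(4)[OF that]])
    have "W12_normsq \<Omega> (\<lambda>x. \<phi> k x - v x) = (\<integral>\<^sup>+x. ?D k v x + (\<Sum>b\<in>Basis. ?D k (G b) x) \<partial>lebesgue_on \<Omega>)"
      unfolding W12_normsq_def
    proof (rule nn_integral_cong_AE, rule eventually_mono[OF AE])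
      fix x assume "\<forall>b\<in>Basis. weak_partial \<Omega> b (\<lambda>x. \<phi> k x - v x) x = conv (mollifier (k0 + k)) (G b) x - G b x"
      then show "ennreal ((norm (\<phi> k x - v x))\<^sup>2 + weak_grad_normsq \<Omega> (\<lambda>x. \<phi> k x - v x) x)
          = ?D k v x + (\<Sum>b\<in>Basis. ?D k (G b) x)"
        by (simp add: weak_grad_normsq_def \<phi>_def sum_nonneg ennreal_plus sum_ennreal)
    qed
    also have "\<dots> \<le> (\<integral>\<^sup>+x. ?D k v x + (\<Sum>b\<in>Basis. ?D k (G b) x) \<partial>lebesgue)"
      using \<Omega>' by (subst nn_integral_restrict_space) (auto intro!: nn_integral_mono simp: indicator_def)
    also have "\<dots> = (\<integral>\<^sup>+x. ?D k v x \<partial>lebesgue) + (\<Sum>b\<in>Basis. \<integral>\<^sup>+x. ?D k (G b) x \<partial>lebesgue)"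
    proof -
      have "(\<integral>\<^sup>+x. (\<Sum>b\<in>Basis. ?D k (G b) x) \<partial>lebesgue) = (\<Sum>b\<in>Basis. \<integral>\<^sup>+x. ?D k (G b) x \<partial>lebesgue)"
        by (rule nn_integral_sum[OF Dm[OF Gi]])
      moreover have "(\<lambda>x. \<Sum>b\<in>Basis. ?D k (G b) x) \<in> borel_measurable lebesgue"
        by (rule borel_measurable_sum[OF Dm[OF Gi]])
      ultimately show ?thesis by (simp only: nn_integral_add[OF Dm[OF vi]])
    qed
    finally show ?thesis .
  qed
  have lim: "(\<lambda>k. \<integral>\<^sup>+x. ?D k f x \<partial>lebesgue) \<longlonglongrightarrow> 0"
    if f: "f \<in> borel_measurable lebesgue" "integrable lebesgue (\<lambda>x. (norm (f x))\<^sup>2)"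
    "\<And>x. x \<notin> K \<Longrightarrow> f x = 0" for f :: "'a \<Rightarrow> 'b"
    using LIMSEQ_ignore_initial_segment[OF conv_mollifier_L2_tendsto[OF f(1,2) K(1) f(3)], of k0]
    by (simp add: add.commute)
  have "(\<lambda>k. (\<integral>\<^sup>+x. ?D k v x \<partial>lebesgue) + (\<Sum>b\<in>Basis. \<integral>\<^sup>+x. ?D k (G b) x \<partial>lebesgue))
      \<longlonglongrightarrow> 0 + (\<Sum>b\<in>(Basis::'a set). 0)"
    by (intro tendsto_add tendsto_sum lim) (use v G in auto)
  then have "(\<lambda>k. W12_normsq \<Omega> (\<lambda>x. \<phi> k x - v x)) \<longlonglongrightarrow> 0"
    by (intro tendsto_sandwich[OF always_eventually always_eventually[OF allI[OF bound]] tendsto_const]) simp_all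
  then show ?thesis
    unfolding W12_0_def using W \<phi> by (intro CollectI conjI exI[of _ \<phi>] allI)
qed

section \<open>Comparison with a cut-off competitor\<close>

lemma norm_sq_orthogonal_split:
  fixes z e :: "'a::real_inner"
  assumes "norm e = 1"
  shows "(norm z)\<^sup>2 = (norm (z - (z \<bullet> e) *\<^sub>R e))\<^sup>2 + (z \<bullet> e)\<^sup>2"
proof -
  have "e \<bullet> e = 1" using assms by (simp add: norm_eq_1)
  then show ?thesis
    unfolding power2_norm_eq_inner
    by (simp add: inner_diff_left inner_diff_right inner_commute power2_eq_square)
qed

text \<open>Minimality may only be tested on Lipschitz domains, and balls are the ones used. With
  \<open>e\<close> the inward normal at the boundary point \<open>p\<close>, the ball lies near
  \<open>p\<close> above the hemisphere of height c \<bullet> e - sqrt(S^2 - |y - y0|^2).\<close>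

lemma bounded_lipschitz_open_ball:
  fixes c :: "'a::euclidean_space"
  assumes S: "S > 0"
  shows "bounded_lipschitz_open (ball c S)"
  unfolding bounded_lipschitz_open_def
proof (intro conjI ballI)
  fix p assume "p \<in> frontier (ball c S)"
  then have p: "norm (c - p) = S" using S by (simp add: frontier_ball dist_norm)
  define e where "e = (1 / S) *\<^sub>R (c - p)"
  have e: "norm e = 1" using p S by (simp add: e_def)
  have pe: "p = c - S *\<^sub>R e" using S by (simp add: e_def)
  define y0 where "y0 = c - (c \<bullet> e) *\<^sub>R e"
  \<comment> \<open>The hemisphere is steep at its rim. Capping the distance at \<open>S / 2\<close>
    keeps the square root at least \<open>S / 2\<close>, so that \<gamma> is Lipschitz everywhere,
    and changes nothing over \<open>ball p (S / 2)\<close>.\<close>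
  define m where "m = (\<lambda>y. min (norm (y - y0)) (S / 2))"
  define \<gamma> where "\<gamma> = (\<lambda>y. c \<bullet> e - sqrt (S\<^sup>2 - (m y)\<^sup>2))"
  have m: "0 \<le> m y" "m y \<le> S / 2" for y using S by (auto simp: m_def)
  have low0: "(S / 2)\<^sup>2 \<le> S\<^sup>2 - (m y)\<^sup>2" for y
  proof -
    have "(m y)\<^sup>2 \<le> (S / 2)\<^sup>2" using m by (intro power_mono)
    moreover have "(S / 2)\<^sup>2 + (S / 2)\<^sup>2 \<le> S\<^sup>2" by (simp add: power_divide)
    ultimately show ?thesis by linarith
  qed
  have low: "S / 2 \<le> sqrt (S\<^sup>2 - (m y)\<^sup>2)" for y
    by (rule real_le_rsqrt[OF low0])
  have "1-lipschitz_on {y. y \<bullet> e = 0} \<gamma>"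
  proof (rule lipschitz_onI)
    fix y z
    let ?a = "sqrt (S\<^sup>2 - (m y)\<^sup>2)" and ?b = "sqrt (S\<^sup>2 - (m z)\<^sup>2)"
    have sq: "?a\<^sup>2 = S\<^sup>2 - (m y)\<^sup>2" "?b\<^sup>2 = S\<^sup>2 - (m z)\<^sup>2"
      by (rule real_sqrt_pow2[OF order.trans[OF zero_le_power2 low0]])+
    have "\<bar>m y - m z\<bar> \<le> dist y z"
      using norm_triangle_ineq3[of "y - y0" "z - y0"] by (auto simp: m_def dist_norm min_def)
    moreover have "\<bar>m y + m z\<bar> \<le> S" using m[of y] m[of z] by simp
    ultimately have "\<bar>m y - m z\<bar> * \<bar>m y + m z\<bar> \<le> dist y z * S"
      by (intro mult_mono) auto
    \<comment> \<open>Factoring the difference of squares avoids derivatives: the sum of the roots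
      is at least \<open>S\<close>, the sum of the capped distances at most \<open>S\<close>, so the
      Lipschitz constant is 1.\<close>
    moreover have "\<bar>?a - ?b\<bar> * \<bar>?a + ?b\<bar> = \<bar>m y - m z\<bar> * \<bar>m y + m z\<bar>"
    proof -
      have "(?a - ?b) * (?a + ?b) = - ((m y - m z) * (m y + m z))"
        using sq by (simp add: algebra_simps power2_eq_square)
      then show ?thesis by (metis abs_minus_cancel abs_mult)
    qed
    moreover have "S \<le> \<bar>?a + ?b\<bar>" using low[of y] low[of z] by linarith
    then have "\<bar>?a - ?b\<bar> * S \<le> \<bar>?a - ?b\<bar> * \<bar>?a + ?b\<bar>" by (rule mult_left_mono) simp
    ultimately have "\<bar>?a - ?b\<bar> * S \<le> dist y z * S" by linarith
    then have "\<bar>?a - ?b\<bar> \<le> dist y z" using S by simp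
    then show "dist (\<gamma> y) (\<gamma> z) \<le> 1 * dist y z" by (simp add: \<gamma>_def dist_real_def abs_minus_commute)
  qed simp
  moreover have "x \<in> ball c S \<longleftrightarrow> \<gamma> (x - (x \<bullet> e) *\<^sub>R e) < x \<bullet> e" if x: "x \<in> ball p (S / 2)" for x
  proof -
    define z where "z = x - c"
    define s where "s = norm (z - (z \<bullet> e) *\<^sub>R e)"
    have ee: "e \<bullet> e = 1" using e by (simp add: norm_eq_1)
    have pr: "x - (x \<bullet> e) *\<^sub>R e - y0 = z - (z \<bullet> e) *\<^sub>R e"
      by (simp add: y0_def z_def inner_diff_left scaleR_diff_left)
    have xp: "x - p = z + S *\<^sub>R e" by (simp add: z_def pe)
    have "(norm (x - p))\<^sup>2 = s\<^sup>2 + (z \<bullet> e + S)\<^sup>2"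
      unfolding xp norm_sq_orthogonal_split[OF e, of "z + S *\<^sub>R e"] s_def
      by (simp add: inner_add_left ee scaleR_add_left)
    moreover have "(norm (x - p))\<^sup>2 < (S / 2)\<^sup>2"
      using x by (intro power_strict_mono) (auto simp: dist_norm norm_minus_commute)
    ultimately have lt: "s\<^sup>2 + (z \<bullet> e + S)\<^sup>2 < (S / 2)\<^sup>2" by simp
    have "s\<^sup>2 < (S / 2)\<^sup>2" using lt zero_le_power2[of "z \<bullet> e + S"] by linarith
    then have s: "s < S / 2" by (rule power_less_imp_less_base) (use S in simp)
    have "(z \<bullet> e + S)\<^sup>2 < (S / 2)\<^sup>2" using lt zero_le_power2[of s] by linarith
    then have "z \<bullet> e + S < S / 2" by (rule power_less_imp_less_base) (use S in simp)
    \<comment> \<open>The point lies on the side of the centre towards \<open>p\<close>, so squaring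
      the comparison with the square root is an equivalence.\<close>
    then have neg: "- (z \<bullet> e) > 0" using S by simp
    have ms: "m (x - (x \<bullet> e) *\<^sub>R e) = s" using s by (simp add: m_def pr s_def)
    have "\<gamma> (x - (x \<bullet> e) *\<^sub>R e) < x \<bullet> e \<longleftrightarrow> - (z \<bullet> e) < sqrt (S\<^sup>2 - s\<^sup>2)"
      by (auto simp: \<gamma>_def ms z_def inner_diff_left)
    also have "\<dots> \<longleftrightarrow> (- (z \<bullet> e))\<^sup>2 < S\<^sup>2 - s\<^sup>2"
      using neg by (metis abs_of_pos real_sqrt_abs real_sqrt_less_iff)
    also have "\<dots> \<longleftrightarrow> (norm z)\<^sup>2 < S\<^sup>2"
      unfolding norm_sq_orthogonal_split[OF e, of z] s_def by auto
    also have "\<dots> \<longleftrightarrow> norm z < S"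
      using S by (metis norm_ge_zero order_less_imp_le power2_less_imp_less power_strict_mono zero_less_numeral)
    finally show ?thesis by (simp add: z_def dist_norm norm_minus_commute)
  qed
  then have "ball c S \<inter> ball p (S / 2) = {x \<in> ball p (S / 2). \<gamma> (x - (x \<bullet> e) *\<^sub>R e) < x \<bullet> e}"
    by auto
  ultimately show "\<exists>r>0. \<exists>e L. \<exists>\<gamma>. norm e = 1 \<and> L-lipschitz_on {y. y \<bullet> e = 0} \<gamma> \<and>
      ball c S \<inter> ball p r = {x \<in> ball p r. \<gamma> (x - (x \<bullet> e) *\<^sub>R e) < x \<bullet> e}"
    using S e by (intro exI[of _ "S / 2"] conjI exI[of _ e] exI[of _ 1] exI[of _ \<gamma>]) auto
qed auto

text \<open>One profile is fixed once and for all; the cut-off at scale R is its dilation, whose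
  partial derivatives are bounded by C / R with the same \<open>C\<close>.\<close>

lemma unit_cutoff:
  "\<exists>(\<eta> :: 'a::euclidean_space \<Rightarrow> real) C. test_fun_on UNIV \<eta> \<and> (\<forall>x. norm x \<le> 1 \<longrightarrow> \<eta> x = 1) \<and>
    (\<forall>x. 0 \<le> \<eta> x \<and> \<eta> x \<le> 1) \<and> (\<forall>x. norm x > 2 \<longrightarrow> \<eta> x = 0) \<and>
    (\<forall>b\<in>Basis. \<forall>x. \<bar>frechet_derivative \<eta> (at x) b\<bar> \<le> C)"
\<comment> \<open>Index 1 gives a collar of width 2/2 = 1 around the unit ball, hence support in the
  ball of radius 2.\<close>
proof (rule smooth_plateau[OF compact_cball[of "0::'a" 1], of 1])
  fix \<eta> :: "'a \<Rightarrow> real"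
  let ?N = "{x + y |x y. x \<in> cball 0 1 \<and> norm (y::'a) \<le> 2 / real (Suc 1)}"
  assume *: "\<And>\<Omega>. ?N \<subseteq> \<Omega> \<Longrightarrow> test_fun_on \<Omega> \<eta>" "\<And>x. x \<in> cball 0 1 \<Longrightarrow> \<eta> x = 1" "\<And>x. 0 \<le> \<eta> x"
    "\<And>x. \<eta> x \<le> 1" "\<And>x. x \<notin> ?N \<Longrightarrow> \<eta> x = 0"
  have \<eta>: "test_fun_on UNIV \<eta>" by (rule *(1)) simp
  have "\<forall>b\<in>Basis. \<exists>M. M \<ge> 0 \<and> (\<forall>x. norm (frechet_derivative \<eta> (at x) b) \<le> M)"
    by (metis test_fun_on_bounded[OF test_fun_on_derivative[OF \<eta>]])
  then obtain M where M: "\<And>b. b \<in> Basis \<Longrightarrow> M b \<ge> 0"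
    "\<And>b x. b \<in> Basis \<Longrightarrow> norm (frechet_derivative \<eta> (at x) b) \<le> M b"
    by metis
  define C where "C = (\<Sum>b\<in>Basis. M b)"
  have "\<bar>frechet_derivative \<eta> (at x) b\<bar> \<le> C" if "b \<in> Basis" for b x
  proof -
    have "M b \<le> (\<Sum>b\<in>Basis. M b)" using that M(1) by (intro member_le_sum) auto
    then show ?thesis using M(2)[OF that, of x] by (simp add: C_def)
  qed
  moreover have "\<eta> x = 0" if "norm x > 2" for x
  proof (rule *(5), rule notI)
    assume "x \<in> ?N"
    then obtain y z where "x = y + z" "norm y \<le> 1" "norm z \<le> 1" by auto
    then show False using that norm_triangle_ineq[of y z] by simp
  qed
  ultimately show ?thesis using \<eta> *(2-4) by (intro exI[of _ \<eta>] exI[of _ C]) simp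
qed

text \<open>AM-GM: the cross term is at most \<open>t\<^sup>2 |g|\<^sup>2 + 4 d\<^sup>2 |w|\<^sup>2\<close>, and its first part is absorbed by the
  loss \<open>1 - (1 - t\<^sup>2)\<^sup>2 \<ge> t\<^sup>2\<close> in the coefficient of \<open>|g|\<^sup>2\<close>.\<close>

lemma cutoff_gradient_bound:
  fixes g w :: "'b::real_inner"
  assumes t: "0 \<le> t" "t \<le> 1"
  shows "(norm ((1 - t\<^sup>2) *\<^sub>R g - (2 * t * d) *\<^sub>R w))\<^sup>2 \<le> (norm g)\<^sup>2 + 8 * (\<bar>d\<bar> * norm w)\<^sup>2"
proof -
  define G X where "G = norm g" and "X = \<bar>d\<bar> * norm w"
  have nn: "G \<ge> 0" "X \<ge> 0" by (auto simp: G_def X_def)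
  have t2: "0 \<le> t\<^sup>2" "t\<^sup>2 \<le> 1" using t by (auto simp: power_le_one)
  have "norm ((1 - t\<^sup>2) *\<^sub>R g - (2 * t * d) *\<^sub>R w) \<le> (1 - t\<^sup>2) * G + 2 * t * X"
    using norm_triangle_ineq4[of "(1 - t\<^sup>2) *\<^sub>R g" "(2 * t * d) *\<^sub>R w"] t t2
    by (simp add: G_def X_def abs_mult mult_ac)
  then have "(norm ((1 - t\<^sup>2) *\<^sub>R g - (2 * t * d) *\<^sub>R w))\<^sup>2 \<le> ((1 - t\<^sup>2) * G + 2 * t * X)\<^sup>2"
    by (rule power_mono) simp
  also have "\<dots> = (1 - t\<^sup>2)\<^sup>2 * G\<^sup>2 + (1 - t\<^sup>2) * (4 * (t * G * X)) + 4 * (t\<^sup>2 * X\<^sup>2)"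
    by (simp add: power2_eq_square algebra_simps)
  also have "\<dots> \<le> (1 - t\<^sup>2) * G\<^sup>2 + 4 * (t * G * X) + 4 * (1 * X\<^sup>2)"
  proof (intro add_mono mult_left_mono mult_right_mono)
    show "(1 - t\<^sup>2)\<^sup>2 \<le> 1 - t\<^sup>2"
      using mult_left_mono[of "1 - t\<^sup>2" 1 "1 - t\<^sup>2"] t2 by (simp add: power2_eq_square)
    show "(1 - t\<^sup>2) * (4 * (t * G * X)) \<le> 4 * (t * G * X)"
      using t t2 nn by (intro mult_left_le_one_le) auto
  qed (use t2 in auto)
  also have "4 * (t * G * X) \<le> t\<^sup>2 * G\<^sup>2 + 4 * X\<^sup>2"
    using zero_le_power2[of "t * G - 2 * X"] by (simp add: power2_eq_square algebra_simps)
  finally show ?thesis by (simp add: G_def X_def algebra_simps)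
qed

text \<open>In the bound, each of the \<open>DIM('a)\<close> directions contributes 8 (C M / R)^2 to
  the squared gradient of the competitor, and the energy carries the factor 1/2; this gives the
  constant 4. The domain has radius 3R so that the support of the perturbation is compact inside
  it.\<close>

lemma minimizer_measure_bound:
  fixes A :: "'b::euclidean_space set" and u :: "'a::euclidean_space \<Rightarrow> 'b" and \<eta> :: "'a \<Rightarrow> real"
  assumes A: "closed A" "a \<in> A" and min: "J_minimizer A u" and uc: "continuous_on UNIV u"
    and avoid: "\<And>x. u x \<in> A \<Longrightarrow> u x = a"
    and M: "AE x in lebesgue. norm (u x - a) \<le> M"
    and \<eta>: "test_fun_on UNIV \<eta>" "\<And>x. norm x \<le> 1 \<Longrightarrow> \<eta> x = 1" "\<And>x. 0 \<le> \<eta> x" "\<And>x. \<eta> x \<le> 1"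
      "\<And>x. norm x > 2 \<Longrightarrow> \<eta> x = 0" "\<And>b x. b \<in> Basis \<Longrightarrow> \<bar>frechet_derivative \<eta> (at x) b\<bar> \<le> C"
    and R: "R > 0"
  shows "measure lebesgue {x \<in> ball x0 R. u x \<noteq> a}
    \<le> 4 * real DIM('a) * (C / R * M)\<^sup>2 * measure lebesgue (ball x0 (3 * R))"
proof -
  define \<Omega> where "\<Omega> = ball x0 (3 * R)"
  define K where "K = cball x0 (2 * R)"
  define B where "B = cball x0 (3 * R)"
  have \<Omega>: "open \<Omega>" "\<Omega> \<in> sets lebesgue" "\<Omega> \<in> lmeasurable" by (auto simp: \<Omega>_def)
  have K: "compact K" "K \<subseteq> \<Omega>" using R by (auto simp: K_def \<Omega>_def)
  have B: "compact B" "\<Omega> \<subseteq> B" "K \<subseteq> B" "B \<in> sets lebesgue" using R by (auto simp: B_def \<Omega>_def K_def)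
  have "\<forall>b\<in>Basis. \<exists>g. has_weak_partial UNIV b u g \<and> (\<forall>K. compact K \<longrightarrow> L2_on K g)"
    using min by (auto simp: J_minimizer_def W12_loc_def)
  then obtain g0 where g0: "\<And>b. b \<in> Basis \<Longrightarrow> has_weak_partial UNIV b u (g0 b)"
    "\<And>b. b \<in> Basis \<Longrightarrow> L2_on B (g0 b)"
    using B(1) by metis
  \<comment> \<open>The weak derivatives of \<open>u\<close> are only locally in L^2. Cutting them
    off outside \<open>B\<close> makes them globally square integrable without changing them on
    \<Omega>.\<close>
  define g where "g = (\<lambda>b x. if x \<in> B then g0 b x else 0)"
  have gm: "g b \<in> borel_measurable lebesgue" if "b \<in> Basis" for b
    using g0(2)[OF that] B(4) unfolding g_def L2_on_def by (intro borel_measurable_if_I) auto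
  have gi: "integrable lebesgue (\<lambda>x. (norm (g b x))\<^sup>2)" if "b \<in> Basis" for b
  proof -
    have "integrable lebesgue (\<lambda>x. if x \<in> B then (norm (g0 b x))\<^sup>2 else 0)"
      using g0(2)[OF that] B(4) by (simp add: L2_on_def Lebesgue_Measure.integrable_restrict_UNIV)
    also have "(\<lambda>x. if x \<in> B then (norm (g0 b x))\<^sup>2 else 0) = (\<lambda>x. (norm (g b x))\<^sup>2)"
      by (auto simp: g_def)
    finally show ?thesis .
  qed

  define h where "h = (\<lambda>x. \<eta> ((1 / R) *\<^sub>R (x - x0)))"
  have hC: "Ck_fun k h" for k
    unfolding h_def by (rule Ck_fun_affine[OF test_fun_on_Ck[OF \<eta>(1)]])
  have h1: "h x = 1" if "x \<in> ball x0 R" for x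
    using that R unfolding h_def by (intro \<eta>(2)) (simp add: dist_norm norm_minus_commute)
  have h0: "h x = 0" if "x \<notin> K" for x
  proof -
    have "norm ((1 / R) *\<^sub>R (x - x0)) = norm (x - x0) / R" using R by (simp only: norm_scaleR) simp
    moreover have "norm (x - x0) > 2 * R" using that by (simp add: K_def dist_norm norm_minus_commute)
    ultimately show ?thesis using R unfolding h_def by (intro \<eta>(5)) (simp only: less_divide_eq if_True)
  qed
  have h01: "0 \<le> h x" "h x \<le> 1" for x using \<eta> by (auto simp: h_def)
  define dh where "dh = (\<lambda>b x. frechet_derivative h (at x) b)"
  have dh: "\<bar>dh b x\<bar> \<le> C / R" if "b \<in> Basis" for b x
    using frechet_derivative_affine[OF test_fun_on_differentiable[OF \<eta>(1)], of "1 / R" x0 x b] \<eta>(6)[OF that] R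
    by (simp add: dh_def h_def abs_mult divide_right_mono)
  have dh0: "dh b x = 0" if "x \<notin> K" for b x
    using frechet_derivative_eq_0[OF compact_imp_closed[OF K(1)] h0 that] by (simp add: dh_def)
  \<comment> \<open>Minus the squared cut-off, so that u + v = u - h^2 (u - a). Writing it as a
    product lets smoothness and its derivative follow from the product rule.\<close>
  define \<psi> where "\<psi> = (\<lambda>x. (- h x) *\<^sub>R h x)"
  have mh: "Ck_fun k (\<lambda>x. - h x)" for k
    by (rule Ck_fun_bounded_linear_comp[OF bounded_linear_minus[OF bounded_linear_ident] hC])
  have \<psi>C: "Ck_fun k \<psi>" for k
    unfolding \<psi>_def by (rule Ck_fun_scaleR[OF mh hC])
  have d\<psi>: "frechet_derivative \<psi> (at x) b = - (2 * h x * dh b x)" for b x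
  proof -
    have d: "(h has_derivative frechet_derivative h (at x)) (at x)" by (rule Ck_fun_has_derivative[OF hC])
    have "(\<psi> has_derivative (\<lambda>k. (- h x) *\<^sub>R frechet_derivative h (at x) k + (- frechet_derivative h (at x) k) *\<^sub>R h x)) (at x)"
      unfolding \<psi>_def by (rule has_derivative_scaleR[OF has_derivative_minus[OF d] d])
    then show ?thesis by (simp add: frechet_derivative_at[symmetric] dh_def)
  qed
  define w where "w = (\<lambda>x. u x - a)"
  have wc: "continuous_on UNIV w" unfolding w_def by (intro continuous_intros uc)
  have wg: "has_weak_partial UNIV b w (g0 b)" if "b \<in> Basis" for b
    using has_weak_partial_diff[OF open_UNIV that g0(1)[OF that] has_weak_partial_const[OF that]] by (simp add: w_def)
  define v where "v = (\<lambda>x. \<psi> x *\<^sub>R w x)"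
  have v0: "v x = 0" if "x \<notin> K" for x using h0[OF that] by (simp add: v_def \<psi>_def)
  have \<psi>c: "continuous_on UNIV \<psi>" by (rule Ck_fun_continuous_on[OF \<psi>C])
  have vc: "continuous_on UNIV v" unfolding v_def by (intro continuous_intros \<psi>c wc)
  have vm: "v \<in> borel_measurable lebesgue" by (rule continuous_on_UNIV_borel_measurable_lebesgue[OF vc])
  define G where "G = (\<lambda>b x. \<psi> x *\<^sub>R g b x + (- (2 * h x * dh b x)) *\<^sub>R w x)"
  have vG: "has_weak_partial UNIV b v (G b)" if b: "b \<in> Basis" for b
  proof -
    have "has_weak_partial UNIV b v (\<lambda>x. \<psi> x *\<^sub>R g0 b x + frechet_derivative \<psi> (at x) b *\<^sub>R w x)"
      unfolding v_def by (rule has_weak_partial_scaleR[OF open_UNIV b wg[OF b] \<psi>C])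
    \<comment> \<open>The truncation of the derivative is invisible here, since \<psi> vanishes off
      \<open>K\<close> and \<open>K\<close> lies in \<open>B\<close>.\<close>
    moreover have "\<psi> x *\<^sub>R g0 b x = \<psi> x *\<^sub>R g b x" for x
      using h0[of x] B(3) by (cases "x \<in> K") (auto simp: \<psi>_def g_def)
    ultimately show ?thesis by (simp add: G_def d\<psi>)
  qed
  have dhC: "Ck_fun k (dh b)" if "b \<in> Basis" for b k
    using hC[of "Suc k"] that by (simp add: dh_def)
  have cc: "continuous_on UNIV (\<lambda>x. (- (2 * h x * dh b x)) *\<^sub>R w x)" if "b \<in> Basis" for b
    by (intro continuous_intros Ck_fun_continuous_on[OF hC] Ck_fun_continuous_on[OF dhC[OF that]] wc)
  have Gm: "G b \<in> borel_measurable lebesgue" if b: "b \<in> Basis" for b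
    unfolding G_def
    by (intro borel_measurable_add borel_measurable_scaleR[of \<psi>] gm[OF b]
        continuous_on_UNIV_borel_measurable_lebesgue[OF cc[OF b]]
        continuous_on_UNIV_borel_measurable_lebesgue[OF \<psi>c])
  have \<psi>1: "\<bar>\<psi> x\<bar> \<le> 1" for x
    using h01[of x] mult_mono[of "h x" 1 "h x" 1] by (simp add: \<psi>_def abs_mult)
  have Gi: "integrable lebesgue (\<lambda>x. (norm (G b x))\<^sup>2)" if b: "b \<in> Basis" for b
  proof (rule Bochner_Integration.integrable_bound)
    let ?q = "\<lambda>x. (- (2 * h x * dh b x)) *\<^sub>R w x"
    have "integrable lebesgue (\<lambda>x. (norm (?q x))\<^sup>2)"
    proof (rule integrable_compact_support[OF _ K(1)])
      show "continuous_on UNIV (\<lambda>x. (norm (?q x))\<^sup>2)" by (intro continuous_on_power continuous_on_norm cc[OF b])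
      show "(norm (?q x))\<^sup>2 = 0" if "x \<notin> K" for x using h0[OF that] by simp
    qed
    then show "integrable lebesgue (\<lambda>x. 2 * (norm (g b x))\<^sup>2 + 2 * (norm (?q x))\<^sup>2)"
      using gi[OF b] by (intro Bochner_Integration.integrable_add integrable_mult_right)
    show "(\<lambda>x. (norm (G b x))\<^sup>2) \<in> borel_measurable lebesgue" using Gm[OF b] by auto
    have "(norm (G b x))\<^sup>2 \<le> 2 * (norm (g b x))\<^sup>2 + 2 * (norm (?q x))\<^sup>2" for x
    proof -
      have "norm (\<psi> x *\<^sub>R g b x) \<le> norm (g b x)"
        using \<psi>1[of x] by (simp add: mult_left_le_one_le)
      then have "(norm (\<psi> x *\<^sub>R g b x))\<^sup>2 \<le> (norm (g b x))\<^sup>2" by (rule power_mono) simp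
      then show ?thesis
        using norm_add_sq_le[of "\<psi> x *\<^sub>R g b x" "?q x"] unfolding G_def by linarith
    qed
    then show "AE x in lebesgue. norm ((norm (G b x))\<^sup>2) \<le> norm (2 * (norm (g b x))\<^sup>2 + 2 * (norm (?q x))\<^sup>2)"
      by (intro AE_I2) (simp add: abs_of_nonneg)
  qed
  have G0: "G b x = 0" if "x \<notin> K" for b x using h0[OF that] by (simp add: G_def \<psi>_def)
  have vi: "integrable lebesgue (\<lambda>x. (norm (v x))\<^sup>2)"
  proof (rule integrable_compact_support[OF _ K(1)])
    show "continuous_on UNIV (\<lambda>x. (norm (v x))\<^sup>2)" by (intro continuous_on_power continuous_on_norm vc)
    show "(norm (v x))\<^sup>2 = 0" if "x \<notin> K" for x using v0[OF that] by simp
  qed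
  have vW: "v \<in> W12_0 \<Omega>"
    by (rule compact_support_in_W12_0[OF \<Omega>(1) K vm vi v0 vG Gm Gi G0])
  have vL: "Linf_on \<Omega> v"
  proof -
    obtain c where c: "\<And>x. norm (v x) \<le> c" using compact_support_bounded[OF vc K(1) v0] by metis
    have m: "v \<in> borel_measurable (lebesgue_on \<Omega>)" using vm by (rule measurable_restrict_space1)
    have "Linf_norm \<Omega> v \<le> ereal c"
      unfolding Linf_norm_def by (rule esssup_I) (use m c in auto)
    then have "Linf_norm \<Omega> v < \<infinity>" by (rule order.strict_trans1) simp
    then show ?thesis using m by (simp add: Linf_on_def)
  qed
  have "bounded_lipschitz_open \<Omega>" unfolding \<Omega>_def by (rule bounded_lipschitz_open_ball) (use R in simp)
  then have J: "J_on A \<Omega> u \<le> J_on A \<Omega> (\<lambda>x. u x + v x)"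
    using min vW vL by (auto simp: J_minimizer_def)

  \<comment> \<open>Energy densities of \<open>u\<close> and of the competitor, written with
    explicit derivatives; they replace the integrands of \<open>J_on\<close> almost everywhere in
    \<Omega>.\<close>
  define E1 where "E1 = (\<lambda>x. 1 / 2 * (\<Sum>b\<in>Basis. (norm (g b x))\<^sup>2) + indicator (- A) (u x) :: real)"
  define E2 where "E2 = (\<lambda>x. 1 / 2 * (\<Sum>b\<in>Basis. (norm (g b x + G b x))\<^sup>2) + indicator (- A) (u x + v x) :: real)"
  have J1: "J_on A \<Omega> u = (\<integral>\<^sup>+x. ennreal (E1 x) \<partial>lebesgue_on \<Omega>)"
  proof -
    have "AE x in lebesgue_on \<Omega>. \<forall>b\<in>Basis. weak_partial \<Omega> b u x = g0 b x"
      using weak_partial_AE_eq[OF \<Omega>(1) has_weak_partial_subset[OF g0(1) \<Omega>(1)]] by (intro AE_finite_allI) auto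
    moreover have "AE x in lebesgue_on \<Omega>. x \<in> \<Omega>" by (rule AE_I2) simp
    ultimately have "AE x in lebesgue_on \<Omega>.
        ennreal (1 / 2 * weak_grad_normsq \<Omega> u x + indicator (- A) (u x)) = ennreal (E1 x)"
      by eventually_elim (use B(2) in \<open>auto simp: E1_def weak_grad_normsq_def g_def\<close>)
    then show ?thesis unfolding J_on_def by (rule nn_integral_cong_AE)
  qed
  have J2: "J_on A \<Omega> (\<lambda>x. u x + v x) = (\<integral>\<^sup>+x. ennreal (E2 x) \<partial>lebesgue_on \<Omega>)"
  proof -
    have "has_weak_partial UNIV b (\<lambda>x. u x + v x) (\<lambda>x. g0 b x + G b x)" if b: "b \<in> Basis" for b
      using has_weak_partial_diff[OF open_UNIV b g0(1)[OF b]
          has_weak_partial_diff[OF open_UNIV b has_weak_partial_const[OF b, of 0] vG[OF b]]] by simp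
    then have "AE x in lebesgue_on \<Omega>. \<forall>b\<in>Basis. weak_partial \<Omega> b (\<lambda>x. u x + v x) x = g0 b x + G b x"
      using weak_partial_AE_eq[OF \<Omega>(1) has_weak_partial_subset[OF _ \<Omega>(1)]] by (intro AE_finite_allI) auto
    moreover have "AE x in lebesgue_on \<Omega>. x \<in> \<Omega>" by (rule AE_I2) simp
    ultimately have "AE x in lebesgue_on \<Omega>.
        ennreal (1 / 2 * weak_grad_normsq \<Omega> (\<lambda>x. u x + v x) x + indicator (- A) (u x + v x)) = ennreal (E2 x)"
      by eventually_elim (use B(2) in \<open>auto simp: E2_def weak_grad_normsq_def g_def\<close>)
    then show ?thesis unfolding J_on_def by (rule nn_integral_cong_AE)
  qed

  define S where "S = {x \<in> ball x0 R. u x \<noteq> a}"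
  have "S = ball x0 R \<inter> u -` (- {a})" by (auto simp: S_def)
  then have "open S"
    using open_vimage[OF _ uc, of "- {a}"] by (auto simp: open_Compl)
  then have S: "S \<in> sets lebesgue" "S \<subseteq> \<Omega>" using R by (auto simp: S_def \<Omega>_def)
  define \<kappa> where "\<kappa> = 4 * real DIM('a) * (C / R * M)\<^sup>2"
  have \<kappa>: "\<kappa> \<ge> 0" by (simp add: \<kappa>_def)
  have E2m: "E2 \<in> borel_measurable lebesgue" and E1m: "E1 \<in> borel_measurable lebesgue"
  proof -
    have ind: "(\<lambda>x. indicator (- A) (f x) :: real) \<in> borel_measurable lebesgue"
      if "continuous_on UNIV f" for f :: "'a \<Rightarrow> 'b"
    \<comment> \<open>Since \<open>A\<close> is closed, the indicator of its complement, composed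
      with a continuous function, is the indicator of an open set and thus measurable.\<close>
    proof -
      have "open (f -` (- A))" using A(1) that by (intro open_vimage) auto
      then have "(indicator (f -` (- A)) :: 'a \<Rightarrow> real) \<in> borel_measurable lebesgue"
        by (intro borel_measurable_indicator) auto
      moreover have "(indicator (f -` (- A)) :: 'a \<Rightarrow> real) = (\<lambda>x. indicator (- A) (f x))"
        by (rule ext) (simp add: indicator_def)
      ultimately show ?thesis by simp
    qed
    have "(\<lambda>x. \<Sum>b\<in>Basis. (norm (g b x + G b x))\<^sup>2) \<in> borel_measurable lebesgue"
    proof (intro borel_measurable_sum borel_measurable_power)
      show "(\<lambda>x. norm (g b x + G b x)) \<in> borel_measurable lebesgue" if "b \<in> Basis" for b
        using gm[OF that] Gm[OF that] by measurable
    qed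
    then show "E2 \<in> borel_measurable lebesgue"
      unfolding E2_def by (intro borel_measurable_add borel_measurable_times ind continuous_intros uc vc) auto
    have "(\<lambda>x. \<Sum>b\<in>Basis. (norm (g b x))\<^sup>2) \<in> borel_measurable lebesgue"
    proof (intro borel_measurable_sum borel_measurable_power)
      show "(\<lambda>x. norm (g b x)) \<in> borel_measurable lebesgue" if "b \<in> Basis" for b
        using gm[OF that] by measurable
    qed
    then show "E1 \<in> borel_measurable lebesgue"
      unfolding E1_def by (intro borel_measurable_add borel_measurable_times ind uc) auto
  qed
  have pt: "E2 x + indicator S x \<le> E1 x + \<kappa>" if Mx: "norm (w x) \<le> M" for x
  proof -
    have "(norm (g b x + G b x))\<^sup>2 \<le> (norm (g b x))\<^sup>2 + 8 * (C / R * M)\<^sup>2" if b: "b \<in> Basis" for b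
    proof -
      have "g b x + G b x = (1 - (h x)\<^sup>2) *\<^sub>R g b x - (2 * h x * dh b x) *\<^sub>R w x"
        by (simp add: G_def \<psi>_def scaleR_diff_left power2_eq_square)
      then have "(norm (g b x + G b x))\<^sup>2 \<le> (norm (g b x))\<^sup>2 + 8 * (\<bar>dh b x\<bar> * norm (w x))\<^sup>2"
        using cutoff_gradient_bound[OF h01[of x]] by simp
      moreover have "(\<bar>dh b x\<bar> * norm (w x))\<^sup>2 \<le> (C / R * M)\<^sup>2"
        using dh[OF b, of x] Mx by (intro power_mono mult_mono) auto
      ultimately show ?thesis by linarith
    qed
    then have "(\<Sum>b\<in>Basis. (norm (g b x + G b x))\<^sup>2) \<le> (\<Sum>b\<in>(Basis::'a set). (norm (g b x))\<^sup>2 + 8 * (C / R * M)\<^sup>2)"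
      by (rule sum_mono)
    then have "1 / 2 * (\<Sum>b\<in>Basis. (norm (g b x + G b x))\<^sup>2) \<le> 1 / 2 * (\<Sum>b\<in>(Basis::'a set). (norm (g b x))\<^sup>2) + \<kappa>"
      by (simp add: sum.distrib \<kappa>_def)
    \<comment> \<open>On \<open>S\<close> the competitor takes the value \<open>a\<close>, so its
      indicator drops from 1 to 0 and pays for the indicator of \<open>S\<close>. Elsewhere either u
      x = a and v x = 0, or the indicator for \<open>u\<close> is already 1.\<close>
    moreover have "indicator (- A) (u x + v x) + indicator S x \<le> (indicator (- A) (u x) :: real)"
    proof (cases "u x = a")
      case True
      then show ?thesis using A(2) by (simp add: v_def w_def S_def)
    next
      case False
      then have uA: "u x \<notin> A" using avoid by blast
      show ?thesis
      proof (cases "x \<in> S")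
        case True
        then have "u x + v x = a" using h1[of x] by (simp add: S_def v_def w_def \<psi>_def)
        then show ?thesis using uA A(2) True by simp
      qed (use uA in \<open>simp add: indicator_def\<close>)
    qed
    ultimately show ?thesis unfolding E1_def E2_def by linarith
  qed
  have E_nonneg: "E1 x \<ge> 0" "E2 x \<ge> 0" for x by (auto simp: E1_def E2_def intro!: add_nonneg_nonneg sum_nonneg)
  have Sint: "emeasure lebesgue S = (\<integral>\<^sup>+x. indicator S x \<partial>lebesgue_on \<Omega>)"
    using S \<Omega>(2) by (subst nn_integral_indicator) (auto simp: sets_restrict_space_iff emeasure_restrict_space)
  have "(\<integral>\<^sup>+x. ennreal (E1 x) \<partial>lebesgue_on \<Omega>) + emeasure lebesgue S
      \<le> (\<integral>\<^sup>+x. ennreal (E2 x) \<partial>lebesgue_on \<Omega>) + emeasure lebesgue S"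
    using J unfolding J1 J2 by (rule add_right_mono)
  also have "\<dots> = (\<integral>\<^sup>+x. ennreal (E2 x) + indicator S x \<partial>lebesgue_on \<Omega>)"
    unfolding Sint
  proof (rule nn_integral_add[symmetric])
    show "(\<lambda>x. ennreal (E2 x)) \<in> borel_measurable (lebesgue_on \<Omega>)"
      using measurable_restrict_space1[OF E2m] by measurable
    show "indicator S \<in> borel_measurable (lebesgue_on \<Omega>)"
      using S \<Omega>(2) by (intro borel_measurable_indicator) (auto simp: sets_restrict_space_iff)
  qed
  also have "\<dots> \<le> (\<integral>\<^sup>+x. ennreal (E1 x) + ennreal \<kappa> \<partial>lebesgue_on \<Omega>)"
  proof (rule nn_integral_mono_AE)
    have "AE x in lebesgue_on \<Omega>. norm (w x) \<le> M"
      using M \<Omega>(2) by (auto simp: AE_restrict_space_iff w_def elim: eventually_mono)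
    then show "AE x in lebesgue_on \<Omega>. ennreal (E2 x) + indicator S x \<le> ennreal (E1 x) + ennreal \<kappa>"
    proof (rule eventually_mono)
      fix x assume "norm (w x) \<le> M"
      have "ennreal (E2 x) + indicator S x = ennreal (E2 x + indicator S x)"
        using E_nonneg[of x] by (simp add: ennreal_plus indicator_def)
      also have "\<dots> \<le> ennreal (E1 x + \<kappa>)" by (rule ennreal_leI[OF pt[OF \<open>norm (w x) \<le> M\<close>]])
      also have "\<dots> = ennreal (E1 x) + ennreal \<kappa>" using E_nonneg[of x] \<kappa> by (simp add: ennreal_plus)
      finally show "ennreal (E2 x) + indicator S x \<le> ennreal (E1 x) + ennreal \<kappa>" .
    qed
  qed
  also have "\<dots> = (\<integral>\<^sup>+x. ennreal (E1 x) \<partial>lebesgue_on \<Omega>) + ennreal \<kappa> * emeasure lebesgue \<Omega>"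
  proof -
    have "(\<lambda>x. ennreal (E1 x)) \<in> borel_measurable (lebesgue_on \<Omega>)"
      using measurable_restrict_space1[OF E1m] by measurable
    then show ?thesis
      using \<Omega>(2) by (simp add: nn_integral_add emeasure_restrict_space)
  qed
  finally have le: "(\<integral>\<^sup>+x. ennreal (E1 x) \<partial>lebesgue_on \<Omega>) + emeasure lebesgue S
      \<le> (\<integral>\<^sup>+x. ennreal (E1 x) \<partial>lebesgue_on \<Omega>) + ennreal \<kappa> * emeasure lebesgue \<Omega>" .
  \<comment> \<open>Subtraction of the energy of \<open>u\<close> is legitimate in the extended
    reals only when it is finite. This follows from square integrability of the \<open>g b\<close>
    and finite volume of \<Omega>.\<close>
  have "integrable (lebesgue_on \<Omega>) (\<lambda>x. 1 / 2 * (\<Sum>b\<in>Basis. (norm (g b x))\<^sup>2) + 1)"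
  proof -
    have "integrable lebesgue (\<lambda>x. 1 / 2 * (\<Sum>b\<in>Basis. (norm (g b x))\<^sup>2))"
      using gi by (intro integrable_mult_right Bochner_Integration.integrable_sum)
    then have "integrable (lebesgue_on \<Omega>) (\<lambda>x. 1 / 2 * (\<Sum>b\<in>Basis. (norm (g b x))\<^sup>2))"
      using integrable_lebesgue_on_subset[of UNIV _ \<Omega>] \<Omega>(2) by (simp add: lebesgue_on_UNIV_eq)
    moreover have "integrable (lebesgue_on \<Omega>) (\<lambda>x. 1 :: real)"
      using finite_measure.integrable_const[OF finite_measure_lebesgue_on[OF \<Omega>(3)]] by blast
    ultimately show ?thesis by (rule Bochner_Integration.integrable_add)
  qed
  then have "(\<integral>\<^sup>+x. ennreal (norm (1 / 2 * (\<Sum>b\<in>Basis. (norm (g b x))\<^sup>2) + 1)) \<partial>lebesgue_on \<Omega>) < \<infinity>"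
    by (simp add: integrable_iff_bounded)
  moreover have "(\<integral>\<^sup>+x. ennreal (E1 x) \<partial>lebesgue_on \<Omega>)
      \<le> (\<integral>\<^sup>+x. ennreal (norm (1 / 2 * (\<Sum>b\<in>Basis. (norm (g b x))\<^sup>2) + 1)) \<partial>lebesgue_on \<Omega>)"
  proof (intro nn_integral_mono ennreal_leI)
    fix x
    have "0 \<le> (\<Sum>b\<in>Basis. (norm (g b x))\<^sup>2)" by (simp add: sum_nonneg)
    then show "E1 x \<le> norm (1 / 2 * (\<Sum>b\<in>Basis. (norm (g b x))\<^sup>2) + 1)"
      by (simp add: E1_def indicator_def)
  qed
  ultimately have "(\<integral>\<^sup>+x. ennreal (E1 x) \<partial>lebesgue_on \<Omega>) \<noteq> \<infinity>" by auto
  then have "emeasure lebesgue S \<le> ennreal \<kappa> * emeasure lebesgue \<Omega>"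
    using le by (simp add: ennreal_add_left_cancel_le)
  also have "\<dots> = ennreal (\<kappa> * measure lebesgue \<Omega>)"
    by (simp only: emeasure_eq_measure2[OF \<Omega>(3)] ennreal_mult[OF \<kappa> measure_nonneg])
  finally have "measure lebesgue S \<le> \<kappa> * measure lebesgue \<Omega>"
    using \<kappa> by (intro enn2real_leI[of "\<kappa> * measure lebesgue \<Omega>" "emeasure lebesgue S", folded measure_def]) auto
  then show ?thesis by (simp only: S_def \<kappa>_def \<Omega>_def)
qed

theorem proposition2:
  fixes A :: "(real ^ 'm) set"
    and u :: "real ^ 'n \<Rightarrow> real ^ 'm"
    and x0 :: "real ^ 'n"
    and a :: "real ^ 'm"
  assumes "finite A" and "card A \<ge> 2"
    and "J_minimizer A u"
    and "continuous_on UNIV u"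
    and "\<not> u constant_on UNIV"
    and "Linf_norm UNIV u < \<infinity>"
    and "a \<in> A"
  shows "\<exists>c>0. \<exists>R0>0. \<forall>R\<ge>R0.
           setdist (u ` ball x0 R) (A - {a}) > 0 \<longrightarrow>
           measure lebesgue ({x. u x = a} \<inter> ball x0 R) \<ge> c * R ^ CARD('n)"
proof (cases "\<exists>R1. \<forall>R\<ge>R1. \<not> setdist (u ` ball x0 R) (A - {a}) > 0")
  case True
  then obtain R1 where "\<forall>R\<ge>R1. \<not> setdist (u ` ball x0 R) (A - {a}) > 0" by blast
  \<comment> \<open>Beyond \<open>R1\<close> the implication is vacuous, so any positive constant
    serves.\<close>
  then show ?thesis by (intro exI[of _ 1] conjI exI[of _ "max R1 1"]) auto
next
  case False
  have avoid: "u x = a" if "u x \<in> A" for x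
  proof (rule ccontr)
    assume "u x \<noteq> a"
    \<comment> \<open>The radii with positive distance are unbounded, so one of them encloses x. If
      u x were in \<open>A - {a}\<close>, it would be common to both sets and force the distance to
      be 0.\<close>
    obtain R where R: "R \<ge> dist x0 x + 1" "setdist (u ` ball x0 R) (A - {a}) > 0" using False by blast
    have "x \<in> ball x0 R" using R(1) by simp
    then have "setdist (u ` ball x0 R) (A - {a}) = 0"
      using \<open>u x \<in> A\<close> \<open>u x \<noteq> a\<close> by (intro setdist_eq_0I[of "u x"]) auto
    then show False using R(2) by simp
  qed
  obtain M where M: "AE x in lebesgue. norm (u x - a) \<le> M"
  proof -
    obtain B where B: "Linf_norm UNIV u \<le> ereal B"
      using assms(6) by (cases "Linf_norm UNIV u") auto
    have "AE x in lebesgue. ereal (norm (u x)) \<le> Linf_norm UNIV u"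
      using esssup_AE[of "\<lambda>x. ereal (norm (u x))" lebesgue] by (simp add: Linf_norm_def lebesgue_on_UNIV_eq)
    then have "AE x in lebesgue. norm (u x - a) \<le> B + norm a"
    proof (rule eventually_mono)
      fix x assume "ereal (norm (u x)) \<le> Linf_norm UNIV u"
      then have "norm (u x) \<le> B" using B by (metis ereal_less_eq(3) order.trans)
      then show "norm (u x - a) \<le> B + norm a" using norm_triangle_ineq4[of "u x" a] by linarith
    qed
    then show thesis by (rule that)
  qed
  from unit_cutoff obtain \<eta> :: "real ^ 'n \<Rightarrow> real" and C where "test_fun_on UNIV \<eta> \<and>
    (\<forall>x. norm x \<le> 1 \<longrightarrow> \<eta> x = 1) \<and> (\<forall>x. 0 \<le> \<eta> x \<and> \<eta> x \<le> 1) \<and> (\<forall>x. norm x > 2 \<longrightarrow> \<eta> x = 0) \<and>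
    (\<forall>b\<in>Basis. \<forall>x. \<bar>frechet_derivative \<eta> (at x) b\<bar> \<le> C)"
    by (elim exE)
  then have \<eta>: "test_fun_on UNIV \<eta>" "\<And>x. norm x \<le> 1 \<Longrightarrow> \<eta> x = 1" "\<And>x. 0 \<le> \<eta> x"
    "\<And>x. \<eta> x \<le> 1" "\<And>x. norm x > 2 \<Longrightarrow> \<eta> x = 0"
    "\<And>b x. b \<in> Basis \<Longrightarrow> \<bar>frechet_derivative \<eta> (at x) b\<bar> \<le> C"
    by simp_all
  let ?n = "CARD('n)"
  \<comment> \<open>Chosen so that 4 n (C M / R)^2 times the volume of the ball of radius 3R equals
    Q / R^2 times half the volume of the ball of radius R: the factor 3^n comes from the radius, and
    8 is 4 doubled by the half.\<close>
  define Q where "Q = 8 * real ?n * (C * M)\<^sup>2 * 3 ^ ?n"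
  have Q: "Q \<ge> 0" by (simp add: Q_def)
  define \<omega> where "\<omega> = unit_ball_vol (real ?n)"
  have \<omega>: "\<omega> > 0" by (simp add: \<omega>_def)
  have vol: "measure lebesgue (ball x0 r) = \<omega> * r ^ ?n" if "r \<ge> 0" for r
    using content_ball[OF that, of x0] by (simp add: \<omega>_def)
  have "\<omega> / 2 * R ^ ?n \<le> measure lebesgue ({x. u x = a} \<inter> ball x0 R)" if R: "R \<ge> max 1 Q" for R
  proof -
    have R0: "R > 0" using R by simp
    let ?S = "{x \<in> ball x0 R. u x \<noteq> a}"
    have "measure lebesgue ?S \<le> 4 * real DIM(real ^ 'n) * (C / R * M)\<^sup>2 * measure lebesgue (ball x0 (3 * R))"
      by (rule minimizer_measure_bound[OF finite_imp_closed[OF assms(1)] assms(7,3,4) avoid M \<eta> R0])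
    also have "\<dots> = Q / R\<^sup>2 * (\<omega> / 2 * R ^ ?n)"
      using R0 vol[of "3 * R"] by (simp add: Q_def power_mult_distrib power_divide field_simps)
    also have "\<dots> \<le> 1 * (\<omega> / 2 * R ^ ?n)"
    proof (rule mult_right_mono)
      \<comment> \<open>Both lower bounds on R enter: R \<ge> Q here, and R \<ge> 1 to pass from R
        to R^2.\<close>
      have "Q \<le> R * 1" using R by simp
      also have "\<dots> \<le> R * R" using R by (intro mult_left_mono) auto
      finally show "Q / R\<^sup>2 \<le> 1" using R0 by (simp add: power2_eq_square)
    qed (use R0 \<omega> in auto)
    finally have S: "measure lebesgue ?S \<le> \<omega> / 2 * R ^ ?n" by simp
    have eq: "{x. u x = a} \<inter> ball x0 R = ball x0 R - ?S" by auto
    have "?S = ball x0 R \<inter> u -` (- {a})" by auto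
    then have "open ?S"
      using open_vimage[OF _ assms(4), of "- {a}"] by (auto simp: open_Compl)
    then have "?S \<in> lmeasurable" by (intro lmeasurable_open) (auto intro: bounded_subset[OF bounded_ball])
    then have "measure lebesgue (ball x0 R - ?S) = measure lebesgue (ball x0 R) - measure lebesgue ?S"
      by (intro measurable_measure_Diff) auto
    then show ?thesis using S vol[of R] R0 unfolding eq by simp
  qed
  then show ?thesis using \<omega> by (intro exI[of _ "\<omega> / 2"] conjI exI[of _ "max 1 Q"]) auto
qed

end
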